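(* Let $\gamma\in\mathbb{R}$ with $|\gamma|<\sqrt{d_H/C_0}$, let $\nu^\gamma$ be the Liouville quantum gravity (LQG) measure on the Sierpinski gasket $K$, and let $\sigma_1,\sigma_2,\sigma_3$ be the reflections of $\mathbb{R}^2$ about the three axes of symmetry of $K$. For any $i=1,2,3$, $$\nu^\gamma\stackrel{d}{=}(\sigma_i)_\#\nu^\gamma$$ (equality in law of random measures on $K$, where $(\sigma_i)_\#\nu^\gamma$ is the push-forward of $\nu^\gamma$ under $\sigma_i$).
   Context: Sierpinski gasket: $V_0=\{p_1,p_2,p_3\}\subset\mathbb{R}^2$ are the vertices of an equilateral triangle of side length one, $F_i(p)=\frac12(p-p_i)+p_i$, and $K$ is the unique non-empty compact set with $K=\bigcup_{i=1}^3F_i(K)$. For a word $w=w_1\ldots w_m\in\{1,2,3\}^m$, $F_w=F_{w_1}\circ\cdots\circ F_{w_m}$. $K$ carries the Euclidean metric $d$ and the self-similar Borel probability measure $\mu$ with $\mu(F_w(K))=3^{-m}$ for all $w\in\{1,2,3\}^m$. Put $d_H=\frac{\log 3}{\log 2}$, $d_W=\frac{\log 5}{\log 2}$, $d_S=\frac{2d_H}{d_W}=\frac{\log 9}{\log 5}$. $L^2(K)=L^2(K,\mu)$ with inner product $\langle\cdot,\cdot\rangle$. The three axes of symmetry are the lines through one vertex $p_i$ and the midpoint of the opposite side; each $\sigma_i$ maps $K$ onto $K$. Dirichlet Laplacian: with $V_n=\bigcup_{|w|=n}F_w(V_0)$ and $x\sim y$ meaning that $x\neq y$ lie in a common $F_w(V_0)$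 with $|w|=n$, let $\mathcal{E}(u,v)=\lim_{n\to\infty}(5/3)^n\sum_{x,y\in V_n,\,x\sim y}(u(x)-u(y))(v(x)-v(y))$ on $\mathcal{F}=\{u\in C(K):\mathcal{E}(u,u)<\infty,\ u|_{V_0}=0\}$. Its generator $\Delta$ on $L^2(K)$ is the Dirichlet Laplacian, with heat kernel $p_t(x,y)$. $-\Delta$ has eigenvalues $0<\lambda_1\le\lambda_2\le\cdots$ (with multiplicity) and an $L^2(K)$-orthonormal basis of eigenfunctions $\varphi_k$. Riesz kernel: $k_{s}(x,y)=\frac1{\Gamma(s/2)}\int_0^\infty t^{s/2-1}p_t(x,y)\,dt$ for $x\neq y$. It is known that there are constants $c_0,C_0>0$ with $c_0\log\frac1{d(x,y)}\le k_{d_S}(x,y)\le C_0\big(1+\log\frac1{d(x,y)}\big)$; such a $C_0$ is fixed. $H^{-\varepsilon}(K)$, $\varepsilon>0$, is the completion of $L^2(K)$ with respect to $\|v\|_{H^{-\varepsilon}}^2=\sum_k\lambda_k^{-\varepsilon}\langle v,\varphi_k\rangle^2$. Field: let $\{\xi_k\}_{k\ge1}$ be i.i.d. standard normal random variables on $(\Omega,\mathbb{P})$, $N_\ell=\frac12(3^{\ell+1}-3)$, and $h_\ell(x)=\sum_{k=1}^{N_\ell}\xi_k\lambda_k^{-d_S/4}\varphi_k(x)$. The fractal Gaussian free field (FGFF) on $K$ is $h=\sum_{k\ge1}\xi_k\lambda_k^{-d_S/4}\varphi_k$, the $\mathbb{P}$-a.s. limit of $h_\ell$ in $H^{-\varepsilon}(K)$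 for every $\varepsilon>0$. LQG measure: $\nu^\gamma$ is the ($\mathbb{P}$-a.s. unique) $\sigma(h)$-measurable random Borel measure on $K$ such that $\mathbb{E}[\int_KF(h,x)\,d\nu^\gamma(x)]=\mathbb{E}[\int_KF(h+\gamma k_{d_S}(x,\cdot),x)\,d\mu(x)]$ for every nonnegative measurable $F$ on $H^{-\varepsilon}(K)\times K$ ($\varepsilon>0$ arbitrary). Equivalently, for every $u\in C_b(K)$, $\int_Ku\,d\nu^\gamma$ is the $L^2(\Omega)$-limit as $\ell\to\infty$ of $\int_Ku\,d\nu_\ell^\gamma$, where $d\nu_\ell^\gamma(x)=e^{\gamma h_\ell(x)-\frac{\gamma^2}{2}\mathbb{E}[h_\ell(x)^2]}\,d\mu(x)$. *)

theory Defs
  imports "HOL-Probability.Probability"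
begin

section \<open>The Sierpinski gasket\<close>

definition d_H :: real where "d_H = ln 3 / ln 2"
definition d_W :: real where "d_W = ln 5 / ln 2"
definition d_S :: real where "d_S = 2 * d_H / d_W"

definition unit_triangle :: "(3 \<Rightarrow> real^2) \<Rightarrow> bool" where
  "unit_triangle p \<longleftrightarrow> (\<forall>i j. i \<noteq> j \<longrightarrow> dist (p i) (p j) = 1)"

definition sg_map :: "(3 \<Rightarrow> real^2) \<Rightarrow> 3 \<Rightarrow> real^2 \<Rightarrow> real^2" where
  "sg_map p i x = (1/2) *\<^sub>R (x - p i) + p i"

definition sg_word :: "(3 \<Rightarrow> real^2) \<Rightarrow> 3 list \<Rightarrow> real^2 \<Rightarrow> real^2" where
  "sg_word p w = foldr (\<circ>) (map (sg_map p) w) id"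

text \<open>These properties determine \<open>K\<close> uniquely.\<close>
definition is_gasket :: "(3 \<Rightarrow> real^2) \<Rightarrow> (real^2) set \<Rightarrow> bool" where
  "is_gasket p K \<longleftrightarrow> compact K \<and> K \<noteq> {} \<and> K = (\<Union>i. sg_map p i ` K)"

abbreviation borel_on :: "'a::topological_space set \<Rightarrow> 'a measure" where
  "borel_on K \<equiv> restrict_space borel K"

definition is_self_similar_measure ::
    "(3 \<Rightarrow> real^2) \<Rightarrow> (real^2) set \<Rightarrow> (real^2) measure \<Rightarrow> bool" where
  "is_self_similar_measure p K \<mu> \<longleftrightarrow>
     prob_space \<mu> \<and> sets \<mu> = sets (borel_on K) \<and>
     (\<forall>w. measure \<mu> (sg_word p w ` K) = (1/3) ^ length w)"

text \<open>Addition in the index type \<open>3\<close> is modulo 3, so \<open>p (i + 1)\<close> and \<open>p (i + 2)\<close> are the end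
  points of the side opposite to \<open>p i\<close>.\<close>
definition sg_axis :: "(3 \<Rightarrow> real^2) \<Rightarrow> 3 \<Rightarrow> (real^2) set" where
  "sg_axis p i = affine hull {p i, midpoint (p (i + 1)) (p (i + 2))}"

text \<open>The midpoint of \<open>x\<close> and its mirror image is the orthogonal projection of \<open>x\<close> to the axis.\<close>
definition sg_reflection :: "(3 \<Rightarrow> real^2) \<Rightarrow> 3 \<Rightarrow> real^2 \<Rightarrow> real^2" where
  "sg_reflection p i x = 2 *\<^sub>R closest_point (sg_axis p i) x - x"

section \<open>The space of square-integrable functions\<close>

text \<open>Elements are functions, not classes; equality in \<open>L\<^sup>2\<close> is equality almost everywhere.\<close>
definition L2 :: "'a measure \<Rightarrow> ('a \<Rightarrow> real) set" where
  "L2 \<mu> = {f \<in> borel_measurable \<mu>. integrable \<mu> (\<lambda>x. (f x)\<^sup>2)}"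

definition L2_inner :: "'a measure \<Rightarrow> ('a \<Rightarrow> real) \<Rightarrow> ('a \<Rightarrow> real) \<Rightarrow> real" where
  "L2_inner \<mu> f g = (LINT x|\<mu>. f x * g x)"

definition L2_norm :: "'a measure \<Rightarrow> ('a \<Rightarrow> real) \<Rightarrow> real" where
  "L2_norm \<mu> f = sqrt (L2_inner \<mu> f f)"

section \<open>The Dirichlet Laplacian\<close>

definition sg_edges :: "(3 \<Rightarrow> real^2) \<Rightarrow> nat \<Rightarrow> ((real^2) \<times> (real^2)) set" where
  "sg_edges p n = {(x, y). x \<noteq> y \<and>
     (\<exists>w. length w = n \<and> x \<in> sg_word p w ` range p \<and> y \<in> sg_word p w ` range p)}"

text \<open>The sum is over ordered pairs, so every unordered edge is counted twice.\<close>
definition sg_energy_level ::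
    "(3 \<Rightarrow> real^2) \<Rightarrow> nat \<Rightarrow> (real^2 \<Rightarrow> real) \<Rightarrow> (real^2 \<Rightarrow> real) \<Rightarrow> real" where
  "sg_energy_level p n u v =
     (5/3) ^ n * (\<Sum>(x, y)\<in>sg_edges p n. (u x - u y) * (v x - v y))"

definition sg_energy ::
    "(3 \<Rightarrow> real^2) \<Rightarrow> (real^2 \<Rightarrow> real) \<Rightarrow> (real^2 \<Rightarrow> real) \<Rightarrow> real" where
  "sg_energy p u v = lim (\<lambda>n. sg_energy_level p n u v)"

text \<open>The level energies of \<open>u\<close> increase with the level, so convergence means that their limit in
  \<open>[0, \<infinity>]\<close> is finite.\<close>
definition sg_form_domain ::
    "(3 \<Rightarrow> real^2) \<Rightarrow> (real^2) set \<Rightarrow> (real^2 \<Rightarrow> real) set" where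
  "sg_form_domain p K = {u. continuous_on K u \<and>
     convergent (\<lambda>n. sg_energy_level p n u u) \<and> (\<forall>i. u (p i) = 0)}"

text \<open>\<open>sg_laplacian p K \<mu> u f\<close>: \<open>u\<close> is in the domain of the generator \<open>\<Delta>\<close> of the form, and
  \<open>\<Delta> u = f\<close> in \<open>L\<^sup>2\<close>.\<close>
definition sg_laplacian ::
    "(3 \<Rightarrow> real^2) \<Rightarrow> (real^2) set \<Rightarrow> (real^2) measure \<Rightarrow>
     (real^2 \<Rightarrow> real) \<Rightarrow> (real^2 \<Rightarrow> real) \<Rightarrow> bool" where
  "sg_laplacian p K \<mu> u f \<longleftrightarrow> u \<in> L2 \<mu> \<and> f \<in> L2 \<mu> \<and>
     (\<exists>u'\<in>sg_form_domain p K. (AE x in \<mu>. u x = u' x) \<and>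
        (\<forall>v\<in>sg_form_domain p K. sg_energy p u' v = - L2_inner \<mu> f v))"

text \<open>The eigenpairs are numbered from 0. Continuity selects the representative of each
  eigenfunction whose point values are used.\<close>
definition is_eigenbasis ::
    "(3 \<Rightarrow> real^2) \<Rightarrow> (real^2) set \<Rightarrow> (real^2) measure \<Rightarrow>
     (nat \<Rightarrow> real) \<Rightarrow> (nat \<Rightarrow> real^2 \<Rightarrow> real) \<Rightarrow> bool" where
  "is_eigenbasis p K \<mu> lam \<phi> \<longleftrightarrow>
     (\<forall>k. 0 < lam k) \<and> mono lam \<and>
     (\<forall>k. continuous_on K (\<phi> k) \<and> sg_laplacian p K \<mu> (\<phi> k) (\<lambda>x. - lam k * \<phi> k x)) \<and>
     (\<forall>j k. L2_inner \<mu> (\<phi> j) (\<phi> k) = (if j = k then 1 else 0)) \<and>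
     (\<forall>f\<in>L2 \<mu>. (\<lambda>n. L2_norm \<mu> (\<lambda>x. f x - (\<Sum>k<n. L2_inner \<mu> f (\<phi> k) * \<phi> k x)))
        \<longlonglongrightarrow> 0)"

definition kernel_operator ::
    "'a measure \<Rightarrow> ('a \<Rightarrow> 'a \<Rightarrow> real) \<Rightarrow> ('a \<Rightarrow> real) \<Rightarrow> 'a \<Rightarrow> real" where
  "kernel_operator \<mu> q f x = (LINT y|\<mu>. q x y * f y)"

text \<open>The kernels \<open>q t\<close> are jointly continuous, and their integral operators form the strongly
  continuous semigroup on \<open>L\<^sup>2\<close> whose infinitesimal generator is the Dirichlet Laplacian.
  Linearity and boundedness of the operators follow from continuity of the kernels.\<close>
definition is_heat_kernel ::
    "(3 \<Rightarrow> real^2) \<Rightarrow> (real^2) set \<Rightarrow> (real^2) measure \<Rightarrow>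
     (real \<Rightarrow> real^2 \<Rightarrow> real^2 \<Rightarrow> real) \<Rightarrow> bool" where
  "is_heat_kernel p K \<mu> q \<longleftrightarrow>
     (\<forall>t>0. continuous_on (K \<times> K) (\<lambda>(x, y). q t x y)) \<and>
     (\<forall>s>0. \<forall>t>0. \<forall>f\<in>L2 \<mu>. AE x in \<mu>.
        kernel_operator \<mu> (q (s + t)) f x
          = kernel_operator \<mu> (q s) (kernel_operator \<mu> (q t) f) x) \<and>
     (\<forall>f\<in>L2 \<mu>. ((\<lambda>t. L2_norm \<mu> (\<lambda>x. kernel_operator \<mu> (q t) f x - f x))
        \<longlongrightarrow> 0) (at_right 0)) \<and>
     (\<forall>u\<in>L2 \<mu>. \<forall>f\<in>L2 \<mu>. sg_laplacian p K \<mu> u f \<longleftrightarrow>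
        ((\<lambda>t. L2_norm \<mu> (\<lambda>x. (kernel_operator \<mu> (q t) u x - u x) / t - f x))
          \<longlongrightarrow> 0) (at_right 0))"

definition riesz_kernel ::
    "(real \<Rightarrow> 'a \<Rightarrow> 'a \<Rightarrow> real) \<Rightarrow> real \<Rightarrow> 'a \<Rightarrow> 'a \<Rightarrow> real" where
  "riesz_kernel q s x y =
     1 / Gamma (s/2) * (LINT t:{0<..}|lborel. t powr (s/2 - 1) * q t x y)"

section \<open>The field and its multiplicative chaos measure\<close>

definition neg_sobolev_norm ::
    "'a measure \<Rightarrow> (nat \<Rightarrow> real) \<Rightarrow> (nat \<Rightarrow> 'a \<Rightarrow> real) \<Rightarrow> real \<Rightarrow> ('a \<Rightarrow> real) \<Rightarrow> real" where
  "neg_sobolev_norm \<mu> lam \<phi> \<epsilon> v =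
     sqrt (\<Sum>k. lam k powr (- \<epsilon>) * (L2_inner \<mu> v (\<phi> k))\<^sup>2)"

text \<open>The type \<open>'b\<close>, with the linear isometry \<open>J\<close> of dense range, is a completion of \<open>L\<^sup>2\<close> for
  the above norm. A completion of this separable space is always second countable.\<close>
definition is_neg_sobolev_completion ::
    "'a measure \<Rightarrow> (nat \<Rightarrow> real) \<Rightarrow> (nat \<Rightarrow> 'a \<Rightarrow> real) \<Rightarrow> real \<Rightarrow>
     (('a \<Rightarrow> real) \<Rightarrow> 'b::{banach, second_countable_topology}) \<Rightarrow> bool" where
  "is_neg_sobolev_completion \<mu> lam \<phi> \<epsilon> J \<longleftrightarrow>
     (\<forall>f\<in>L2 \<mu>. \<forall>g\<in>L2 \<mu>. \<forall>a b. J (\<lambda>x. a * f x + b * g x) = a *\<^sub>R J f + b *\<^sub>R J g) \<and>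
     (\<forall>f\<in>L2 \<mu>. norm (J f) = neg_sobolev_norm \<mu> lam \<phi> \<epsilon> f) \<and>
     closure (J ` L2 \<mu>) = UNIV"

definition fgff_cutoff :: "nat \<Rightarrow> nat" where
  "fgff_cutoff l = (3 ^ (l + 1) - 3) div 2"

definition fgff_level ::
    "(nat \<Rightarrow> real) \<Rightarrow> (nat \<Rightarrow> 'a \<Rightarrow> real) \<Rightarrow> (nat \<Rightarrow> 'w \<Rightarrow> real) \<Rightarrow> nat \<Rightarrow> 'w \<Rightarrow> 'a \<Rightarrow> real" where
  "fgff_level lam \<phi> \<xi> l \<omega> x =
     (\<Sum>k<fgff_cutoff l. \<xi> k \<omega> * lam k powr (- d_S / 4) * \<phi> k x)"

definition iid_std_normal :: "'w measure \<Rightarrow> (nat \<Rightarrow> 'w \<Rightarrow> real) \<Rightarrow> bool" where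
  "iid_std_normal P \<xi> \<longleftrightarrow> prob_space.indep_vars P (\<lambda>_. borel) \<xi> UNIV \<and>
     (\<forall>k. distributed P lborel (\<xi> k) std_normal_density)"

definition is_fgff ::
    "'w measure \<Rightarrow> (nat \<Rightarrow> real) \<Rightarrow> (nat \<Rightarrow> 'a \<Rightarrow> real) \<Rightarrow> (nat \<Rightarrow> 'w \<Rightarrow> real) \<Rightarrow>
     (('a \<Rightarrow> real) \<Rightarrow> 'b::{banach, second_countable_topology}) \<Rightarrow> ('w \<Rightarrow> 'b) \<Rightarrow> bool" where
  "is_fgff P lam \<phi> \<xi> J h \<longleftrightarrow> h \<in> borel_measurable P \<and>
     (AE \<omega> in P. (\<lambda>l. J (fgff_level lam \<phi> \<xi> l \<omega>)) \<longlonglongrightarrow> h \<omega>)"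

text \<open>The measurable space of all measures on the measurable space of \<open>N\<close>, with the
  sigma-algebra generated by the evaluations on measurable sets; it is to arbitrary measures what
  \<^const>\<open>subprob_algebra\<close> is to sub-probability measures.\<close>
definition measure_algebra :: "'a measure \<Rightarrow> 'a measure measure" where
  "measure_algebra N =
     (SUP A\<in>sets N. vimage_algebra {M. sets M = sets N} (\<lambda>M. emeasure M A) borel)"

lemma space_measure_algebra: "space (measure_algebra N) = {M. sets M = sets N}"
  unfolding measure_algebra_def by (subst space_Sup_eq_UN) auto

lemma measurable_emeasure_measure_algebra:
  "A \<in> sets N \<Longrightarrow> (\<lambda>M. emeasure M A) \<in> borel_measurable (measure_algebra N)"
  unfolding measure_algebra_def
  by (auto intro!: measurable_Sup1 measurable_vimage_algebra1)

definition is_lqg_measure ::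
    "(real^2) set \<Rightarrow> (real^2) measure \<Rightarrow> (real^2 \<Rightarrow> real^2 \<Rightarrow> real) \<Rightarrow>
     ((real^2 \<Rightarrow> real) \<Rightarrow> 'b::{banach, second_countable_topology}) \<Rightarrow>
     'w measure \<Rightarrow> ('w \<Rightarrow> 'b) \<Rightarrow> real \<Rightarrow> ('w \<Rightarrow> (real^2) measure) \<Rightarrow> bool" where
  "is_lqg_measure K \<mu> k J P h \<gamma> \<nu> \<longleftrightarrow>
     \<nu> \<in> measurable (vimage_algebra (space P) h borel) (measure_algebra (borel_on K)) \<and>
     (\<forall>F :: 'b \<times> (real^2) \<Rightarrow> ennreal. F \<in> borel_measurable (borel \<Otimes>\<^sub>M borel_on K) \<longrightarrow>
        (\<integral>\<^sup>+\<omega>. (\<integral>\<^sup>+x. F (h \<omega>, x) \<partial>(\<nu> \<omega>)) \<partial>P) =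
        (\<integral>\<^sup>+\<omega>. (\<integral>\<^sup>+x. F (h \<omega> + \<gamma> *\<^sub>R J (k x), x) \<partial>\<mu>) \<partial>P))"

end

(* The reflection sigma permutes the cells of K, so it preserves the measure, the energy form and
   the Laplacian. Hence the functions phi_k o sigma form another eigenbasis with the same
   eigenvalues, and since the heat kernel is determined by any eigenbasis, it and the Riesz kernel
   are sigma-invariant. On the sequence of coefficients with respect to the eigenbasis, sigma acts
   as an orthogonal involution with finite blocks inside the eigenspaces; the coefficients of the
   field are independent Gaussians with variances constant on the blocks, so the law of the field
   is invariant. Applying sigma to both sides of the identity that characterizes the measure nu
   shows that the push-forward of nu is the same function of the reflected field as nu is of the
   field, hence has the same law.

   That the shifts of the field by the Riesz kernel are legitimate (the kernel is square
   integrable) follows from the boundedness of the Green function on the diagonal, which is the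
   estimate sup |u|^2 <= C E(u, u) applied to truncated Green functions. *)

theory Submission
  imports Defs
begin

text \<open>Every object is given by characterizing properties and not by a construction, and this
  shapes the proof. The type \<open>'b\<close> of the field values is an arbitrary completion on
  which no reflection is given. The argument therefore runs on coefficient sequences, which is
  possible because every Borel set of \<open>'b\<close> is the preimage of a measurable set of
  sequences. Since \<nu> is measurable with respect to the field, each value \<nu>(A) is a function
  of the sequence, and the identity pins this function down up to null sets of the law of the
  sequence. Such null sets depend on A, but the sigma-algebra on measures is determined by finitely
  many values at a time.

  That an eigenbasis determines the heat kernel rests on linear algebra: the eigenspaces are
  finite-dimensional, because integrating the Green bound bounds the sum of 1 /
  \<open>lam k\<close>, and the semigroup acts on each of them by matrices. Symmetry and joint
  measurability in time and space are not hypotheses on the kernel; what is required of them is read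
  off from its expansion.\<close>

section \<open>Geometry of the gasket\<close>

lemma three_cases:
  fixes i j :: 3
  shows "j = i \<or> j = i + 1 \<or> j = i + 2"
  using exhaust_3[of i] exhaust_3[of j] by auto

lemma three_neq: "(i::3) \<noteq> i + 1" "(i::3) \<noteq> i + 2" "(i::3) + 1 \<noteq> i + 2"
  by simp_all

text \<open>In dimension two the complement of \<open>u\<close> is a line: the determinant of
  \<open>w\<close> and \<open>v\<close> annihilates both components of \<open>u\<close>. This puts
  the foot of a perpendicular on the axis of symmetry.\<close>

lemma plane_orthogonal_parallel:
  fixes u v w :: "real^2"
  assumes "w \<bullet> u = 0" "v \<bullet> u = 0" "u \<noteq> 0" "v \<noteq> 0"
  shows "\<exists>r. w = r *\<^sub>R v"
proof -
  have w: "w$1 * u$1 + w$2 * u$2 = 0" and v: "v$1 * u$1 + v$2 * u$2 = 0"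
    using assms by (simp_all add: inner_vec_def sum_2)
  have "(w$1 * v$2 - w$2 * v$1) * u$1 = 0" "(w$1 * v$2 - w$2 * v$1) * u$2 = 0"
    using w v by algebra+
  moreover have "u$1 \<noteq> 0 \<or> u$2 \<noteq> 0"
    using assms(3) by (auto simp: vec_eq_iff forall_2)
  ultimately have *: "w$1 * v$2 = w$2 * v$1" by auto
  have **: "v$1 \<noteq> 0 \<or> v$2 \<noteq> 0"
    using assms(4) by (auto simp: vec_eq_iff forall_2)
  show ?thesis
  proof (cases "v$1 = 0")
    case True
    then show ?thesis using * ** by (intro exI[of _ "w$2 / v$2"]) (auto simp: vec_eq_iff forall_2)
  next
    case False
    then show ?thesis using *
      by (intro exI[of _ "w$1 / v$1"]) (auto simp: vec_eq_iff forall_2 field_simps)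
  qed
qed

text \<open>The permutation that the reflection induces on the vertices. Applied letter by letter to
  words, it permutes the cells (\<open>reflection_sg_word\<close>).\<close>

definition vertex_swap :: "3 \<Rightarrow> 3 \<Rightarrow> 3" where
  "vertex_swap i j = (if j = i + 1 then i + 2 else if j = i + 2 then i + 1 else j)"

lemma vertex_swap_involution [simp]: "vertex_swap i (vertex_swap i j) = j"
  by (auto simp: vertex_swap_def)

lemma vertex_swap_comp [simp]: "vertex_swap i \<circ> vertex_swap i = id"
  by (auto simp: fun_eq_iff)

text \<open>In an equilateral triangle the axis through \<open>p i\<close> is the perpendicular
  bisector of the opposite side, so that side is a unit normal \<open>u i\<close>. By Pythagoras,
  removing the normal component gives the closest point, which makes the reflection an explicit
  affine map.\<close>

lemma reflection_formula:
  assumes "unit_triangle p"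
  defines "u \<equiv> \<lambda>i. p (i + 1) - p (i + 2)" and "m \<equiv> \<lambda>i. midpoint (p (i + 1)) (p (i + 2))"
  shows "sg_reflection p i x = x - (2 * ((x - m i) \<bullet> u i)) *\<^sub>R u i"
    and "norm (u i) = 1" and "(p i - m i) \<bullet> u i = 0"
proof -
  have d: "dist (p i) (p (i+1)) = 1" "dist (p i) (p (i+2)) = 1" "dist (p (i+1)) (p (i+2)) = 1"
    using assms(1) three_neq[of i] unfolding unit_triangle_def by blast+
  show nu: "norm (u i) = 1" using d by (simp add: u_def dist_norm)
  have e1: "(p i - p (i+1)) \<bullet> (p i - p (i+1)) = 1" and e2: "(p i - p (i+2)) \<bullet> (p i - p (i+2)) = 1"
    using d by (simp_all add: dot_square_norm dist_norm)
  then have "p (i + 1) \<bullet> p (i + 1) - 2 * (p i \<bullet> p (i+1)) = p (i + 2) \<bullet> p (i + 2) - 2 * (p i \<bullet> p (i+2))"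
    by (simp add: inner_diff_left inner_diff_right inner_commute)
  then show am: "(p i - m i) \<bullet> u i = 0"
    by (simp add: u_def m_def midpoint_def inner_diff_left inner_diff_right inner_add_left inner_commute algebra_simps)
  have ne: "p i - m i \<noteq> 0"
  proof
    assume "p i - m i = 0"
    then have "p i = midpoint (p (i+1)) (p (i+2))" by (simp add: m_def)
    then have "dist (p i) (p (i+1)) = 1/2" using d(3) by (simp add: dist_midpoint)
    then show False using d by simp
  qed
  have uu: "u i \<bullet> u i = 1" using nu by (simp add: dot_square_norm)
  define y where "y = x - ((x - m i) \<bullet> u i) *\<^sub>R u i"
  have "(y - m i) \<bullet> u i = 0"
    using uu by (simp add: y_def algebra_simps inner_diff_left)
  then obtain r where r: "y - m i = r *\<^sub>R (p i - m i)"
    using plane_orthogonal_parallel[of "y - m i" "u i" "p i - m i"] am ne nu by fastforce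
  have axis: "sg_axis p i = {a *\<^sub>R p i + b *\<^sub>R m i |a b. a + b = 1}"
    by (simp add: sg_axis_def affine_hull_2 m_def)
  have yin: "y \<in> sg_axis p i"
    unfolding axis
  proof (intro CollectI exI conjI)
    show "y = r *\<^sub>R p i + (1 - r) *\<^sub>R m i" using r by (simp add: algebra_simps)
  qed simp
  have "closest_point (sg_axis p i) x = y"
  proof (rule sym, rule closest_point_unique)
    show "convex (sg_axis p i)" unfolding sg_axis_def by (simp add: affine_imp_convex)
    show "closed (sg_axis p i)" unfolding sg_axis_def by simp
    show "y \<in> sg_axis p i" by fact
    show "\<forall>z\<in>sg_axis p i. dist x y \<le> dist x z"
    proof
      fix z assume "z \<in> sg_axis p i"
      then obtain a b where z: "z = a *\<^sub>R p i + b *\<^sub>R m i" "a + b = 1" unfolding axis by blast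
      have b: "b = 1 - a" using z by simp
      have "z - m i = a *\<^sub>R (p i - m i)" unfolding z(1) b by (simp add: algebra_simps)
      then have "(z - m i) \<bullet> u i = 0" using am by simp
      then have "(y - z) \<bullet> u i = 0" using \<open>(y - m i) \<bullet> u i = 0\<close> by (simp add: inner_diff_left)
      then have "orthogonal (x - y) (y - z)"
        by (simp add: y_def orthogonal_def inner_commute)
      then have "(norm (x - z))\<^sup>2 = (norm (x - y))\<^sup>2 + (norm (y - z))\<^sup>2"
        using norm_add_Pythagorean[of "x - y" "y - z"] by simp
      then show "dist x y \<le> dist x z" unfolding dist_norm
        by (simp add: power2_le_imp_le)
    qed
  qed
  then have "sg_reflection p i x = 2 *\<^sub>R y - x" by (simp add: sg_reflection_def)
  then show "sg_reflection p i x = x - (2 * ((x - m i) \<bullet> u i)) *\<^sub>R u i"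
    by (simp add: y_def vec_eq_iff)
qed

lemma sg_word_Nil [simp]: "sg_word p [] = id"
  and sg_word_Cons: "sg_word p (a # w) = sg_map p a \<circ> sg_word p w"
  by (simp_all add: sg_word_def)

lemma sg_word_append: "sg_word p (v @ w) = sg_word p v \<circ> sg_word p w"
  by (induction v) (simp_all add: sg_word_Cons fun_eq_iff)

lemma sg_map_fix [simp]: "sg_map p i (p i) = p i"
  by (simp add: sg_map_def)

lemma dist_sg_map: "dist (sg_map p i x) (sg_map p i y) = dist x y / 2"
proof -
  have "sg_map p i x - sg_map p i y = (1/2) *\<^sub>R (x - y)"
    by (simp add: sg_map_def algebra_simps)
  then show ?thesis by (simp add: dist_norm)
qed

lemma dist_sg_word: "dist (sg_word p w x) (sg_word p w y) = dist x y / 2 ^ length w"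
  by (induction w) (simp_all add: sg_word_Cons dist_sg_map)

lemma continuous_on_sg_word: "continuous_on S (sg_word p w)"
proof -
  have "dist (sg_word p w x) (sg_word p w y) \<le> dist x y" for x y
    unfolding dist_sg_word by (simp add: divide_le_eq mult_left_le_one_le  mult_le_cancel_left1)
  then show ?thesis
    by (intro continuous_onI) (meson le_less_trans less_imp_le)
qed

lemma sg_map_midpoint: "sg_map p i (p j) = sg_map p j (p i)"
  by (simp add: sg_map_def vec_eq_iff field_simps)

context
  fixes p :: "3 \<Rightarrow> real^2" and i :: 3
  assumes tri: "unit_triangle p"
begin

lemma reflection_normal_form:
  obtains u m where "u \<bullet> u = 1" "\<And>x. sg_reflection p i x = x - (2 * ((x - m) \<bullet> u)) *\<^sub>R u"
  using reflection_formula(1,2)[OF tri, of i] by (metis dot_square_norm power_one)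

lemma reflection_involution [simp]: "sg_reflection p i (sg_reflection p i x) = x"
proof -
  obtain u m where u: "u \<bullet> u = 1" and eq: "\<And>x. sg_reflection p i x = x - (2 * ((x - m) \<bullet> u)) *\<^sub>R u"
    by (rule reflection_normal_form) blast
  have "(sg_reflection p i x - m) \<bullet> u = - ((x - m) \<bullet> u)"
    unfolding eq using u by (simp add: inner_diff_left)
  then show ?thesis by (simp add: eq[of "sg_reflection p i x"]) (simp add: eq)
qed

text \<open>Affine maps preserve midpoints. With \<open>y\<close> a vertex this says that the
  reflection conjugates one contraction into another.\<close>

lemma reflection_affine: "sg_reflection p i ((1/2) *\<^sub>R (x - y) + y) = (1/2) *\<^sub>R (sg_reflection p i x - sg_reflection p i y) + sg_reflection p i y"
proof -
  obtain u m where eq: "\<And>x. sg_reflection p i x = x - (2 * ((x - m) \<bullet> u)) *\<^sub>R u"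
    by (rule reflection_normal_form) blast
  show ?thesis
    unfolding eq by (simp add: vec_eq_iff inner_diff_left inner_add_left field_simps)
qed

lemma dist_reflection: "dist (sg_reflection p i x) (sg_reflection p i y) = dist x y"
proof -
  obtain u m where u: "u \<bullet> u = 1" and eq: "\<And>x. sg_reflection p i x = x - (2 * ((x - m) \<bullet> u)) *\<^sub>R u"
    by (rule reflection_normal_form) blast
  define v where "v = x - y"
  have "sg_reflection p i x - sg_reflection p i y = v - (2 * (v \<bullet> u)) *\<^sub>R u"
    by (simp add: eq v_def algebra_simps inner_diff_left)
  then have "(sg_reflection p i x - sg_reflection p i y) \<bullet> (sg_reflection p i x - sg_reflection p i y) = v \<bullet> v"
    using u by (simp add: inner_diff_left inner_diff_right inner_commute[of u v])
  then show ?thesis by (simp add: dist_norm norm_eq_sqrt_inner v_def)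
qed

lemma continuous_on_reflection: "continuous_on S (sg_reflection p i)"
  by (intro continuous_onI) (metis dist_reflection less_imp_le)

lemma reflection_vertex: "sg_reflection p i (p j) = p (vertex_swap i j)"
proof -
  let ?u = "p (i + 1) - p (i + 2)" and ?m = "midpoint (p (i + 1)) (p (i + 2))"
  have uu: "?u \<bullet> ?u = 1"
    using reflection_formula(2)[OF tri, of i] by (simp add: dot_square_norm)
  have 1: "p (i + 1) - ?m = (1/2) *\<^sub>R ?u" and 2: "p (i + 2) - ?m = (- 1/2) *\<^sub>R ?u"
    by (simp_all add: midpoint_def vec_eq_iff field_simps)
  consider "j = i" | "j = i + 1" | "j = i + 2" using three_cases[of j i] by blast
  then show ?thesis
  proof cases
    case 1
    then show ?thesis
      using reflection_formula(3)[OF tri, of i]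
      by (simp add: reflection_formula(1)[OF tri] vertex_swap_def)
  next
    case 2
    then show ?thesis
      unfolding reflection_formula(1)[OF tri] 2 1 inner_scaleR_left uu by (simp add: vertex_swap_def)
  next
    case 3
    then show ?thesis
      unfolding reflection_formula(1)[OF tri] 3 2 inner_scaleR_left uu by (simp add: vertex_swap_def)
  qed
qed

lemma reflection_sg_map: "sg_reflection p i (sg_map p j x) = sg_map p (vertex_swap i j) (sg_reflection p i x)"
  unfolding sg_map_def reflection_affine reflection_vertex ..

lemma reflection_sg_word: "sg_reflection p i (sg_word p w x) = sg_word p (map (vertex_swap i) w) (sg_reflection p i x)"
  by (induction w) (simp_all add: sg_word_Cons reflection_sg_map)

end

lemma halving_eventually_less:
  fixes D e :: real
  assumes "e > 0" shows "\<exists>n. \<forall>m\<ge>n. D / 2 ^ m < e"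
proof -
  have "(\<lambda>n. D / 2 ^ n) \<longlonglongrightarrow> 0" by real_asymp
  from order_tendstoD(2)[OF this assms] show ?thesis
    unfolding eventually_sequentially .
qed

section \<open>Cells, vertices and symmetry of the gasket\<close>

locale sierpinski =
  fixes p :: "3 \<Rightarrow> real^2" and K :: "(real^2) set" and \<mu> :: "(real^2) measure"
  assumes tri: "unit_triangle p" and gasket: "is_gasket p K"
    and self_similar: "is_self_similar_measure p K \<mu>"
begin

abbreviation cell :: "3 list \<Rightarrow> (real^2) set" where
  "cell w \<equiv> sg_word p w ` K"

lemma compact_K: "compact K" and K_nonempty: "K \<noteq> {}" and K_eq: "K = (\<Union>j. sg_map p j ` K)"
  using gasket unfolding is_gasket_def by auto

lemma closed_K: "closed K" using compact_K by (rule compact_imp_closed)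

lemma sg_map_K: "x \<in> K \<Longrightarrow> sg_map p j x \<in> K"
  using K_eq by blast

lemma sg_word_K: "x \<in> K \<Longrightarrow> sg_word p w x \<in> K"
  by (induction w) (auto simp: sg_word_Cons sg_map_K)

lemma cell_cover: "x \<in> K \<Longrightarrow> \<exists>w. length w = n \<and> x \<in> cell w"
proof (induction n arbitrary: x)
  case 0 then show ?case by auto
next
  case (Suc n)
  then obtain j y where y: "y \<in> K" "x = sg_map p j y" using K_eq by blast
  from Suc.IH[OF y(1)] obtain w where "length w = n" "y \<in> cell w" by blast
  then show ?case using y(2)
    by (intro exI[of _ "j # w"]) (auto simp: sg_word_Cons)
qed

lemma small_cell:
  assumes "e > 0"
  shows "\<exists>n. \<forall>w. length w = n \<longrightarrow> (\<forall>x\<in>K. \<forall>y\<in>K. dist (sg_word p w x) (sg_word p w y) < e)"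
proof -
  obtain D where D: "\<And>x y. x \<in> K \<Longrightarrow> y \<in> K \<Longrightarrow> dist x y \<le> D"
    using compact_imp_bounded[OF compact_K] bounded_two_points by metis
  obtain n where n: "D / 2 ^ n < e"
    using halving_eventually_less[OF assms] by blast
  show ?thesis
  proof (intro exI[of _ n] allI impI ballI)
    fix x y and w :: "3 list" assume w: "length w = n" and xy: "x \<in> K" "y \<in> K"
    have "dist (sg_word p w x) (sg_word p w y) \<le> D / 2 ^ n"
      unfolding dist_sg_word w using D[OF xy] by (simp add: divide_right_mono)
    then show "dist (sg_word p w x) (sg_word p w y) < e" using n by linarith
  qed
qed

text \<open>A point of \<open>K\<close> with address \<open>w\<close> of length n lies within D /
  2^n of the image of any chosen point of \<open>L\<close> under the same word, and that image stays
  in \<open>L\<close>.\<close>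

lemma gasket_subset_closed:
  assumes "closed L" "L \<noteq> {}" "\<And>x j. x \<in> L \<Longrightarrow> sg_map p j x \<in> L" "bounded L"
  shows "K \<subseteq> L"
proof
  fix x assume x: "x \<in> K"
  obtain y where y: "y \<in> L" using assms(2) by blast
  have L: "sg_word p w y \<in> L" for w
    by (induction w) (auto simp: sg_word_Cons y assms(3))
  obtain D where D: "\<And>z. z \<in> K \<Longrightarrow> dist z y \<le> D"
    using compact_imp_bounded[OF compact_K] y unfolding bounded_any_center[where a=y]
    by (metis dist_commute)
  have "x \<in> closure L"
    unfolding closure_approachable
  proof (intro allI impI)
    fix e :: real assume "e > 0"
    then obtain n where n: "D / 2 ^ n < e"
      using halving_eventually_less[of e D] by blast
    obtain w z where w: "length w = n" "z \<in> K" "x = sg_word p w z" using cell_cover[OF x] by blast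
    have "dist (sg_word p w y) x \<le> D / 2 ^ n"
      unfolding w dist_sg_word using D[OF w(2)] by (simp add: divide_right_mono dist_commute w(1))
    then show "\<exists>y\<in>L. dist y x < e" using L n by (intro bexI[of _ "sg_word p w y"]) auto
  qed
  then show "x \<in> L" using assms(1) by simp
qed

text \<open>The vertex is the fixed point of its own contraction, hence the limit of the iterates of
  any point of \<open>K\<close>.\<close>

lemma vertex_K: "p j \<in> K"
proof -
  obtain y where y: "y \<in> K" using K_nonempty by blast
  have "(\<lambda>n. sg_word p (replicate n j) y) \<longlonglongrightarrow> p j"
  proof (rule metric_LIMSEQ_I)
    fix e :: real assume "e > 0"
    have pj: "sg_word p (replicate n j) (p j) = p j" for n
      by (induction n) (simp_all add: sg_word_Cons)
    obtain n where "\<And>m. m \<ge> n \<Longrightarrow> dist y (p j) / 2 ^ m < e"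
      using halving_eventually_less[OF \<open>e > 0\<close>] by blast
    then show "\<exists>n. \<forall>m\<ge>n. dist (sg_word p (replicate m j) y) (p j) < e"
      using dist_sg_word[of p "replicate _ j" y "p j"] pj by (intro exI[of _ n]) simp
  qed
  then show ?thesis
    by (rule closed_sequentially[OF closed_K sg_word_K[OF y]])
qed

lemma vertices_K: "sg_word p w (p j) \<in> K"
  using vertex_K sg_word_K by blast

text \<open>The mirror image of \<open>K\<close> is invariant under all contractions, since the
  reflection only permutes them. By minimality it contains \<open>K\<close>, and the involution
  turns this into the claim.\<close>

lemma reflection_K: "x \<in> K \<Longrightarrow> sg_reflection p i x \<in> K"
proof -
  let ?L = "sg_reflection p i ` K"
  have "K \<subseteq> ?L"
  proof (rule gasket_subset_closed)
    have "compact ?L" using compact_K continuous_on_reflection[OF tri] by (rule compact_continuous_image[rotated])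
    then show "closed ?L" "bounded ?L" by (auto dest: compact_imp_closed compact_imp_bounded)
    show "?L \<noteq> {}" using K_nonempty by simp
    fix x j assume "x \<in> ?L"
    then obtain y where "y \<in> K" "x = sg_reflection p i y" by blast
    then have "sg_map p j x = sg_reflection p i (sg_map p (vertex_swap i j) y)"
      by (simp add: reflection_sg_map[OF tri])
    then show "sg_map p j x \<in> ?L" using sg_map_K[OF \<open>y \<in> K\<close>] by blast
  qed
  then show "x \<in> K \<Longrightarrow> sg_reflection p i x \<in> K"
    using reflection_involution[OF tri] by (metis (no_types, lifting) imageE subsetD)
qed

lemma reflection_image_K: "sg_reflection p i ` K = K"
  using reflection_K reflection_involution[OF tri] by (metis image_eqI image_subsetI subsetI subset_antisym)

lemma reflection_cell: "sg_reflection p i ` cell w = cell (map (vertex_swap i) w)"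
proof -
  have "sg_reflection p i ` cell w = sg_word p (map (vertex_swap i) w) ` (sg_reflection p i ` K)"
    by (simp add: image_image reflection_sg_word[OF tri])
  then show ?thesis by (simp add: reflection_image_K)
qed

section \<open>The self-similar measure\<close>

sublocale prob_space \<mu>
  using self_similar by (simp add: is_self_similar_measure_def)

lemma sets_mu: "sets \<mu> = sets (borel_on K)"
  using self_similar by (simp add: is_self_similar_measure_def)

lemma space_mu [simp]: "space \<mu> = K"
  using sets_eq_imp_space_eq[OF sets_mu] by (simp add: space_restrict_space)

lemma measure_cell: "measure \<mu> (cell w) = (1/3) ^ length w"
  using self_similar by (simp add: is_self_similar_measure_def)

lemma sets_mu_iff: "A \<in> sets \<mu> \<longleftrightarrow> A \<in> sets borel \<and> A \<subseteq> K"
  unfolding sets_mu using closed_K by (subst sets_restrict_space_iff) auto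

lemma cell_sets: "cell w \<in> sets \<mu>"
  unfolding sets_mu_iff
  using sg_word_K compact_continuous_image[OF continuous_on_sg_word compact_K, THEN compact_imp_closed] by auto

lemma measurable_mu: "continuous_on K f \<Longrightarrow> f \<in> borel_measurable \<mu>"
  for f :: "real^2 \<Rightarrow> 'z::topological_space"
  using borel_measurable_continuous_on_restrict[of K f] measurable_cong_sets[OF sets_mu refl] by blast

lemma card_words: "finite {w :: 3 list. length w = n}" "card {w :: 3 list. length w = n} = 3 ^ n"
  using finite_lists_length_eq[of "UNIV :: 3 set" n] card_lists_length_eq[of "UNIV :: 3 set" n] by auto

text \<open>The masses of the cells of a level add up to 1, which makes overlaps negligible without any
  geometric description of them.\<close>
lemma measure_cells:
  assumes "S \<subseteq> {w. length w = n}"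
  shows "measure \<mu> (\<Union>w\<in>S. cell w) = card S / 3 ^ n"
proof -
  let ?A = "{w :: 3 list. length w = n}"
  have fin: "finite S" "finite (?A - S)" using assms card_words(1) finite_subset by auto
  have le: "measure \<mu> (\<Union>w\<in>T. cell w) \<le> card T / 3 ^ n" if "T \<subseteq> ?A" for T
  proof -
    have "measure \<mu> (\<Union>w\<in>T. cell w) \<le> (\<Sum>w\<in>T. measure \<mu> (cell w))"
      using cell_sets finite_subset[OF that card_words(1)] by (intro finite_measure_subadditive_finite) auto
    also have "\<dots> = (\<Sum>w\<in>T. (1/3)^n)" using that by (intro sum.cong) (auto simp: measure_cell)
    finally show ?thesis by (simp add: power_one_over)
  qed
  have "1 = measure \<mu> ((\<Union>w\<in>S. cell w) \<union> (\<Union>w\<in>?A - S. cell w))"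
  proof -
    have "(\<Union>w\<in>S. cell w) \<union> (\<Union>w\<in>?A - S. cell w) = space \<mu>"
    proof (intro subset_antisym subsetI)
      fix x assume "x \<in> space \<mu>"
      then obtain w where "length w = n" "x \<in> cell w" using cell_cover[of x n] by auto
      then show "x \<in> (\<Union>w\<in>S. cell w) \<union> (\<Union>w\<in>?A - S. cell w)" by blast
    qed (auto simp: sg_word_K)
    then show ?thesis using prob_space by simp
  qed
  also have "\<dots> \<le> measure \<mu> (\<Union>w\<in>S. cell w) + measure \<mu> (\<Union>w\<in>?A - S. cell w)"
    using fin cell_sets by (intro measure_Un_le) auto
  also have "\<dots> \<le> measure \<mu> (\<Union>w\<in>S. cell w) + card (?A - S) / 3 ^ n"
    using le[of "?A - S"] by auto
  also have "card (?A - S) = 3 ^ n - card S"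
    using card_words assms fin by (simp add: card_Diff_subset)
  finally have "1 \<le> measure \<mu> (\<Union>w\<in>S. cell w) + (3 ^ n - real (card S)) / 3 ^ n"
    using card_mono[OF card_words(1) assms] card_words(2)[of n] by (simp add: of_nat_diff)
  then have "card S / 3 ^ n \<le> measure \<mu> (\<Union>w\<in>S. cell w)" by (simp add: diff_divide_distrib)
  then show ?thesis using le[OF assms] by linarith
qed

text \<open>The unions of the level-n cells that meet \<open>C\<close> decrease to
  \<open>C \<inter> K\<close>, because cells shrink to points. The mass of a closed set thereby
  becomes a limit of numbers of words, on which the reflection acts by a bijection.\<close>

lemma measure_closed_limit:
  assumes "closed C"
  shows "(\<lambda>n. card {w. length w = n \<and> cell w \<inter> C \<noteq> {}} / 3 ^ n) \<longlonglongrightarrow> measure \<mu> (C \<inter> K)"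
proof -
  define U where "U n = (\<Union>w\<in>{w. length w = n \<and> cell w \<inter> C \<noteq> {}}. cell w)" for n
  have fin: "finite {w :: 3 list. length w = n \<and> Q w}" for n Q
    using card_words(1)[of n] by (rule rev_finite_subset) auto
  have U: "range U \<subseteq> sets \<mu>" unfolding U_def using cell_sets fin by (auto intro!: sets.finite_UN)
  have dec: "decseq U"
  proof (rule decseq_SucI, rule subsetI)
    fix n x assume "x \<in> U (Suc n)"
    then obtain w where w: "length w = Suc n" "cell w \<inter> C \<noteq> {}" "x \<in> cell w" unfolding U_def by blast
    then obtain v a where va: "w = v @ [a]" by (cases w rule: rev_cases) auto
    have sub: "cell w \<subseteq> cell v"
    proof
      fix y assume "y \<in> cell w"
      then obtain z where "z \<in> K" "y = sg_word p v (sg_word p [a] z)"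
        by (auto simp: va sg_word_append)
      then show "y \<in> cell v" using sg_word_K[of z "[a]"] by blast
    qed
    then have "length v = n" "cell v \<inter> C \<noteq> {}" "x \<in> cell v" using w va by auto
    then show "x \<in> U n" unfolding U_def by blast
  qed
  have "(\<Inter>n. U n) = C \<inter> K"
  proof (intro set_eqI iffI)
    fix x assume x: "x \<in> (\<Inter>n. U n)"
    then have "x \<in> U 0" by auto
    then have xK: "x \<in> K" unfolding U_def by (auto split: if_splits)
    have "x \<in> closure C" unfolding closure_approachable
    proof (intro allI impI)
      fix e :: real assume "e > 0"
      then obtain n where n: "\<And>w x y. length w = n \<Longrightarrow> x \<in> K \<Longrightarrow> y \<in> K \<Longrightarrow> dist (sg_word p w x) (sg_word p w y) < e"
        using small_cell by blast
      have "x \<in> U n" using x by auto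
      then obtain w where w: "length w = n" "cell w \<inter> C \<noteq> {}" "x \<in> cell w" unfolding U_def by blast
      then show "\<exists>y\<in>C. dist y x < e" using n[OF w(1)] by (auto simp: dist_commute)
    qed
    then show "x \<in> C \<inter> K" using assms xK by simp
  next
    fix x assume x: "x \<in> C \<inter> K"
    have "x \<in> U n" for n
    proof -
      obtain w where "length w = n" "x \<in> cell w" using cell_cover[of x n] x by blast
      then show ?thesis unfolding U_def using x by (intro UN_I[of w]) auto
    qed
    then show "x \<in> (\<Inter>n. U n)" by simp
  qed
  then have "(\<lambda>n. measure \<mu> (U n)) \<longlonglongrightarrow> measure \<mu> (C \<inter> K)"
    using finite_Lim_measure_decseq[OF U dec] by simp
  moreover have "measure \<mu> (U n) = card {w. length w = n \<and> cell w \<inter> C \<noteq> {}} / 3 ^ n" for n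
    unfolding U_def by (rule measure_cells) auto
  ultimately show ?thesis by simp
qed

lemma measure_reflection_closed:
  assumes "closed C"
  shows "measure \<mu> (sg_reflection p i -` C \<inter> K) = measure \<mu> (C \<inter> K)"
proof -
  let ?s = "sg_reflection p i"
  have cl: "closed (?s -` C)"
    using continuous_on_reflection[OF tri, of UNIV] assms by (rule closed_vimage[rotated])
  have iff: "cell w \<inter> ?s -` C \<noteq> {} \<longleftrightarrow> cell (map (vertex_swap i) w) \<inter> C \<noteq> {}" for w
    unfolding reflection_cell[symmetric] by auto
  have "card {w. length w = n \<and> cell w \<inter> ?s -` C \<noteq> {}} = card {w. length w = n \<and> cell w \<inter> C \<noteq> {}}" for n
    by (rule bij_betw_same_card[of "map (vertex_swap i)"],
        rule bij_betw_byWitness[where f' = "map (vertex_swap i)"])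
       (auto simp: iff)
  then show ?thesis
    using measure_closed_limit[OF cl] measure_closed_limit[OF assms] LIMSEQ_unique by simp
qed

lemma reflection_measurable [measurable]: "sg_reflection p i \<in> measurable \<mu> \<mu>"
proof -
  have "sg_reflection p i \<in> measurable \<mu> (borel_on K)"
    using reflection_K by (intro measurable_restrict_space2 measurable_mu continuous_on_reflection[OF tri]) auto
  then show ?thesis by (simp add: measurable_cong_sets[OF refl sets_mu])
qed

lemma distr_reflection: "distr \<mu> \<mu> (sg_reflection p i) = \<mu>"
proof -
  let ?s = "sg_reflection p i"
  have m1 [measurable]: "(\<lambda>x. x) \<in> measurable \<mu> borel" "?s \<in> measurable \<mu> borel"
    by (intro measurable_mu continuous_on_id continuous_on_reflection[OF tri])+
  \<comment> \<open>The comparison is made on the Borel sets of the whole plane, where the closed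
    sets are an intersection-stable generator.\<close>
  have eq: "distr \<mu> borel ?s = distr \<mu> borel (\<lambda>x. x)"
  proof (rule measure_eqI_generator_eq[where E = "Collect closed" and \<Omega> = UNIV and A = "\<lambda>_. UNIV"])
    show "Int_stable (Collect closed :: (real^2) set set)" by (auto simp: Int_stable_def)
    fix X :: "(real^2) set" assume "X \<in> Collect closed"
    then have X: "closed X" by simp
    then show "emeasure (distr \<mu> borel ?s) X = emeasure (distr \<mu> borel (\<lambda>x. x)) X"
      using measure_reflection_closed[OF X, of i] by (simp add: emeasure_distr emeasure_eq_measure)
  next
    show "sets (distr \<mu> borel ?s) = sigma_sets UNIV (Collect closed)"
      and "sets (distr \<mu> borel (\<lambda>x. x)) = sigma_sets UNIV (Collect closed)"
      by (simp_all add: borel_eq_closed)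
    show "emeasure (distr \<mu> borel ?s) UNIV \<noteq> \<infinity>" for k :: nat
      by (simp add: emeasure_distr)
  qed simp_all
  show ?thesis
  proof (rule measure_eqI)
    fix A assume "A \<in> sets (distr \<mu> \<mu> ?s)"
    then have A: "A \<in> sets borel" "A \<subseteq> K" "A \<in> sets \<mu>" by (auto simp: sets_mu_iff)
    have "emeasure (distr \<mu> \<mu> ?s) A = emeasure (distr \<mu> borel ?s) A"
      using A by (simp add: emeasure_distr)
    also have "\<dots> = emeasure \<mu> A" unfolding eq using A by (simp add: emeasure_distr Int_absorb2)
    finally show "emeasure (distr \<mu> \<mu> ?s) A = emeasure \<mu> A" .
  qed simp
qed

lemma integral_reflection:
  fixes f :: "real^2 \<Rightarrow> real"
  assumes [measurable]: "f \<in> borel_measurable \<mu>"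
  shows "(LINT x|\<mu>. f (sg_reflection p i x)) = (LINT x|\<mu>. f x)"
    and "integrable \<mu> (\<lambda>x. f (sg_reflection p i x)) \<longleftrightarrow> integrable \<mu> f"
  using integral_distr[of "sg_reflection p i" \<mu> \<mu> f] integrable_distr_eq[of "sg_reflection p i" \<mu> \<mu> f]
  by (simp_all add: distr_reflection)

lemma nn_integral_reflection:
  assumes [measurable]: "f \<in> borel_measurable \<mu>"
  shows "(\<integral>\<^sup>+x. f (sg_reflection p i x) \<partial>\<mu>) = (\<integral>\<^sup>+x. f x \<partial>\<mu>)"
  using nn_integral_distr[of "sg_reflection p i" \<mu> \<mu> f] by (simp add: distr_reflection)

lemma AE_eq_imp_eq:
  fixes f g :: "real^2 \<Rightarrow> real"
  assumes "continuous_on K f" "continuous_on K g" "AE x in \<mu>. f x = g x" "x \<in> K"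
  shows "f x = g x"
proof (rule ccontr)
  assume ne: "f x \<noteq> g x"
  define h where "h x = f x - g x" for x
  have "continuous_on K h" unfolding h_def by (intro continuous_intros assms)
  note cont = this
  have "\<bar>h x\<bar> > 0" using ne by (simp add: h_def)
  then have "\<exists>d>0. \<forall>y\<in>K. dist y x < d \<longrightarrow> dist (h y) (h x) < \<bar>h x\<bar>"
    using cont[unfolded continuous_on_iff, rule_format, OF \<open>x \<in> K\<close>, of "\<bar>h x\<bar>"] by simp
  then obtain d where dd: "d > 0 \<and> (\<forall>y\<in>K. dist y x < d \<longrightarrow> dist (h y) (h x) < \<bar>h x\<bar>)" ..
  note d = dd[THEN conjunct1] and d2 = dd[THEN conjunct2]
  from small_cell[OF d] obtain n where "\<forall>w. length w = n \<longrightarrow> (\<forall>x\<in>K. \<forall>y\<in>K. dist (sg_word p w x) (sg_word p w y) < d)" ..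
  then have n: "dist (sg_word p w x) (sg_word p w y) < d" if "length w = n" "x \<in> K" "y \<in> K" for w x y
    using that by simp
  obtain w where w: "length w = n" "x \<in> cell w" using cell_cover[OF \<open>x \<in> K\<close>] by blast
  have "h y \<noteq> 0" if "y \<in> cell w" for y
  proof -
    have "dist y x < d" "y \<in> K" using that w n sg_word_K by auto
    with d2 have "dist (h y) (h x) < \<bar>h x\<bar>" by blast
    then show ?thesis by (auto simp: dist_real_def)
  qed
  then have "\<And>y. f y = g y \<Longrightarrow> y \<notin> cell w" by (auto simp: h_def)
  then have "AE y in \<mu>. y \<notin> cell w" by (rule eventually_mono[OF assms(3)])
  then have "emeasure \<mu> (cell w) = 0"
    using AE_iff_measurable[OF cell_sets, of "\<lambda>y. y \<notin> cell w" w] sg_word_K by auto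
  then show False using measure_cell[of w] unfolding measure_def by simp
qed

end

section \<open>The energy form\<close>

text \<open>The optimal values at the midpoints are those of the harmonic extension, e.g.
  \<open>z = (2 a + 2 b + c) / 5\<close>; the difference of the two sides is a sum of squares centred there.\<close>
lemma harmonic_extension_ineq:
  fixes a b c x y z :: real
  shows "3 / 5 * ((a - b)\<^sup>2 + (b - c)\<^sup>2 + (c - a)\<^sup>2) \<le>
    (a - z)\<^sup>2 + (a - y)\<^sup>2 + (z - y)\<^sup>2 + (b - z)\<^sup>2 + (b - x)\<^sup>2 + (z - x)\<^sup>2 + (c - x)\<^sup>2 + (c - y)\<^sup>2 + (x - y)\<^sup>2"
    (is "?l \<le> ?r")
proof -
  define X Y Z where "X = x - (a + 2*b + 2*c) / 5" and "Y = y - (2*a + b + 2*c) / 5"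
    and "Z = z - (2*a + 2*b + c) / 5"
  have "?r - ?l = 2 * (X\<^sup>2 + Y\<^sup>2 + Z\<^sup>2) + (X - Y)\<^sup>2 + (Y - Z)\<^sup>2 + (Z - X)\<^sup>2"
    unfolding X_def Y_def Z_def power2_eq_square by (simp add: field_simps)
  also have "\<dots> \<ge> 0" by simp
  finally show ?thesis by simp
qed

section \<open>Edges and words are determined by the points they produce\<close>

lemma sg_word_diff: "sg_word p w x - sg_word p w y = (1 / 2 ^ length w) *\<^sub>R (x - y)"
proof (induction w)
  case (Cons a w)
  have "sg_word p (a # w) x - sg_word p (a # w) y = (1/2) *\<^sub>R (sg_word p w x - sg_word p w y)"
    by (simp add: sg_word_Cons sg_map_def algebra_simps)
  then show ?case by (simp add: Cons.IH)
qed simp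

lemma unit_triangle_neq: "unit_triangle p \<Longrightarrow> i \<noteq> j \<Longrightarrow> p i \<noteq> p j"
  unfolding unit_triangle_def by (metis dist_self zero_neq_one)

text \<open>If the initial vertices differ, two of the remaining indices must coincide or close up,
  as there are only three vertices. Each case either cancels to an equality of vertices or makes a
  difference of two vertices twice a unit vector.\<close>

lemma unit_triangle_edge_inj:
  assumes tri: "unit_triangle p" and eq: "p i - p j = p k - p l" and ij: "i \<noteq> j"
  shows "i = k \<and> j = l"
proof -
  have d: "norm (p a - p b) = 1" if "a \<noteq> b" for a b
    using tri that unfolding unit_triangle_def dist_norm by blast
  have d': "norm (p a - p b) \<le> 1" for a b using d[of a b] by (cases "a = b") auto
  have no2: False if "p a - p b = 2 *\<^sub>R (p c - p e)" "c \<noteq> e" for a b c e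
    using d'[of a b] d[OF that(2)] unfolding that(1) by simp
  have inj: "p a = p b \<longleftrightarrow> a = b" for a b using unit_triangle_neq[OF tri] by blast
  show ?thesis
  proof (cases "i = k")
    case True
    then show ?thesis using eq inj by auto
  next
    case False
    have "k = j \<or> l = i \<or> l = j \<or> l = k"
      using three_cases[of i j] three_cases[of i k] three_cases[of i l] ij False by auto
    then consider "k = j" | "l = i" | "l = j" | "l = k" by blast
    then show ?thesis
    proof cases
      case 1
      then have "p i - p l = 2 *\<^sub>R (p j - p l)" using eq by (simp add: scaleR_2 algebra_simps)
      moreover have "j \<noteq> l" using 1 eq inj ij by auto
      ultimately show ?thesis using no2 by blast
    next
      case 2
      then have "p k - p j = 2 *\<^sub>R (p i - p j)" using eq by (simp add: scaleR_2 algebra_simps)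
      then show ?thesis using no2 ij by blast
    next
      case 3
      then show ?thesis using eq inj False by auto
    next
      case 4
      then show ?thesis using eq inj ij by auto
    qed
  qed
qed

text \<open>Different first letters \<open>a\<close> and \<open>b\<close> would force the remaining
  words to move the midpoint of \<open>p a\<close> and \<open>p b\<close> to points that differ by
  \<open>p b - p a\<close>. The functional \<open>g\<close> changes by 1 along this vector, but its
  values at both points lie strictly between -1/2 and 1/2.\<close>

lemma sg_word_inj:
  assumes tri: "unit_triangle p"
  shows "length w = length v \<Longrightarrow> sg_word p w = sg_word p v \<Longrightarrow> w = v"
proof (induction w arbitrary: v)
  case (Cons a w)
  then obtain b v' where v: "v = b # v'" "length w = length v'" by (cases v) auto
  have eq: "sg_map p a (sg_word p w x) = sg_map p b (sg_word p v' x)" for x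
    using fun_cong[OF Cons.prems(2), of x] by (simp add: v sg_word_Cons)
  have "a = b"
  proof (rule ccontr)
    assume ab: "a \<noteq> b"
    \<comment> \<open>an affine functional with values in \<open>{-1/2, 0, 1/2}\<close> at the vertices\<close>
    define g where "g y = y \<bullet> (p a - p b) + (p b \<bullet> p b - p a \<bullet> p a) / 2" for y
    have gp: "\<bar>g (p j)\<bar> \<le> 1/2" for j
    proof -
      have n: "(p j - p c) \<bullet> (p j - p c) \<in> {0, 1}" for c
        using tri unfolding unit_triangle_def dist_norm dot_square_norm
        by (cases "j = c") auto
      have "g (p j) = ((p j - p b) \<bullet> (p j - p b) - (p j - p a) \<bullet> (p j - p a)) / 2"
        by (simp add: g_def inner_diff_left inner_diff_right inner_commute field_simps)
      then show ?thesis using n[of a] n[of b] by auto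
    qed
    have gF: "g (sg_map p j y) = (g y + g (p j)) / 2" for j y
      by (simp add: g_def sg_map_def inner_diff_left inner_add_left field_simps)
    have g0: "g (midpoint (p a) (p b)) = 0"
      by (simp add: g_def midpoint_def inner_diff_right inner_diff_left inner_add_left inner_add_right inner_commute)
        (simp add: field_simps)?
    \<comment> \<open>A contraction averages the value of \<open>g\<close> with its value at a
      vertex, so the bound 1/2 stays strict once it is strict at the start; this is why the
      midpoint, where \<open>g\<close> vanishes, is followed.\<close>
    have gw: "\<bar>g (sg_word p u (midpoint (p a) (p b)))\<bar> < 1/2" for u
    proof (induction u)
      case (Cons c u)
      then show ?case using gp[of c] unfolding sg_word_Cons o_apply gF by (auto simp: abs_if split: if_splits)
    qed (simp add: g0)
    define x where "x = midpoint (p a) (p b)"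
    have "sg_word p w x - sg_word p v' x = p b - p a"
    proof -
      have h: "sg_map p c y = (1/2) *\<^sub>R (y + p c)" for c y
        by (simp add: sg_map_def vec_eq_iff field_simps)
      have "sg_word p w x + p a = sg_word p v' x + p b"
        using eq[of x] unfolding h scaleR_cancel_left by simp
      then show ?thesis by (simp add: algebra_simps)
    qed
    then have "g (sg_word p w x) - g (sg_word p v' x) = (p b - p a) \<bullet> (p a - p b)"
      unfolding g_def by (simp flip: inner_diff_left)
    also have "\<dots> = - 1"
    proof -
      have "(p a - p b) \<bullet> (p a - p b) = 1"
        using tri ab unfolding unit_triangle_def dist_norm dot_square_norm by simp
      then show ?thesis by (metis inner_minus_left minus_diff_eq)
    qed
    finally show False using gw[of w] gw[of v'] unfolding x_def by linarith
  qed
  moreover have "sg_word p w = sg_word p v'"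
  proof
    fix x show "sg_word p w x = sg_word p v' x"
      using eq[of x] dist_sg_map[of p b "sg_word p w x" "sg_word p v' x"] \<open>a = b\<close> by simp
  qed
  ultimately show ?case using Cons.IH v by simp
qed simp

section \<open>Level energies as sums over cells, and their limit\<close>

context sierpinski
begin

text \<open>Ordered pairs of vertices, to match \<open>sg_edges\<close>; the diagonal terms
  vanish.\<close>

definition cell_energy :: "3 list \<Rightarrow> (real^2 \<Rightarrow> real) \<Rightarrow> (real^2 \<Rightarrow> real) \<Rightarrow> real" where
  "cell_energy w u v = (\<Sum>j\<in>UNIV. \<Sum>k\<in>UNIV.
     (u (sg_word p w (p j)) - u (sg_word p w (p k))) * (v (sg_word p w (p j)) - v (sg_word p w (p k))))"

lemma energy_level_cells:
  "sg_energy_level p n u v = (5/3) ^ n * (\<Sum>w | length w = n. cell_energy w u v)"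
proof -
  let ?I = "{w :: 3 list. length w = n} \<times> {(j, k). j \<noteq> (k :: 3)}"
  let ?f = "\<lambda>(w, (j, k)). (sg_word p w (p j), sg_word p w (p k))"
  let ?g = "\<lambda>(x, y). (u x - u y) * (v x - v y)"
  \<comment> \<open>Cells may share vertices but not edges: the direction of an edge determines the
    pair of vertex indices, then one end point fixes the map \<open>sg_word p w\<close>, and the map
    fixes the word.\<close>
  have inj: "inj_on ?f ?I"
  proof (rule inj_onI, clarsimp)
    fix w v :: "3 list" and j k j' k' :: 3
    assume n: "n = length w" "length v = length w" and ne: "j \<noteq> k" "j' \<noteq> k'"
      and eq: "sg_word p w (p j) = sg_word p v (p j')" "sg_word p w (p k) = sg_word p v (p k')"
    have "(1 / 2 ^ length w) *\<^sub>R (p j - p k) = (1 / 2 ^ length w) *\<^sub>R (p j' - p k')"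
      using eq sg_word_diff[of p w "p j" "p k"] sg_word_diff[of p v "p j'" "p k'"] n by simp
    then have "p j - p k = p j' - p k'" by (simp del: scaleR_diff_right scaleR_right_diff_distrib)
    then have jk: "j = j' \<and> k = k'" using unit_triangle_edge_inj[OF tri] ne by blast
    have "sg_word p w x = sg_word p v x" for x
      using sg_word_diff[of p w x "p j"] sg_word_diff[of p v x "p j"] eq jk n
      by (metis add_diff_cancel_left' diff_add_cancel)
    then have "sg_word p w = sg_word p v" by blast
    then have "w = v" using sg_word_inj[OF tri] n by simp
    then show "w = v \<and> j = j' \<and> k = k'" using jk by blast
  qed
  have img: "sg_edges p n = ?f ` ?I"
  proof (intro set_eqI iffI)
    fix e assume "e \<in> sg_edges p n"
    then obtain w j k where "length w = n" "e = (sg_word p w (p j), sg_word p w (p k))"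
      "sg_word p w (p j) \<noteq> sg_word p w (p k)"
      unfolding sg_edges_def by auto
    then show "e \<in> ?f ` ?I" by (intro image_eqI[of _ _ "(w, (j, k))"]) auto
  next
    fix e assume "e \<in> ?f ` ?I"
    then obtain w j k where "length w = n" "e = (sg_word p w (p j), sg_word p w (p k))" "j \<noteq> k" by auto
    moreover from this have "sg_word p w (p j) \<noteq> sg_word p w (p k)"
      using dist_sg_word[of p w "p j" "p k"] unit_triangle_neq[OF tri, of j k] by auto
    ultimately show "e \<in> sg_edges p n" unfolding sg_edges_def by blast
  qed
  have "(\<Sum>e\<in>sg_edges p n. ?g e) = (\<Sum>t\<in>?I. ?g (?f t))"
    unfolding img by (simp add: sum.reindex[OF inj])
  also have "\<dots> = (\<Sum>w | length w = n. \<Sum>jk\<in>{(j, k). j \<noteq> k}. ?g (?f (w, jk)))"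
    using card_words(1) by (subst sum.cartesian_product) (auto intro!: sum.cong)
  also have "\<dots> = (\<Sum>w | length w = n. cell_energy w u v)"
  proof (intro sum.cong refl)
    fix w :: "3 list"
    have "(\<Sum>jk\<in>{(j, k). j \<noteq> k}. ?g (?f (w, jk))) = (\<Sum>jk\<in>UNIV \<times> UNIV. ?g (?f (w, jk)))"
      by (rule sum.mono_neutral_left) auto
    then show "(\<Sum>jk\<in>{(j, k). j \<noteq> k}. ?g (?f (w, jk))) = cell_energy w u v"
      unfolding cell_energy_def sum.cartesian_product by (simp add: case_prod_unfold)
  qed
  finally show ?thesis unfolding sg_energy_level_def by (simp add: case_prod_unfold)
qed

lemma energy_level_linear:
  "sg_energy_level p n (\<lambda>x. a * u x + b * v x) f = a * sg_energy_level p n u f + b * sg_energy_level p n v f"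
  unfolding energy_level_cells cell_energy_def sum_distrib_left sum.distrib[symmetric]
  by (intro sum.cong refl) (simp add: algebra_simps)

lemma energy_level_sym: "sg_energy_level p n u v = sg_energy_level p n v u"
  unfolding energy_level_cells cell_energy_def by (simp add: mult.commute)

lemma cell_energy_nonneg: "cell_energy w u u \<ge> 0"
  unfolding cell_energy_def by (intro sum_nonneg) simp

lemma energy_level_nonneg: "sg_energy_level p n u u \<ge> 0"
  unfolding energy_level_cells by (intro mult_nonneg_nonneg sum_nonneg cell_energy_nonneg) auto

lemma energy_level_cong:
  assumes "\<And>x. x \<in> K \<Longrightarrow> u x = u' x" "\<And>x. x \<in> K \<Longrightarrow> v x = v' x"
  shows "sg_energy_level p n u v = sg_energy_level p n u' v'"
  unfolding energy_level_cells cell_energy_def using assms vertices_K by simp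

text \<open>\<open>V k j\<close> is the value at the midpoint of the images of \<open>p k\<close>
  and \<open>p j\<close>, and at a corner of the cell for k = j. It is symmetric because two
  subcells share that midpoint, which leaves the six values of
  \<open>harmonic_extension_ineq\<close>.\<close>

lemma cell_energy_subdivide: "3/5 * cell_energy w u u \<le> (\<Sum>k\<in>UNIV. cell_energy (w @ [k]) u u)"
proof -
  define V where "V k j = u (sg_word p w (sg_map p k (p j)))" for k j
  have sym: "V k j = V j k" for j k unfolding V_def by (metis sg_map_midpoint)
  have d: "u (sg_word p w (p j)) = V j j" for j by (simp add: V_def)
  have l: "cell_energy w u u = 2 * ((V 1 1 - V 2 2)\<^sup>2 + (V 2 2 - V 3 3)\<^sup>2 + (V 3 3 - V 1 1)\<^sup>2)"
    unfolding cell_energy_def d by (simp add: sum_3 power2_eq_square algebra_simps)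
  have "(\<Sum>k\<in>UNIV. cell_energy (w @ [k]) u u) = (\<Sum>k\<in>UNIV. \<Sum>i\<in>UNIV. \<Sum>j\<in>UNIV. (V k i - V k j) * (V k i - V k j))"
    unfolding cell_energy_def by (simp add: sg_word_append sg_word_Cons V_def)
  also have "\<dots> = 2 * ((V 1 1 - V 1 2)\<^sup>2 + (V 1 1 - V 1 3)\<^sup>2 + (V 1 2 - V 1 3)\<^sup>2
     + (V 2 2 - V 1 2)\<^sup>2 + (V 2 2 - V 2 3)\<^sup>2 + (V 1 2 - V 2 3)\<^sup>2
     + (V 3 3 - V 2 3)\<^sup>2 + (V 3 3 - V 1 3)\<^sup>2 + (V 2 3 - V 1 3)\<^sup>2)"
    unfolding sum_3 sym[of 2 1] sym[of 3 1] sym[of 3 2] by (simp add: power2_eq_square algebra_simps)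
  finally show ?thesis
    unfolding l using harmonic_extension_ineq[of "V 1 1" "V 2 2" "V 3 3" "V 1 2" "V 1 3" "V 2 3"] by simp
qed

lemma sum_words_Suc:
  "(\<Sum>w | length w = Suc n. f w) = (\<Sum>w | length w = n. \<Sum>k\<in>UNIV. f (w @ [k :: 3]) :: real)"
proof -
  have "(\<Sum>w | length w = Suc n. f w) = (\<Sum>(w, k)\<in>{w. length w = n} \<times> (UNIV :: 3 set). f (w @ [k]))"
    by (rule sum.reindex_bij_witness[of _ "\<lambda>(w, k). w @ [k]" "\<lambda>w. (butlast w, last w)"])
       (auto simp: append_butlast_last_id length_0_conv[symmetric] simp del: length_0_conv)
  then show ?thesis by (simp add: sum.cartesian_product)
qed

lemma energy_level_mono: "incseq (\<lambda>n. sg_energy_level p n u u)"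
proof (rule incseq_SucI)
  fix n
  have "3/5 * (\<Sum>w | length w = n. cell_energy w u u) \<le> (\<Sum>w | length w = Suc n. cell_energy w u u)"
    unfolding sum_words_Suc sum_distrib_left by (intro sum_mono cell_energy_subdivide)
  then have "(5/3) ^ Suc n * (3/5 * (\<Sum>w | length w = n. cell_energy w u u)) \<le> (5/3) ^ Suc n * (\<Sum>w | length w = Suc n. cell_energy w u u)"
    by (rule mult_left_mono) simp
  then show "sg_energy_level p n u u \<le> sg_energy_level p (Suc n) u u"
    unfolding energy_level_cells by simp
qed

lemma energy_level_reflection:
  "sg_energy_level p n (\<lambda>x. u (sg_reflection p i x)) (\<lambda>x. v (sg_reflection p i x)) = sg_energy_level p n u v"
proof -
  let ?t = "vertex_swap i"
  have b: "bij_betw ?t UNIV UNIV"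
    by (rule bij_betw_byWitness[where f' = ?t]) auto
  have *: "(\<Sum>j\<in>UNIV. \<Sum>k\<in>UNIV. G (?t j) (?t k)) = (\<Sum>j\<in>UNIV. \<Sum>k\<in>UNIV. G j k)" for G :: "3 \<Rightarrow> 3 \<Rightarrow> real"
  proof -
    have "(\<Sum>k\<in>UNIV. G (?t j) (?t k)) = (\<Sum>k\<in>UNIV. G (?t j) k)" for j
      by (rule sum.reindex_bij_betw[OF b])
    then show ?thesis using sum.reindex_bij_betw[OF b, of "\<lambda>j. \<Sum>k\<in>UNIV. G j k"] by simp
  qed
  have "cell_energy w (\<lambda>x. u (sg_reflection p i x)) (\<lambda>x. v (sg_reflection p i x)) = cell_energy (map ?t w) u v" for w
    unfolding cell_energy_def reflection_sg_word[OF tri] reflection_vertex[OF tri]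
    by (rule *[of "\<lambda>j k. (u (sg_word p (map ?t w) (p j)) - u (sg_word p (map ?t w) (p k))) * (v (sg_word p (map ?t w) (p j)) - v (sg_word p (map ?t w) (p k)))"])
  then show ?thesis
    unfolding energy_level_cells
    by (auto intro!: sum.reindex_bij_witness[of _ "map ?t" "map ?t"])
qed

abbreviation "\<F> \<equiv> sg_form_domain p K"

lemma form_domainD:
  assumes "u \<in> \<F>"
  shows "continuous_on K u" "(\<lambda>n. sg_energy_level p n u u) \<longlonglongrightarrow> sg_energy p u u" "u (p j) = 0"
    "sg_energy_level p n u u \<le> sg_energy p u u"
proof -
  show "continuous_on K u" and 1: "(\<lambda>n. sg_energy_level p n u u) \<longlonglongrightarrow> sg_energy p u u" and "u (p j) = 0"
    using assms by (auto simp: sg_form_domain_def sg_energy_def convergent_LIMSEQ_iff)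
  show "sg_energy_level p n u u \<le> sg_energy p u u"
    using energy_level_mono 1 by (rule incseq_le)
qed

lemma form_domainI:
  assumes "continuous_on K u" "\<And>n. sg_energy_level p n u u \<le> B" "\<And>j. u (p j) = 0"
  shows "u \<in> \<F>"
proof -
  have "Bseq (\<lambda>n. sg_energy_level p n u u)"
    using assms(2) energy_level_nonneg by (intro BseqI'[of _ B]) simp
  then show ?thesis
    using assms Bseq_monoseq_convergent[OF _ incseq_imp_monoseq[OF energy_level_mono]]
    by (auto simp: sg_form_domain_def)
qed

lemma form_domain_linear:
  assumes "u \<in> \<F>" "v \<in> \<F>"
  shows "(\<lambda>x. a * u x + b * v x) \<in> \<F>"
proof (rule form_domainI)
  show "continuous_on K (\<lambda>x. a * u x + b * v x)" using assms by (intro continuous_intros form_domainD)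
  show "a * u (p j) + b * v (p j) = 0" for j using assms by (simp add: form_domainD)
  fix n
  let ?E = "sg_energy_level p n"
  \<comment> \<open>The signs \<open>s\<close> = 1 and \<open>s\<close> = -1 give the parallelogram
    identity: adding the non-negative energy of a u - b v cancels the mixed term.\<close>
  let ?w = "\<lambda>s x. a * u x + s * b * v x"
  have exp: "?E (?w s) (?w s) = a\<^sup>2 * ?E u u + 2 * (s * a * b * ?E u v) + s\<^sup>2 * b\<^sup>2 * ?E v v" for s
    by (subst energy_level_linear, subst (1 2) energy_level_sym, subst (1 2) energy_level_linear)
      (simp add: power2_eq_square algebra_simps energy_level_sym[of n v u])
  have "?E (?w 1) (?w 1) \<le> ?E (?w 1) (?w 1) + ?E (?w (-1)) (?w (-1))"
    using energy_level_nonneg by simp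
  also have "\<dots> = 2 * a\<^sup>2 * ?E u u + 2 * b\<^sup>2 * ?E v v" unfolding exp by simp
  also have "\<dots> \<le> 2 * a\<^sup>2 * sg_energy p u u + 2 * b\<^sup>2 * sg_energy p v v"
    using assms by (intro add_mono mult_left_mono form_domainD) auto
  finally show "?E (\<lambda>x. a * u x + b * v x) (\<lambda>x. a * u x + b * v x) \<le> 2 * a\<^sup>2 * sg_energy p u u + 2 * b\<^sup>2 * sg_energy p v v"
    by simp
qed

text \<open>The form domain postulates convergence only on the diagonal; polarization extends it to
  pairs, so that the \<open>lim\<close> in \<open>sg_energy\<close> is a genuine limit.\<close>

lemma energy_tendsto:
  assumes "u \<in> \<F>" "v \<in> \<F>"
  shows "(\<lambda>n. sg_energy_level p n u v) \<longlonglongrightarrow> sg_energy p u v"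
proof -
  let ?w = "\<lambda>x. 1 * u x + 1 * v x"
  let ?E = "sg_energy_level p"
  have "?E n ?w ?w = ?E n u u + 2 * ?E n u v + ?E n v v" for n
    by (subst energy_level_linear, subst (1 2) energy_level_sym, subst (1 2) energy_level_linear)
      (simp add: energy_level_sym[of n v u])
  then have eq: "?E n u v = (?E n ?w ?w - ?E n u u - ?E n v v) / 2" for n by simp
  have "(\<lambda>n. ?E n u v) \<longlonglongrightarrow> (sg_energy p ?w ?w - sg_energy p u u - sg_energy p v v) / 2"
    unfolding eq by (intro tendsto_intros form_domainD form_domain_linear assms) simp
  then show ?thesis unfolding sg_energy_def by (simp add: convergentI convergent_LIMSEQ_iff[symmetric])
qed

lemma energy_linear:
  assumes "u \<in> \<F>" "v \<in> \<F>" "f \<in> \<F>"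
  shows "sg_energy p (\<lambda>x. a * u x + b * v x) f = a * sg_energy p u f + b * sg_energy p v f"
proof (rule LIMSEQ_unique)
  show "(\<lambda>n. sg_energy_level p n (\<lambda>x. a * u x + b * v x) f) \<longlonglongrightarrow> sg_energy p (\<lambda>x. a * u x + b * v x) f"
    by (intro energy_tendsto form_domain_linear assms)
  show "(\<lambda>n. sg_energy_level p n (\<lambda>x. a * u x + b * v x) f) \<longlonglongrightarrow> a * sg_energy p u f + b * sg_energy p v f"
    unfolding energy_level_linear by (intro tendsto_intros energy_tendsto assms)
qed

lemma energy_sym: "sg_energy p u v = sg_energy p v u"
  unfolding sg_energy_def by (simp add: energy_level_sym)

lemma form_domain_reflection: "u \<in> \<F> \<Longrightarrow> (\<lambda>x. u (sg_reflection p i x)) \<in> \<F>"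
  unfolding sg_form_domain_def
  using continuous_on_compose2[OF _ continuous_on_reflection[OF tri], of K u i K] reflection_K
  by (auto simp: reflection_vertex[OF tri] energy_level_reflection)

lemma energy_reflection:
  "sg_energy p (\<lambda>x. u (sg_reflection p i x)) v = sg_energy p u (\<lambda>x. v (sg_reflection p i x))"
  using energy_level_reflection[of _ u i "\<lambda>x. v (sg_reflection p i x)"]
  by (simp add: sg_energy_def reflection_involution[OF tri])

lemma form_domain_cong:
  assumes "\<And>x. x \<in> K \<Longrightarrow> u x = u' x"
  shows "u \<in> \<F> \<longleftrightarrow> u' \<in> \<F>" "sg_energy p u v = sg_energy p u' v"
  unfolding sg_form_domain_def sg_energy_def
  using assms energy_level_cong[of u u' u u'] energy_level_cong[of u u' v v] vertex_K
  by (auto cong: continuous_on_cong)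

text \<open>Successive vertices along the cells containing a point differ by at most the square root of
  \<open>(3/5)^n\<close> times the energy, and these differences are summable.\<close>
lemma sup_energy_bound:
  "\<exists>C. C > 0 \<and> (\<forall>u\<in>\<F>. \<forall>x\<in>K. (u x)\<^sup>2 \<le> C * sg_energy p u u)"
proof -
  define r :: real where "r = sqrt (3/5)"
  have r: "0 \<le> r" "r < 1" "r\<^sup>2 = 3/5"
    unfolding r_def by simp_all
  have bound: "\<bar>u x\<bar> \<le> sqrt (sg_energy p u u) / (1 - r)" if u: "u \<in> \<F>" and x: "x \<in> K" for u x
  proof -
    define s where "s = sqrt (sg_energy p u u)"
    have E0: "sg_energy p u u \<ge> 0"
      using form_domainD(4)[OF u, of 0] energy_level_nonneg[of 0 u] by linarith
    have s: "s \<ge> 0" "s\<^sup>2 = sg_energy p u u" using E0 by (simp_all add: s_def)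
    have edge: "\<bar>u (sg_word p w (p j)) - u (sg_word p w (p k))\<bar> \<le> r ^ length w * s" for w j k
    proof -
      let ?d = "\<lambda>j k. (u (sg_word p w (p j)) - u (sg_word p w (p k))) * (u (sg_word p w (p j)) - u (sg_word p w (p k)))"
      have "?d j k \<le> (\<Sum>k\<in>UNIV. ?d j k)" by (rule member_le_sum) auto
      also have "\<dots> \<le> cell_energy w u u" unfolding cell_energy_def
        by (rule member_le_sum[of j UNIV "\<lambda>j. \<Sum>k\<in>UNIV. ?d j k"]) (auto intro!: sum_nonneg)
      also have "\<dots> \<le> (\<Sum>w' | length w' = length w. cell_energy w' u u)"
        by (rule member_le_sum) (auto simp: cell_energy_nonneg card_words)
      also have "\<dots> = (3/5) ^ length w * sg_energy_level p (length w) u u"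
        unfolding energy_level_cells by (simp add: power_mult_distrib[symmetric] mult.assoc[symmetric])
      also have "\<dots> \<le> (3/5) ^ length w * s\<^sup>2"
        unfolding s by (intro mult_left_mono form_domainD u) simp
      also have "\<dots> = (r ^ length w * s)\<^sup>2" by (simp add: power_mult_distrib r(3)[symmetric] flip: power_mult)
        (simp add: mult.commute)
      finally have "\<bar>u (sg_word p w (p j)) - u (sg_word p w (p k))\<bar>\<^sup>2 \<le> (r ^ length w * s)\<^sup>2"
        by (simp add: power2_eq_square)
      then show ?thesis by (rule power2_le_imp_le) (use r s in simp)
    qed
    have vert: "\<bar>u (sg_word p w (p j))\<bar> \<le> (\<Sum>k\<le>length w. r ^ k) * s" for w j
    proof (induction w arbitrary: j rule: rev_induct)
      case Nil
      then show ?case using form_domainD(3)[OF u] s by simp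
    next
      case (snoc k w)
      \<comment> \<open>The corner of the new cell at \<open>p k\<close> is already a corner of the
        old one, so a single edge of the new cell links \<open>p j\<close> to the previous level.
        The chain starts at the value 0 on the boundary.\<close>
      have "sg_word p (w @ [k]) (p k) = sg_word p w (p k)" by (simp add: sg_word_append sg_word_Cons)
      then show ?case using edge[of "w @ [k]" j k] snoc[of k] by (simp add: algebra_simps)
    qed
    have geo: "(\<Sum>k\<le>n. r ^ k) \<le> 1 / (1 - r)" for n
      using r unfolding lessThan_Suc_atMost[symmetric] sum_gp_strict
      by (simp add: divide_right_mono)
    have vert': "\<bar>u y\<bar> \<le> s / (1 - r)" if y_in: "y \<in> {sg_word p w (p j) |w j. True}" for y
    proof -
      obtain w j where y: "y = sg_word p w (p j)" using y_in by blast
      have "\<bar>u y\<bar> \<le> 1 / (1 - r) * s"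
        unfolding y by (rule order_trans[OF vert mult_right_mono[OF geo s(1)]])
      then show ?thesis by simp
    qed
    have xcl: "x \<in> closure {sg_word p w (p j) |w j. True}"
      unfolding closure_approachable
    proof (intro allI impI)
      fix e :: real assume "e > 0"
      from small_cell[OF this] obtain n where
        n: "\<forall>w. length w = n \<longrightarrow> (\<forall>x\<in>K. \<forall>y\<in>K. dist (sg_word p w x) (sg_word p w y) < e)" ..
      obtain w z where w: "length w = n" "z \<in> K" "x = sg_word p w z" using cell_cover[OF x, of n] by blast
      then have "dist (sg_word p w (p 1)) x < e" using n vertex_K by blast
      then show "\<exists>y\<in>{sg_word p w (p j) |w j. True}. dist y x < e" by blast
    qed
    have "closure {sg_word p w (p j) |w j. True} \<subseteq> K"
      using vertices_K by (intro closure_minimal closed_K) auto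
    then have cont: "continuous_on (closure {sg_word p w (p j) |w j. True}) (\<lambda>x. \<bar>u x\<bar>)"
      by (intro continuous_intros continuous_on_subset[OF form_domainD(1)[OF u]])
    show ?thesis
      unfolding s_def[symmetric] by (rule continuous_le_on_closure[OF cont xcl vert'])
  qed
  have "(u x)\<^sup>2 \<le> 1 / (1 - r)\<^sup>2 * sg_energy p u u" if u: "u \<in> \<F>" and x: "x \<in> K" for u x
  proof -
    have E0: "sg_energy p u u \<ge> 0"
      using form_domainD(4)[OF u, of 0] energy_level_nonneg[of 0 u] by linarith
    have "\<bar>u x\<bar>\<^sup>2 \<le> (sqrt (sg_energy p u u) / (1 - r))\<^sup>2"
      using bound[OF u x] by (rule power_mono) simp
    then show ?thesis using E0 by (simp add: power_divide)
  qed
  moreover have "1 / (1 - r)\<^sup>2 > 0" using r by simp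
  ultimately show ?thesis by blast
qed

end

section \<open>Square-integrable functions\<close>

lemma L2_measurable: "f \<in> L2 M \<Longrightarrow> f \<in> borel_measurable M"
  by (simp add: L2_def)

lemma L2_integrable_mult:
  assumes "f \<in> L2 M" "g \<in> L2 M"
  shows "integrable M (\<lambda>x. f x * g x)"
proof (rule Bochner_Integration.integrable_bound)
  show "integrable M (\<lambda>x. (f x)\<^sup>2 + (g x)\<^sup>2)" using assms by (simp add: L2_def)
  show "(\<lambda>x. f x * g x) \<in> borel_measurable M"
    using assms by (intro borel_measurable_times L2_measurable)
  have "\<bar>a * b\<bar> \<le> a\<^sup>2 + b\<^sup>2" for a b :: real
    using sum_squares_bound[of "\<bar>a\<bar>" "\<bar>b\<bar>"] mult_nonneg_nonneg[OF abs_ge_zero[of a] abs_ge_zero[of b]]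
    unfolding abs_mult power2_abs mult.assoc by linarith
  then show "AE x in M. norm (f x * g x) \<le> norm ((f x)\<^sup>2 + (g x)\<^sup>2)" by simp
qed

lemma L2_linear:
  assumes "f \<in> L2 M" "g \<in> L2 M"
  shows "(\<lambda>x. a * f x + b * g x) \<in> L2 M"
proof -
  have "(\<lambda>x. (a * f x + b * g x)\<^sup>2) = (\<lambda>x. a\<^sup>2 * (f x)\<^sup>2 + 2 * a * b * (f x * g x) + b\<^sup>2 * (g x)\<^sup>2)"
    by (auto simp: power2_eq_square algebra_simps)
  then show ?thesis
    using assms L2_integrable_mult[OF assms] by (auto simp: L2_def)
qed

lemma L2_scale: "f \<in> L2 M \<Longrightarrow> (\<lambda>x. a * f x) \<in> L2 M"
  using L2_linear[of f M f a 0] by simp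

lemma L2_add: "f \<in> L2 M \<Longrightarrow> g \<in> L2 M \<Longrightarrow> (\<lambda>x. f x + g x) \<in> L2 M"
  using L2_linear[of f M g 1 1] by simp

lemma L2_diff: "f \<in> L2 M \<Longrightarrow> g \<in> L2 M \<Longrightarrow> (\<lambda>x. f x - g x) \<in> L2 M"
  using L2_linear[of f M g 1 "-1"] by simp

lemma L2_zero: "(\<lambda>x. 0) \<in> L2 M"
  by (simp add: L2_def)

lemma L2_sum: "(\<And>k. k \<in> A \<Longrightarrow> f k \<in> L2 M) \<Longrightarrow> (\<lambda>x. \<Sum>k\<in>A. c k * f k x) \<in> L2 M"
  by (induction A rule: infinite_finite_induct) (auto simp: L2_zero L2_add L2_scale)

lemma L2_inner_commute: "L2_inner M f g = L2_inner M g f"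
  by (simp add: L2_inner_def mult.commute)

lemma L2_inner_linear:
  assumes "f \<in> L2 M" "g \<in> L2 M" "h \<in> L2 M"
  shows "L2_inner M (\<lambda>x. a * f x + b * g x) h = a * L2_inner M f h + b * L2_inner M g h"
  unfolding L2_inner_def using L2_integrable_mult[OF assms(1,3)] L2_integrable_mult[OF assms(2,3)]
  by (simp add: distrib_right mult.assoc)

lemma L2_inner_diff:
  assumes "f \<in> L2 M" "g \<in> L2 M" "h \<in> L2 M"
  shows "L2_inner M (\<lambda>x. f x - g x) h = L2_inner M f h - L2_inner M g h"
  using L2_inner_linear[OF assms, of 1 "-1"] by simp

lemma L2_inner_scale: "L2_inner M (\<lambda>x. a * f x) h = a * L2_inner M f h"
  unfolding L2_inner_def by (simp add: mult.assoc)

lemma L2_inner_sum: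
  assumes "\<And>k. k \<in> A \<Longrightarrow> f k \<in> L2 M" "h \<in> L2 M"
  shows "L2_inner M (\<lambda>x. \<Sum>k\<in>A. c k * f k x) h = (\<Sum>k\<in>A. c k * L2_inner M (f k) h)"
  using L2_integrable_mult[OF assms(1) assms(2)]
  unfolding L2_inner_def by (simp add: sum_distrib_right mult.assoc)

lemma L2_inner_cong_AE:
  assumes "f \<in> borel_measurable M" "f' \<in> borel_measurable M" "g \<in> borel_measurable M"
    "AE x in M. f x = f' x"
  shows "L2_inner M f g = L2_inner M f' g"
  unfolding L2_inner_def using assms by (intro integral_cong_AE) auto

lemma L2_norm_nonneg [simp]: "L2_norm M f \<ge> 0"
  by (simp add: L2_norm_def L2_inner_def)

lemma L2_norm_power2: "(L2_norm M f)\<^sup>2 = L2_inner M f f"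
  by (simp add: L2_norm_def L2_inner_def)

lemma L2_norm_zero_iff:
  assumes "f \<in> L2 M"
  shows "L2_norm M f = 0 \<longleftrightarrow> (AE x in M. f x = 0)"
  using integral_nonneg_eq_0_iff_AE[OF L2_integrable_mult[OF assms assms]]
  by (simp add: L2_norm_def L2_inner_def)

lemma L2_inner_square_linear:
  assumes "f \<in> L2 M" "g \<in> L2 M"
  shows "L2_inner M (\<lambda>x. a * f x + b * g x) (\<lambda>x. a * f x + b * g x)
    = a\<^sup>2 * L2_inner M f f + 2 * a * b * L2_inner M f g + b\<^sup>2 * L2_inner M g g" (is "L2_inner M ?h ?h = _")
proof -
  have 1: "L2_inner M ?h ?h = a * L2_inner M f ?h + b * L2_inner M g ?h"
    by (rule L2_inner_linear[OF assms L2_linear[OF assms]])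
  have 2: "L2_inner M f ?h = a * L2_inner M f f + b * L2_inner M f g"
    unfolding L2_inner_commute[of M f ?h] L2_inner_linear[OF assms assms(1)] L2_inner_commute[of M g f] ..
  have 3: "L2_inner M g ?h = a * L2_inner M f g + b * L2_inner M g g"
    unfolding L2_inner_commute[of M g ?h] L2_inner_linear[OF assms assms(2)] ..
  show ?thesis unfolding 1 2 3 by (simp add: power2_eq_square algebra_simps)
qed

lemma L2_Cauchy_Schwarz:
  assumes "f \<in> L2 M" "g \<in> L2 M"
  shows "\<bar>L2_inner M f g\<bar> \<le> L2_norm M f * L2_norm M g"
proof -
  let ?A = "L2_inner M f f" and ?B = "L2_inner M f g" and ?C = "L2_inner M g g"
  have quad: "0 \<le> a\<^sup>2 * ?A + 2 * a * b * ?B + b\<^sup>2 * ?C" for a b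
  proof -
    let ?h = "\<lambda>x. a * f x + b * g x"
    have "a\<^sup>2 * ?A + 2 * a * b * ?B + b\<^sup>2 * ?C = (L2_norm M ?h)\<^sup>2"
      unfolding L2_norm_power2 L2_inner_square_linear[OF assms] ..
    then show ?thesis by simp
  qed
  have nn: "?A \<ge> 0" "?C \<ge> 0" using quad[of 1 0] quad[of 0 1] by simp_all
  have "?B\<^sup>2 \<le> ?A * ?C"
  proof (cases "?C = 0")
    case True
    have "AE x in M. g x = 0" using True L2_norm_zero_iff[OF assms(2)] by (simp add: L2_norm_def)
    then have "?B = L2_inner M (\<lambda>x. 0) f"
      using assms by (subst L2_inner_commute) (intro L2_inner_cong_AE L2_measurable, auto simp: L2_zero)
    then show ?thesis using nn by (simp add: L2_inner_def)
  next
    case False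
    with nn have C: "?C > 0" by simp
    have "0 \<le> ?C * (?A * ?C - ?B\<^sup>2)"
      using quad[of ?C "- ?B"] by (simp add: power2_eq_square algebra_simps)
    then show ?thesis using C by (simp add: zero_le_mult_iff)
  qed
  then have "sqrt (?B\<^sup>2) \<le> sqrt (?A * ?C)" by (rule real_sqrt_le_mono)
  then show ?thesis by (simp add: L2_norm_def real_sqrt_mult)
qed

context sierpinski
begin

lemma prob_K [simp]: "prob K = 1"
  using prob_space by simp

lemma continuous_bounded:
  fixes f :: "real^2 \<Rightarrow> real"
  assumes "continuous_on K f"
  shows "\<exists>B\<ge>0. \<forall>x\<in>K. \<bar>f x\<bar> \<le> B"
proof -
  have "bounded (f ` K)" by (intro compact_imp_bounded compact_continuous_image assms compact_K)
  then obtain B where "\<forall>x\<in>K. \<bar>f x\<bar> \<le> B" unfolding bounded_iff by auto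
  then show ?thesis by (intro exI[of _ "max 0 B"]) force
qed

lemma L2_bounded:
  assumes [measurable]: "f \<in> borel_measurable \<mu>" and "\<And>x. x \<in> K \<Longrightarrow> \<bar>f x\<bar> \<le> B"
  shows "f \<in> L2 \<mu>"
proof -
  have "integrable \<mu> (\<lambda>x. (f x)\<^sup>2)"
  proof (rule integrable_const_bound[where B = "B\<^sup>2"])
    show "AE x in \<mu>. norm ((f x)\<^sup>2) \<le> B\<^sup>2"
    proof (rule AE_I2)
      fix x assume "x \<in> space \<mu>"
      then have "\<bar>f x\<bar>\<^sup>2 \<le> B\<^sup>2" using assms(2)[of x] by (intro power_mono) auto
      then show "norm ((f x)\<^sup>2) \<le> B\<^sup>2" by simp
    qed
  qed simp
  then show ?thesis by (simp add: L2_def)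
qed

lemma L2_continuous:
  fixes f :: "real^2 \<Rightarrow> real"
  assumes "continuous_on K f"
  shows "f \<in> L2 \<mu>"
  using continuous_bounded[OF assms] L2_bounded[OF measurable_mu[OF assms]] by blast

lemma L2_norm_bounded:
  assumes "f \<in> borel_measurable \<mu>" and "B \<ge> 0" and "\<And>x. x \<in> K \<Longrightarrow> \<bar>f x\<bar> \<le> B"
  shows "L2_norm \<mu> f \<le> B"
proof -
  have f: "f \<in> L2 \<mu>" using L2_bounded assms by blast
  have sq: "f x * f x \<le> B\<^sup>2" if "x \<in> K" for x
    using power_mono[OF assms(3)[OF that], of 2] by (simp add: power2_eq_square)
  have "L2_inner \<mu> f f \<le> (LINT x|\<mu>. B\<^sup>2)"
    unfolding L2_inner_def using sq by (intro integral_mono L2_integrable_mult f) auto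
  then have "(L2_norm \<mu> f)\<^sup>2 \<le> B\<^sup>2" by (simp add: L2_norm_power2 prob_space)
  then show ?thesis using assms(2) by (rule power2_le_imp_le)
qed

lemma L2_reflection:
  assumes "f \<in> L2 \<mu>"
  shows "(\<lambda>x. f (sg_reflection p i x)) \<in> L2 \<mu>"
  using assms integral_reflection(2)[OF borel_measurable_power, of f i 2] measurable_compose[OF reflection_measurable, of f borel i]
  by (simp add: L2_def)

lemma L2_inner_reflection:
  assumes "f \<in> L2 \<mu>" "g \<in> L2 \<mu>"
  shows "L2_inner \<mu> (\<lambda>x. f (sg_reflection p i x)) g = L2_inner \<mu> f (\<lambda>x. g (sg_reflection p i x))"
  using integral_reflection(1)[OF borel_measurable_times, OF L2_measurable L2_measurable, OF assms(1) L2_reflection[OF assms(2)], of i i]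
  by (simp add: L2_inner_def reflection_involution[OF tri])

lemma L2_norm_reflection:
  assumes "f \<in> L2 \<mu>"
  shows "L2_norm \<mu> (\<lambda>x. f (sg_reflection p i x)) = L2_norm \<mu> f"
  unfolding L2_norm_def L2_inner_reflection[OF assms L2_reflection[OF assms]]
  by (simp add: reflection_involution[OF tri])

end

section \<open>The eigenbasis\<close>

locale sierpinski_eigen = sierpinski +
  fixes lam :: "nat \<Rightarrow> real" and \<phi> :: "nat \<Rightarrow> real^2 \<Rightarrow> real"
  assumes eigenbasis: "is_eigenbasis p K \<mu> lam \<phi>"
begin

lemma lam_pos [simp]: "0 < lam k" and lam_mono: "j \<le> k \<Longrightarrow> lam j \<le> lam k"
  and phi_continuous: "continuous_on K (\<phi> k)"
  and phi_orthonormal: "L2_inner \<mu> (\<phi> j) (\<phi> k) = (if j = k then 1 else 0)"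
  using eigenbasis unfolding is_eigenbasis_def by (auto simp: mono_def)

lemma lam_neq_0 [simp]: "lam k \<noteq> 0"
  by (rule less_imp_neq[OF lam_pos, symmetric])

lemma phi_L2: "\<phi> k \<in> L2 \<mu>"
  by (rule L2_continuous[OF phi_continuous])

text \<open>The definition of the Laplacian supplies the weak equation only for some representative
  in the form domain. It agrees with the given one on \<open>K\<close> because both are
  continuous.\<close>

lemma phi_form_domain: "\<phi> k \<in> \<F>"
  and phi_weak: "v \<in> \<F> \<Longrightarrow> sg_energy p (\<phi> k) v = lam k * L2_inner \<mu> (\<phi> k) v"
proof -
  obtain u' where u': "u' \<in> \<F>" "AE x in \<mu>. \<phi> k x = u' x"
    and w: "\<And>v. v \<in> \<F> \<Longrightarrow> sg_energy p u' v = - L2_inner \<mu> (\<lambda>x. - lam k * \<phi> k x) v"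
    using eigenbasis unfolding is_eigenbasis_def sg_laplacian_def by metis
  have eq: "\<phi> k x = u' x" if "x \<in> K" for x
    using AE_eq_imp_eq[OF phi_continuous form_domainD(1)[OF u'(1)] u'(2) that] .
  show "\<phi> k \<in> \<F>" using form_domain_cong(1)[of "\<phi> k" u'] eq u'(1) by blast
  show "sg_energy p (\<phi> k) v = lam k * L2_inner \<mu> (\<phi> k) v" if "v \<in> \<F>"
    using form_domain_cong(2)[of "\<phi> k" u' v] eq w[OF that] L2_inner_scale[of \<mu> "- lam k" "\<phi> k" v] by simp
qed

lemma expansion_tendsto:
  "f \<in> L2 \<mu> \<Longrightarrow> (\<lambda>n. L2_norm \<mu> (\<lambda>x. f x - (\<Sum>k<n. L2_inner \<mu> f (\<phi> k) * \<phi> k x))) \<longlonglongrightarrow> 0"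
  using eigenbasis unfolding is_eigenbasis_def by blast

lemma inner_bounded_tendsto:
  assumes "\<And>n. f n \<in> L2 \<mu>" "g \<in> L2 \<mu>" "(\<lambda>n. L2_norm \<mu> (f n)) \<longlonglongrightarrow> 0"
  shows "(\<lambda>n. L2_inner \<mu> (f n) g) \<longlonglongrightarrow> 0"
proof (rule Lim_null_comparison)
  show "\<forall>\<^sub>F n in sequentially. norm (L2_inner \<mu> (f n) g) \<le> L2_norm \<mu> (f n) * L2_norm \<mu> g"
    using L2_Cauchy_Schwarz[OF assms(1,2)] by simp
  show "(\<lambda>n. L2_norm \<mu> (f n) * L2_norm \<mu> g) \<longlonglongrightarrow> 0"
    using tendsto_mult_left_zero[OF assms(3)] .
qed

lemma Parseval:
  assumes "f \<in> L2 \<mu>" "g \<in> L2 \<mu>"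
  shows "(\<lambda>k. L2_inner \<mu> f (\<phi> k) * L2_inner \<mu> g (\<phi> k)) sums L2_inner \<mu> f g"
proof -
  let ?S = "\<lambda>n x. \<Sum>k<n. L2_inner \<mu> f (\<phi> k) * \<phi> k x"
  have S: "?S n \<in> L2 \<mu>" for n by (intro L2_sum phi_L2)
  have lim: "(\<lambda>n. L2_inner \<mu> (\<lambda>x. f x - ?S n x) g) \<longlonglongrightarrow> 0"
    by (intro inner_bounded_tendsto expansion_tendsto L2_diff S assms)
  have "(\<Sum>k<n. L2_inner \<mu> f (\<phi> k) * L2_inner \<mu> g (\<phi> k)) = L2_inner \<mu> f g - L2_inner \<mu> (\<lambda>x. f x - ?S n x) g" for n
    using assms S[of n] by (simp add: L2_inner_diff L2_inner_sum phi_L2 L2_inner_commute[of \<mu> g])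
  then show ?thesis unfolding sums_def
    using tendsto_diff[OF tendsto_const lim, of "L2_inner \<mu> f g"] by simp
qed

lemma L2_eq_if_coeffs_eq:
  assumes "f \<in> L2 \<mu>" "g \<in> L2 \<mu>" "\<And>k. L2_inner \<mu> f (\<phi> k) = L2_inner \<mu> g (\<phi> k)"
  shows "AE x in \<mu>. f x = g x"
proof -
  let ?h = "\<lambda>x. f x - g x"
  have h: "?h \<in> L2 \<mu>" using assms by (intro L2_diff)
  have "L2_inner \<mu> ?h (\<phi> k) = 0" for k using assms by (simp add: L2_inner_diff phi_L2)
  then have "(\<lambda>k. 0) sums L2_inner \<mu> ?h ?h" using Parseval[OF h h] by simp
  then have "L2_inner \<mu> ?h ?h = 0" using sums_unique2 sums_zero by blast
  then have "AE x in \<mu>. ?h x = 0" using L2_norm_zero_iff[OF h] by (simp add: L2_norm_def)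
  then show ?thesis by eventually_elim simp
qed

text \<open>The reflection preserves the inner product, the form and its domain. Completeness
  follows by expanding the reflected function in the original basis and reflecting the remainder
  back.\<close>

lemma reflected_eigenbasis: "is_eigenbasis p K \<mu> lam (\<lambda>k x. \<phi> k (sg_reflection p i x))"
  unfolding is_eigenbasis_def
proof (intro conjI allI ballI)
  let ?s = "sg_reflection p i"
  show "0 < lam k" for k by simp
  show "mono lam" using lam_mono by (simp add: mono_def)
  fix k j
  show "continuous_on K (\<lambda>x. \<phi> k (?s x))"
    using continuous_on_compose2[OF phi_continuous continuous_on_reflection[OF tri]] reflection_K by blast
  show "L2_inner \<mu> (\<lambda>x. \<phi> j (?s x)) (\<lambda>x. \<phi> k (?s x)) = (if j = k then 1 else 0)"
    using L2_inner_reflection[OF phi_L2[of j] L2_reflection[OF phi_L2[of k], of i], of i] phi_orthonormal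
    by (simp add: reflection_involution[OF tri])
  show "sg_laplacian p K \<mu> (\<lambda>x. \<phi> k (?s x)) (\<lambda>x. - lam k * \<phi> k (?s x))"
    unfolding sg_laplacian_def
  proof (intro conjI bexI ballI)
    show "(\<lambda>x. \<phi> k (?s x)) \<in> L2 \<mu>" "(\<lambda>x. - lam k * \<phi> k (?s x)) \<in> L2 \<mu>"
      by (intro L2_scale L2_reflection phi_L2)+
    show "(\<lambda>x. \<phi> k (?s x)) \<in> \<F>" by (intro form_domain_reflection phi_form_domain)
    fix v assume v: "v \<in> \<F>"
    have vL: "v \<in> L2 \<mu>" using form_domainD(1)[OF v] by (rule L2_continuous)
    show "sg_energy p (\<lambda>x. \<phi> k (?s x)) v = - L2_inner \<mu> (\<lambda>x. - lam k * \<phi> k (?s x)) v"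
      using phi_weak[OF form_domain_reflection[OF v, of i], of k] L2_inner_reflection[OF phi_L2[of k] vL, of i]
        L2_inner_scale[of \<mu> "- lam k" "\<lambda>x. \<phi> k (?s x)" v]
      by (simp add: energy_reflection)
  qed simp
  fix f assume f: "f \<in> L2 \<mu>"
  let ?f = "\<lambda>x. f (?s x)"
  have "L2_norm \<mu> (\<lambda>x. f x - (\<Sum>k<n. L2_inner \<mu> f (\<lambda>x. \<phi> k (?s x)) * \<phi> k (?s x)))
    = L2_norm \<mu> (\<lambda>x. ?f x - (\<Sum>k<n. L2_inner \<mu> ?f (\<phi> k) * \<phi> k x))" for n
  proof -
    have "(\<lambda>x. ?f x - (\<Sum>k<n. L2_inner \<mu> ?f (\<phi> k) * \<phi> k x)) \<in> L2 \<mu>"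
      by (intro L2_diff L2_reflection f L2_sum phi_L2)
    from L2_norm_reflection[OF this, of i] show ?thesis
      by (simp add: reflection_involution[OF tri] L2_inner_reflection[OF f phi_L2])
  qed
  then show "(\<lambda>n. L2_norm \<mu> (\<lambda>x. f x - (\<Sum>k<n. L2_inner \<mu> f (\<lambda>x. \<phi> k (?s x)) * \<phi> k (?s x)))) \<longlonglongrightarrow> 0"
    using expansion_tendsto[OF L2_reflection[OF f, of i]] by simp
qed

lemma phi_combination_energy:
  "(\<lambda>x. \<Sum>k<n. a k * \<phi> k x) \<in> \<F> \<and>
   (v \<in> \<F> \<longrightarrow> sg_energy p (\<lambda>x. \<Sum>k<n. a k * \<phi> k x) v = (\<Sum>k<n. a k * lam k * L2_inner \<mu> (\<phi> k) v))"
proof (induction n)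
  case 0
  \<comment> \<open>The empty combination is written as a trivial combination of
    \<open>\<phi> 0\<close> so that linearity of the domain and of the form covers it.\<close>
  have "(\<lambda>x. 0 * \<phi> 0 x + 0 * \<phi> 0 x) \<in> \<F>" by (intro form_domain_linear phi_form_domain)
  moreover have "sg_energy p (\<lambda>x. 0 * \<phi> 0 x + 0 * \<phi> 0 x) v = 0 * sg_energy p (\<phi> 0) v + 0 * sg_energy p (\<phi> 0) v"
    if "v \<in> \<F>" by (intro energy_linear phi_form_domain that)
  ultimately show ?case by simp
next
  case (Suc n)
  have "(\<lambda>x. 1 * (\<Sum>k<n. a k * \<phi> k x) + a n * \<phi> n x) \<in> \<F>"
    using Suc.IH by (intro form_domain_linear phi_form_domain) blast
  moreover have "sg_energy p (\<lambda>x. 1 * (\<Sum>k<n. a k * \<phi> k x) + a n * \<phi> n x) v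
      = 1 * sg_energy p (\<lambda>x. \<Sum>k<n. a k * \<phi> k x) v + a n * sg_energy p (\<phi> n) v" if "v \<in> \<F>"
    using Suc.IH by (intro energy_linear phi_form_domain that) blast
  ultimately show ?case using Suc.IH phi_weak by simp
qed

text \<open>The sup bound is applied to the truncated Green function
  \<open>\<Sum>k<n. \<phi> k x / lam k * \<phi> k\<close>, whose energy is its own value at \<open>x\<close>.\<close>
lemma Green_diagonal_bound:
  "\<exists>C>0. \<forall>n. \<forall>x\<in>K. (\<Sum>k<n. (\<phi> k x)\<^sup>2 / lam k) \<le> C"
proof -
  obtain C where C: "C > 0" "\<And>u x. u \<in> \<F> \<Longrightarrow> x \<in> K \<Longrightarrow> (u x)\<^sup>2 \<le> C * sg_energy p u u"
    using sup_energy_bound by blast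
  have "(\<Sum>k<n. (\<phi> k x)\<^sup>2 / lam k) \<le> C" if x: "x \<in> K" for n x
  proof -
    define S where "S = (\<Sum>k<n. (\<phi> k x)\<^sup>2 / lam k)"
    define a where "a k = \<phi> k x / lam k" for k
    let ?u = "\<lambda>y. \<Sum>k<n. a k * \<phi> k y"
    have ux: "?u x = S" by (simp add: S_def a_def power2_eq_square)
    have u: "?u \<in> \<F>" using phi_combination_energy by blast
    have ip: "L2_inner \<mu> (\<phi> k) ?u = a k" if "k < n" for k
      using that unfolding L2_inner_commute[of \<mu> "\<phi> k"]
      by (simp add: L2_inner_sum phi_L2 phi_orthonormal if_distrib cong: if_cong)
    have "sg_energy p ?u ?u = (\<Sum>k<n. a k * lam k * L2_inner \<mu> (\<phi> k) ?u)"
      using phi_combination_energy u by blast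
    also have "\<dots> = S" unfolding S_def
      by (intro sum.cong refl) (simp add: ip, simp add: a_def power2_eq_square)
    finally have "S\<^sup>2 \<le> C * S" using C(2)[OF u x] ux by simp
    moreover have "S \<ge> 0" unfolding S_def using less_imp_le[OF lam_pos] by (intro sum_nonneg divide_nonneg_nonneg) auto
    ultimately show ?thesis unfolding S_def[symmetric]
      using C(1) by (cases "S = 0") (auto simp: power2_eq_square)
  qed
  then show ?thesis using C(1) by blast
qed

text \<open>Integrating the Green bound gives the trace bound that the sum of 1 /
  \<open>lam m\<close> is at most C. As \<open>lam\<close> is monotone, an index k with eigenvalue l
  contributes at least (k + 1) / l to it, hence k \<le> C l.\<close>

lemma finite_multiplicity [simp]: "finite {k. lam k = l}"
proof (cases "{k. lam k = l} = {}")
  case False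
  then obtain j where j: "lam j = l" by blast
  obtain C where C: "C > 0" "\<And>n x. x \<in> K \<Longrightarrow> (\<Sum>k<n. (\<phi> k x)\<^sup>2 / lam k) \<le> C"
    using Green_diagonal_bound by blast
  have trace: "(\<Sum>k<n. 1 / lam k) \<le> C" for n
  proof -
    have int: "integrable \<mu> (\<lambda>x. (\<phi> k x)\<^sup>2)" for k using phi_L2[of k] by (simp add: L2_def)
    have "(\<Sum>k<n. 1 / lam k) = (LINT x|\<mu>. (\<Sum>k<n. (\<phi> k x)\<^sup>2 / lam k))"
      using phi_orthonormal[of k k for k] int by (simp add: L2_inner_def power2_eq_square)
    also have "\<dots> \<le> (LINT x|\<mu>. C)"
      using C(2) int by (intro integral_mono integrable_sum) auto
    finally show ?thesis by (simp add: prob_space)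
  qed
  have l: "l > 0" using j lam_pos by metis
  have "{k. lam k = l} \<subseteq> {..<Suc (nat \<lceil>C * l\<rceil>)}"
  proof
    fix k assume "k \<in> {k. lam k = l}"
    then have "lam m \<le> l" if "m < Suc k" for m using lam_mono[of m k] that by simp
    then have "(\<Sum>m<Suc k. 1 / l) \<le> (\<Sum>m<Suc k. 1 / lam m)"
      by (intro sum_mono divide_left_mono) (auto simp: l)
    then have "(real k + 1) / l \<le> C" using trace[of "Suc k"] by (simp add: add.commute)
    then have "real k \<le> C * l" using l by (simp add: divide_le_eq)
    then show "k \<in> {..<Suc (nat \<lceil>C * l\<rceil>)}" by (simp add: less_Suc_eq_le) linarith
  qed
  then show ?thesis by (rule finite_subset) simp
qed simp

end

section \<open>The heat kernel\<close>

text \<open>A matrix semigroup with derivative 0 at 0: from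
  \<open>1 + D(s + t) \<le> (1 + D s) (1 + D t)\<close> for \<open>D t = \<Sum>\<bar>b t - I\<bar>\<close> one gets
  \<open>1 + D t \<le> exp (n D(t / n))\<close>, and the exponent tends to 0.\<close>
lemma matrix_semigroup_trivial:
  fixes b :: "real \<Rightarrow> 'i \<Rightarrow> 'i \<Rightarrow> real"
  assumes fin: "finite I"
    and semi: "\<And>s t j k. s > 0 \<Longrightarrow> t > 0 \<Longrightarrow> j \<in> I \<Longrightarrow> k \<in> I \<Longrightarrow> b (s + t) j k = (\<Sum>l\<in>I. b t j l * b s l k)"
    and small: "\<And>j k. j \<in> I \<Longrightarrow> k \<in> I \<Longrightarrow> ((\<lambda>h. (b h j k - (if j = k then 1 else 0)) / h) \<longlongrightarrow> 0) (at_right 0)"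
    and t: "t > 0" and jk: "j \<in> I" "k \<in> I"
  shows "b t j k = (if j = k then 1 else 0)"
proof -
  define B where "B t j k = b t j k - (if j = k then 1 else 0)" for t j k
  define D where "D t = (\<Sum>j\<in>I. \<Sum>k\<in>I. \<bar>B t j k\<bar>)" for t
  have D0: "D t \<ge> 0" for t unfolding D_def by (intro sum_nonneg) simp
  have sub: "1 + D (s + t) \<le> (1 + D s) * (1 + D t)" if st: "s > 0" "t > 0" for s t
  proof -
    \<comment> \<open>This expands the product of I + \<open>B t\<close> and I +
      \<open>B s\<close>.\<close>
    have dec: "B (s + t) j k = (\<Sum>l\<in>I. B t j l * B s l k) + B t j k + B s j k" if "j \<in> I" "k \<in> I" for j k
    proof -
      have "B t j l * B s l k = b t j l * b s l k - (if l = k then b t j l else 0) - (if j = l then b s l k else 0)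
         + (if j = l then if l = k then 1 else 0 else 0)" for l
        by (simp add: B_def algebra_simps)
      then have "(\<Sum>l\<in>I. B t j l * B s l k) = b (s + t) j k - b t j k - b s j k + (if j = k then 1 else 0)"
        using that fin st by (simp add: sum.distrib sum_subtractf semi)
      then show ?thesis by (simp add: B_def)
    qed
    have "D (s + t) \<le> (\<Sum>j\<in>I. \<Sum>k\<in>I. (\<Sum>l\<in>I. \<bar>B t j l\<bar> * \<bar>B s l k\<bar>) + \<bar>B t j k\<bar> + \<bar>B s j k\<bar>)"
      unfolding D_def
    proof (intro sum_mono)
      fix j k assume "j \<in> I" "k \<in> I"
      then have "\<bar>B (s + t) j k\<bar> \<le> \<bar>\<Sum>l\<in>I. B t j l * B s l k\<bar> + \<bar>B t j k\<bar> + \<bar>B s j k\<bar>"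
        unfolding dec[OF \<open>j \<in> I\<close> \<open>k \<in> I\<close>] by linarith
      moreover have "\<bar>\<Sum>l\<in>I. B t j l * B s l k\<bar> \<le> (\<Sum>l\<in>I. \<bar>B t j l\<bar> * \<bar>B s l k\<bar>)"
        unfolding abs_mult[symmetric] by (rule sum_abs)
      ultimately show "\<bar>B (s + t) j k\<bar> \<le> (\<Sum>l\<in>I. \<bar>B t j l\<bar> * \<bar>B s l k\<bar>) + \<bar>B t j k\<bar> + \<bar>B s j k\<bar>"
        by linarith
    qed
    also have "\<dots> = (\<Sum>j\<in>I. \<Sum>k\<in>I. \<Sum>l\<in>I. \<bar>B t j l\<bar> * \<bar>B s l k\<bar>) + D t + D s"
      unfolding D_def by (simp add: sum.distrib)
    also have "(\<Sum>j\<in>I. \<Sum>k\<in>I. \<Sum>l\<in>I. \<bar>B t j l\<bar> * \<bar>B s l k\<bar>) = (\<Sum>j\<in>I. \<Sum>l\<in>I. \<bar>B t j l\<bar> * (\<Sum>k\<in>I. \<bar>B s l k\<bar>))"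
      unfolding sum_distrib_left by (intro sum.cong refl sum.swap)
    also have "\<dots> \<le> (\<Sum>j\<in>I. \<Sum>l\<in>I. \<bar>B t j l\<bar> * D s)"
      unfolding D_def using fin
      by (intro sum_mono mult_left_mono member_le_sum[of _ I "\<lambda>l. \<Sum>k\<in>I. \<bar>B s l k\<bar>"]) (auto intro!: sum_nonneg)
    also have "\<dots> = D t * D s" unfolding D_def by (simp add: sum_distrib_right)
    finally show ?thesis by (simp add: algebra_simps)
  qed
  have pow: "1 + D (real (Suc n) * h) \<le> (1 + D h) ^ Suc n" if h: "h > 0" for h n
  proof (induction n)
    case (Suc n)
    have "1 + D (real (Suc (Suc n)) * h) = 1 + D (h + real (Suc n) * h)" by (simp add: algebra_simps)
    also have "\<dots> \<le> (1 + D h) * (1 + D (real (Suc n) * h))" using h by (intro sub) auto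
    also have "\<dots> \<le> (1 + D h) * (1 + D h) ^ Suc n" using Suc D0[of h] by (intro mult_left_mono) auto
    finally show ?case by simp
  qed simp
  have bound: "1 + D t \<le> exp (t * (D (t / real (Suc n)) / (t / real (Suc n))))" for n
  proof -
    let ?h = "t / real (Suc n)"
    have "1 + D t \<le> (1 + D ?h) ^ Suc n" using pow[of ?h n] t by simp
    also have "\<dots> \<le> exp (D ?h) ^ Suc n" using D0[of ?h] by (intro power_mono) auto
    also have "\<dots> = exp (real (Suc n) * D ?h)" by (rule exp_of_nat_mult[symmetric])
    finally show ?thesis using t by (simp add: mult.commute)
  qed
  have "((\<lambda>h. D h / h) \<longlongrightarrow> 0) (at_right 0)"
  proof -
    have "((\<lambda>h. \<Sum>j\<in>I. \<Sum>k\<in>I. \<bar>B h j k / h\<bar>) \<longlongrightarrow> (\<Sum>j\<in>I. \<Sum>k\<in>I. \<bar>0\<bar>)) (at_right 0)"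
      unfolding B_def by (intro tendsto_sum tendsto_rabs small)
    moreover have "\<forall>\<^sub>F h in at_right 0. (\<Sum>j\<in>I. \<Sum>k\<in>I. \<bar>B h j k / h\<bar>) = D h / h"
      using eventually_at_right_less[of "0::real"]
      by eventually_elim (simp add: D_def sum_divide_distrib)
    ultimately show ?thesis by (simp add: tendsto_cong)
  qed
  moreover have "filterlim (\<lambda>n. t / real (Suc n)) (at_right 0) sequentially"
    using t by real_asymp
  ultimately have "(\<lambda>n. D (t / real (Suc n)) / (t / real (Suc n))) \<longlonglongrightarrow> 0"
    by (rule filterlim_compose)
  then have "(\<lambda>n. exp (t * (D (t / real (Suc n)) / (t / real (Suc n))))) \<longlonglongrightarrow> exp (t * 0)"
    by (intro tendsto_intros)
  then have "1 + D t \<le> 1" using bound by (intro LIMSEQ_le_const[of _ 1]) auto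
  then have "D t = 0" using D0[of t] by simp
  then have "B t j k = 0"
    using jk fin unfolding D_def by (auto simp: sum_nonneg_eq_0_iff sum_nonneg)
  then show ?thesis by (simp add: B_def)
qed

section \<open>The heat semigroup and its expansion in eigenfunctions\<close>

locale sierpinski_heat = sierpinski_eigen +
  fixes q :: "real \<Rightarrow> real^2 \<Rightarrow> real^2 \<Rightarrow> real"
  assumes heat_kernel: "is_heat_kernel p K \<mu> q"
begin

abbreviation T :: "real \<Rightarrow> (real^2 \<Rightarrow> real) \<Rightarrow> real^2 \<Rightarrow> real" where
  "T t \<equiv> kernel_operator \<mu> (q t)"

lemma T_inner: "T t f x = L2_inner \<mu> (q t x) f"
  by (simp add: kernel_operator_def L2_inner_def)

lemma q_continuous: "t > 0 \<Longrightarrow> continuous_on (K \<times> K) (\<lambda>(x, y). q t x y)"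
  using heat_kernel by (simp add: is_heat_kernel_def)

lemma q_row_continuous:
  assumes "t > 0" "x \<in> K" shows "continuous_on K (q t x)"
proof -
  have "continuous_on K (\<lambda>y. (\<lambda>(x, y). q t x y) (x, y))"
    using assms by (intro continuous_on_compose2[OF q_continuous] continuous_intros) auto
  then show ?thesis by simp
qed

lemma q_L2: "t > 0 \<Longrightarrow> x \<in> K \<Longrightarrow> q t x \<in> L2 \<mu>"
  by (intro L2_continuous q_row_continuous)

lemma q_bounded:
  assumes "t > 0" obtains M where "M \<ge> 0" "\<And>x y. x \<in> K \<Longrightarrow> y \<in> K \<Longrightarrow> \<bar>q t x y\<bar> \<le> M"
proof -
  have "bounded ((\<lambda>(x, y). q t x y) ` (K \<times> K))"
    using q_continuous[OF assms] compact_Times[OF compact_K compact_K]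
    by (intro compact_imp_bounded compact_continuous_image)
  then obtain B where B: "\<And>z. z \<in> K \<times> K \<Longrightarrow> \<bar>case z of (x, y) \<Rightarrow> q t x y\<bar> \<le> B"
    unfolding bounded_iff by auto
  show ?thesis
  proof (rule that[of "max 0 B"])
    fix x y assume "x \<in> K" "y \<in> K"
    then show "\<bar>q t x y\<bar> \<le> max 0 B" using B[of "(x, y)"] by simp
  qed simp
qed

lemma T_continuous:
  assumes "t > 0" "f \<in> L2 \<mu>" shows "continuous_on K (T t f)"
  unfolding continuous_on_iff
proof (intro ballI allI impI)
  fix x e :: real and x0 assume "0 < e" and x0: "x0 \<in> K"
  \<comment> \<open>The summand 1 covers a vanishing norm, and the factor 2 makes the final estimate
    strict.\<close>
  define e' where "e' = e / (2 * (L2_norm \<mu> f + 1))"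
  have nf: "L2_norm \<mu> f + 1 > 0" using L2_norm_nonneg[of \<mu> f] by linarith
  then have e': "e' > 0" using \<open>0 < e\<close> by (simp add: e'_def)
  have "uniformly_continuous_on (K \<times> K) (\<lambda>(x, y). q t x y)"
    using q_continuous[OF assms(1)] compact_Times[OF compact_K compact_K] by (rule compact_uniformly_continuous)
  then obtain d where d: "d > 0" "\<And>z z'. z \<in> K \<times> K \<Longrightarrow> z' \<in> K \<times> K \<Longrightarrow> dist z' z < d \<Longrightarrow>
      dist ((\<lambda>(x, y). q t x y) z') ((\<lambda>(x, y). q t x y) z) < e'"
    unfolding uniformly_continuous_on_def using e' by blast
  show "\<exists>d>0. \<forall>x'\<in>K. dist x' x0 < d \<longrightarrow> dist (T t f x') (T t f x0) < e"
  proof (intro exI[of _ d] conjI ballI impI d(1))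
    fix x' assume x': "x' \<in> K" "dist x' x0 < d"
    have L: "(\<lambda>y. q t x' y - q t x0 y) \<in> L2 \<mu>" by (intro L2_diff q_L2 assms x' x0)
    have "L2_norm \<mu> (\<lambda>y. q t x' y - q t x0 y) \<le> e'"
    proof (rule L2_norm_bounded[OF L2_measurable[OF L]])
      fix y assume "y \<in> K"
      then show "\<bar>q t x' y - q t x0 y\<bar> \<le> e'"
        using d(2)[of "(x0, y)" "(x', y)"] x' x0 by (simp add: dist_Pair_Pair dist_real_def)
    qed (use e' in simp)
    then have "\<bar>L2_inner \<mu> (\<lambda>y. q t x' y - q t x0 y) f\<bar> \<le> e' * L2_norm \<mu> f"
      using L2_Cauchy_Schwarz[OF L assms(2)] mult_right_mono[OF _ L2_norm_nonneg] order_trans by blast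
    also have "\<dots> \<le> e / 2"
      unfolding e'_def using nf \<open>0 < e\<close> by (simp add: field_simps)
    also have "\<dots> < e" using \<open>0 < e\<close> by simp
    finally show "dist (T t f x') (T t f x0) < e"
      unfolding T_inner dist_real_def using x' x0 by (simp add: L2_inner_diff q_L2 assms)
  qed
qed

lemma T_L2: "t > 0 \<Longrightarrow> f \<in> L2 \<mu> \<Longrightarrow> T t f \<in> L2 \<mu>"
  by (rule L2_continuous[OF T_continuous])

lemma T_bounded:
  assumes "t > 0" obtains M where "M \<ge> 0" "\<And>f. f \<in> L2 \<mu> \<Longrightarrow> L2_norm \<mu> (T t f) \<le> M * L2_norm \<mu> f"
proof -
  obtain M where M: "M \<ge> 0" "\<And>x y. x \<in> K \<Longrightarrow> y \<in> K \<Longrightarrow> \<bar>q t x y\<bar> \<le> M"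
    using q_bounded[OF assms] by blast
  show ?thesis
  proof (rule that[OF M(1)])
    fix f assume f: "f \<in> L2 \<mu>"
    show "L2_norm \<mu> (T t f) \<le> M * L2_norm \<mu> f"
    proof (rule L2_norm_bounded[OF L2_measurable[OF T_L2[OF assms f]]])
      fix x assume x: "x \<in> K"
      have "\<bar>T t f x\<bar> \<le> L2_norm \<mu> (q t x) * L2_norm \<mu> f"
        unfolding T_inner by (intro L2_Cauchy_Schwarz q_L2 assms x f)
      also have "\<dots> \<le> M * L2_norm \<mu> f"
        using M x by (intro mult_right_mono L2_norm_bounded L2_measurable q_L2 assms) auto
      finally show "\<bar>T t f x\<bar> \<le> M * L2_norm \<mu> f" .
    qed (use M in simp)
  qed
qed

lemma T_linear:
  assumes "t > 0" "f \<in> L2 \<mu>" "g \<in> L2 \<mu>" "x \<in> K"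
  shows "T t (\<lambda>y. a * f y + b * g y) x = a * T t f x + b * T t g x"
  using assms unfolding T_inner L2_inner_commute[of \<mu> "q t x"] by (simp add: L2_inner_linear q_L2)

lemma T_scale: "T t (\<lambda>y. a * f y) x = a * T t f x"
  unfolding T_inner L2_inner_commute[of \<mu> "q t x"] by (rule L2_inner_scale)

lemma T_sum:
  assumes "t > 0" "\<And>k. k \<in> A \<Longrightarrow> f k \<in> L2 \<mu>" "x \<in> K"
  shows "T t (\<lambda>y. \<Sum>k\<in>A. c k * f k y) x = (\<Sum>k\<in>A. c k * T t (f k) x)"
  using assms unfolding T_inner L2_inner_commute[of \<mu> "q t x"] by (simp add: L2_inner_sum q_L2)

lemma T_cong: "(\<And>y. y \<in> K \<Longrightarrow> f y = g y) \<Longrightarrow> T t f x = T t g x"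
  unfolding kernel_operator_def by (intro Bochner_Integration.integral_cong) auto

lemma T_semigroup:
  assumes "s > 0" "t > 0" "f \<in> L2 \<mu>" "x \<in> K"
  shows "T (s + t) f x = T s (T t f) x"
proof -
  have "AE x in \<mu>. T (s + t) f x = T s (T t f) x"
    using heat_kernel assms unfolding is_heat_kernel_def by blast
  then show ?thesis
    using assms by (intro AE_eq_imp_eq[of "T (s + t) f" "T s (T t f)"] T_continuous T_L2) auto
qed

lemma laplacian_iff:
  assumes "u \<in> L2 \<mu>" "f \<in> L2 \<mu>"
  shows "sg_laplacian p K \<mu> u f \<longleftrightarrow>
    ((\<lambda>t. L2_norm \<mu> (\<lambda>x. (T t u x - u x) / t - f x)) \<longlongrightarrow> 0) (at_right 0)"
  using heat_kernel assms unfolding is_heat_kernel_def by blast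

text \<open>\<open>T t\<close> commutes with \<open>T h\<close> and is bounded on L2. Applied to the
  difference quotient of \<open>u\<close>, it gives that of \<open>T t u\<close>, with the error
  enlarged at most by the factor \<open>M\<close>.\<close>

lemma laplacian_T:
  assumes lap: "sg_laplacian p K \<mu> u f" and t: "t > 0"
  shows "sg_laplacian p K \<mu> (T t u) (T t f)"
proof -
  have L: "u \<in> L2 \<mu>" "f \<in> L2 \<mu>" using lap by (auto simp: sg_laplacian_def)
  obtain M where M: "M \<ge> 0" "\<And>f. f \<in> L2 \<mu> \<Longrightarrow> L2_norm \<mu> (T t f) \<le> M * L2_norm \<mu> f"
    using T_bounded[OF t] by blast
  let ?D = "\<lambda>h x. (T h u x - u x) / h - f x"
  have D0: "((\<lambda>h. L2_norm \<mu> (?D h)) \<longlongrightarrow> 0) (at_right 0)"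
    using lap laplacian_iff[OF L] by blast
  have ev: "\<forall>\<^sub>F h in at_right 0. norm (L2_norm \<mu> (\<lambda>x. (T h (T t u) x - T t u x) / h - T t f x)) \<le> M * L2_norm \<mu> (?D h)"
    using eventually_at_right_less[of "0::real"]
  proof eventually_elim
    case (elim h)
    then have h: "h > 0" by simp
    have D': "(\<lambda>x. 1 * ((1/h) * T h u x + (- 1/h) * u x) + (-1) * f x) \<in> L2 \<mu>"
      by (intro L2_linear T_L2 L h)
    have Deq: "?D h = (\<lambda>x. 1 * ((1/h) * T h u x + (- 1/h) * u x) + (-1) * f x)"
      by (auto simp: diff_divide_distrib)
    have "T t (?D h) x = (T h (T t u) x - T t u x) / h - T t f x" if x: "x \<in> K" for x
    proof -
      have "T t (?D h) x = (1/h) * T t (T h u) x + (- 1/h) * T t u x - T t f x"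
        unfolding Deq T_linear[OF t L2_linear[OF T_L2[OF h L(1)] L(1)] L(2) x]
          T_linear[OF t T_L2[OF h L(1)] L(1) x] by simp
      also have "T t (T h u) x = T h (T t u) x"
        using T_semigroup[OF t h L(1) x] T_semigroup[OF h t L(1) x] by (simp add: add.commute)
      finally show ?thesis by (simp add: diff_divide_distrib)
    qed
    then have "L2_norm \<mu> (\<lambda>x. (T h (T t u) x - T t u x) / h - T t f x) = L2_norm \<mu> (T t (?D h))"
      unfolding L2_norm_def L2_inner_def by (auto intro!: Bochner_Integration.integral_cong arg_cong[where f = sqrt])
    then show ?case using M(2)[OF D'] unfolding Deq by simp
  qed
  have "((\<lambda>h. M * L2_norm \<mu> (?D h)) \<longlongrightarrow> 0) (at_right 0)"
    using tendsto_mult_right_zero[OF D0] .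
  from Lim_null_comparison[OF ev this]
  show ?thesis using laplacian_iff[OF T_L2[OF t L(1)] T_L2[OF t L(2)]] by blast
qed

text \<open>The weak equation of \<open>u\<close> is tested with \<open>\<phi> k\<close>; symmetry
  of the form then allows the weak equation of \<open>\<phi> k\<close> to be tested with
  \<open>u\<close>.\<close>

lemma laplacian_coeff:
  assumes "sg_laplacian p K \<mu> u f"
  shows "L2_inner \<mu> f (\<phi> k) = - lam k * L2_inner \<mu> u (\<phi> k)"
proof -
  have L: "u \<in> L2 \<mu>" "f \<in> L2 \<mu>" using assms by (auto simp: sg_laplacian_def)
  obtain u' where u': "u' \<in> \<F>" "AE x in \<mu>. u x = u' x"
    and w: "\<And>v. v \<in> \<F> \<Longrightarrow> sg_energy p u' v = - L2_inner \<mu> f v"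
    using assms unfolding sg_laplacian_def by blast
  have "L2_inner \<mu> u (\<phi> k) = L2_inner \<mu> u' (\<phi> k)"
    by (rule L2_inner_cong_AE[OF L2_measurable[OF L(1)] measurable_mu[OF form_domainD(1)[OF u'(1)]]
      L2_measurable[OF phi_L2] u'(2)])
  moreover have "lam k * L2_inner \<mu> u' (\<phi> k) = - L2_inner \<mu> f (\<phi> k)"
    using w[OF phi_form_domain[of k]] phi_weak[OF u'(1), of k]
    by (simp add: energy_sym[of u'] L2_inner_commute[of \<mu> u'])
  ultimately show ?thesis by simp
qed

lemma phi_laplacian: "sg_laplacian p K \<mu> (\<phi> k) (\<lambda>x. - lam k * \<phi> k x)"
  using eigenbasis unfolding is_eigenbasis_def by blast

text \<open>\<open>T t (\<phi> j)\<close> is again an eigenfunction for \<open>lam j\<close>, and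
  such a function has no component along an eigenfunction for another eigenvalue.\<close>

lemma T_phi_coeff:
  assumes "t > 0" "lam j \<noteq> lam k"
  shows "L2_inner \<mu> (T t (\<phi> j)) (\<phi> k) = 0"
proof -
  have "L2_inner \<mu> (T t (\<lambda>x. - lam j * \<phi> j x)) (\<phi> k) = - lam k * L2_inner \<mu> (T t (\<phi> j)) (\<phi> k)"
    by (rule laplacian_coeff[OF laplacian_T[OF phi_laplacian assms(1)]])
  moreover have "T t (\<lambda>x. - lam j * \<phi> j x) = (\<lambda>x. - lam j * T t (\<phi> j) x)"
    by (rule ext) (rule T_scale)
  ultimately show ?thesis using assms(2) by (simp only: L2_inner_scale) simp
qed

lemma L2_eq_block:
  assumes f: "f \<in> L2 \<mu>" and zero: "\<And>k. lam k \<noteq> l \<Longrightarrow> L2_inner \<mu> f (\<phi> k) = 0"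
  shows "AE x in \<mu>. f x = (\<Sum>k | lam k = l. L2_inner \<mu> f (\<phi> k) * \<phi> k x)"
proof (rule L2_eq_if_coeffs_eq[OF f])
  show "(\<lambda>x. \<Sum>k | lam k = l. L2_inner \<mu> f (\<phi> k) * \<phi> k x) \<in> L2 \<mu>" by (intro L2_sum phi_L2)
  fix j
  have "L2_inner \<mu> (\<lambda>x. \<Sum>k | lam k = l. L2_inner \<mu> f (\<phi> k) * \<phi> k x) (\<phi> j)
    = (\<Sum>k | lam k = l. L2_inner \<mu> f (\<phi> k) * (if k = j then 1 else 0))"
    by (simp add: L2_inner_sum phi_L2 phi_orthonormal)
  also have "\<dots> = (\<Sum>k | lam k = l. if k = j then L2_inner \<mu> f (\<phi> k) else 0)"
    by (intro sum.cong) auto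
  also have "\<dots> = L2_inner \<mu> f (\<phi> j)" using zero[of j] finite_multiplicity[of l] by (cases "lam j = l") simp_all
  finally show "L2_inner \<mu> f (\<phi> j) = L2_inner \<mu> (\<lambda>x. \<Sum>k | lam k = l. L2_inner \<mu> f (\<phi> k) * \<phi> k x) (\<phi> j)" ..
qed

text \<open>The heat semigroup commutes with its generator, hence preserves the finite-dimensional
  eigenspaces; there it is a matrix semigroup with generator \<open>- lam k\<close> times the identity.\<close>
lemma T_phi:
  assumes t: "t > 0" and x: "x \<in> K"
  shows "T t (\<phi> k) x = exp (- lam k * t) * \<phi> k x"
proof -
  define l where "l = lam k"
  define I where "I = {j. lam j = l}"
  define a where "a t i j = L2_inner \<mu> (T t (\<phi> i)) (\<phi> j)" for t i j
  \<comment> \<open>The factor cancels the generator -l, so that \<open>b\<close> has derivative 0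
    at time 0, as \<open>matrix_semigroup_trivial\<close> demands.\<close>
  define b where "b t i j = exp (l * t) * a t i j" for t i j
  have block: "T t (\<phi> i) y = (\<Sum>j\<in>I. a t i j * \<phi> j y)" if "t > 0" "i \<in> I" "y \<in> K" for t i y
  proof (rule AE_eq_imp_eq[OF _ _ _ that(3)])
    show "continuous_on K (T t (\<phi> i))" using that by (intro T_continuous phi_L2)
    show "continuous_on K (\<lambda>y. \<Sum>j\<in>I. a t i j * \<phi> j y)" by (intro continuous_intros phi_continuous)
    show "AE y in \<mu>. T t (\<phi> i) y = (\<Sum>j\<in>I. a t i j * \<phi> j y)"
      unfolding I_def a_def using that T_phi_coeff[OF that(1)]
      by (intro L2_eq_block T_L2 phi_L2) (auto simp: I_def)
  qed
  have b1: "b t i j = (if i = j then 1 else 0)" if "i \<in> I" "j \<in> I" for i j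
  proof (rule matrix_semigroup_trivial[of I b])
    show "finite I" unfolding I_def by (rule finite_multiplicity)
    fix s t :: real and i j assume st: "s > 0" "t > 0" "i \<in> I" "j \<in> I"
    have "T (s + t) (\<phi> i) y = (\<Sum>m\<in>I. a t i m * T s (\<phi> m) y)" if "y \<in> K" for y
    proof -
      have "T (s + t) (\<phi> i) y = T s (T t (\<phi> i)) y" using st that by (intro T_semigroup phi_L2)
      also have "\<dots> = T s (\<lambda>z. \<Sum>m\<in>I. a t i m * \<phi> m z) y" using st by (intro T_cong block)
      also have "\<dots> = (\<Sum>m\<in>I. a t i m * T s (\<phi> m) y)" using st that by (intro T_sum phi_L2)
      finally show ?thesis .
    qed
    then have "a (s + t) i j = L2_inner \<mu> (\<lambda>y. \<Sum>m\<in>I. a t i m * T s (\<phi> m) y) (\<phi> j)"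
      unfolding a_def[of "s + t"] L2_inner_def by (intro Bochner_Integration.integral_cong) auto
    also have "\<dots> = (\<Sum>m\<in>I. a t i m * a s m j)"
      unfolding a_def[of s] using st by (intro L2_inner_sum T_L2 phi_L2)
    finally show "b (s + t) i j = (\<Sum>m\<in>I. b t i m * b s m j)"
      by (simp add: b_def sum_distrib_left distrib_left exp_add mult_ac)
  next
    fix i j assume ij: "i \<in> I" "j \<in> I"
    let ?d = "if i = j then 1 else 0 :: real"
    have li: "lam i = l" using ij by (simp add: I_def)
    have D0: "((\<lambda>h. L2_norm \<mu> (\<lambda>x. (T h (\<phi> i) x - \<phi> i x) / h - (- l * \<phi> i x))) \<longlongrightarrow> 0) (at_right 0)"
      using phi_laplacian[of i] unfolding li by (subst (asm) laplacian_iff) (auto intro!: L2_scale[of _ _ "- l", simplified] phi_L2)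
    have "((\<lambda>h. (a h i j - ?d) / h + l * ?d) \<longlongrightarrow> 0) (at_right 0)"
    proof (rule Lim_null_comparison[OF _ D0])
      show "\<forall>\<^sub>F h in at_right 0. norm ((a h i j - ?d) / h + l * ?d) \<le> L2_norm \<mu> (\<lambda>x. (T h (\<phi> i) x - \<phi> i x) / h - (- l * \<phi> i x))"
        using eventually_at_right_less[of "0::real"]
      proof eventually_elim
        case (elim h)
        then have h: "h > 0" by simp
        let ?g = "\<lambda>x. (1/h) * T h (\<phi> i) x + (l - 1/h) * \<phi> i x"
        have g: "?g \<in> L2 \<mu>" by (intro L2_linear T_L2 phi_L2 h)
        have eq: "(\<lambda>x. (T h (\<phi> i) x - \<phi> i x) / h - (- l * \<phi> i x)) = ?g"
          by (auto simp: diff_divide_distrib algebra_simps)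
        have "L2_inner \<mu> ?g (\<phi> j) = (a h i j - ?d) / h + l * ?d"
          unfolding L2_inner_linear[OF T_L2[OF h phi_L2] phi_L2 phi_L2] a_def phi_orthonormal
          by (simp add: diff_divide_distrib)
        moreover have "L2_norm \<mu> (\<phi> j) = 1" by (simp add: L2_norm_def phi_orthonormal)
        ultimately show ?case using L2_Cauchy_Schwarz[OF g phi_L2[of j]] unfolding eq by simp
      qed
    qed
    moreover have e1: "((\<lambda>h::real. exp (l * h)) \<longlongrightarrow> 1) (at_right 0)"
      by (rule tendsto_eq_intros refl | simp)+
    moreover have e2: "((\<lambda>h::real. (exp (l * h) - 1) / h - l * exp (l * h)) \<longlongrightarrow> 0) (at_right 0)"
      by real_asymp
    ultimately have "((\<lambda>h. exp (l * h) * ((a h i j - ?d) / h + l * ?d) + ((exp (l * h) - 1) / h - l * exp (l * h)) * ?d) \<longlongrightarrow> 1 * 0 + 0 * ?d) (at_right 0)"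
      by (intro tendsto_intros)
    \<comment> \<open>A product rule for quotients: the quotient of \<open>a\<close>, corrected by
      its limit, is multiplied by a factor tending to 1, and the remainder involves only the
      exponential.\<close>
    moreover have "(b h i j - ?d) / h = exp (l * h) * ((a h i j - ?d) / h + l * ?d) + ((exp (l * h) - 1) / h - l * exp (l * h)) * ?d" for h
      by (simp add: b_def diff_divide_distrib algebra_simps)
    ultimately show "((\<lambda>h. (b h i j - ?d) / h) \<longlongrightarrow> 0) (at_right 0)" by simp
  qed (use that t in auto)
  have kI: "k \<in> I" by (simp add: I_def l_def)
  have a: "a t k j = (if k = j then exp (- l * t) else 0)" if "j \<in> I" for j
  proof -
    have "a t k j = exp (- l * t) * b t k j"
      unfolding b_def mult.assoc[symmetric] exp_add[symmetric] by simp
    then show ?thesis unfolding b1[OF kI that] by simp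
  qed
  have "T t (\<phi> k) x = (\<Sum>j\<in>I. a t k j * \<phi> j x)" using t kI x by (rule block)
  also have "\<dots> = (\<Sum>j\<in>I. if j = k then exp (- l * t) * \<phi> j x else 0)"
    by (intro sum.cong refl) (auto simp: a)
  also have "\<dots> = exp (- l * t) * \<phi> k x"
    using kI finite_multiplicity[of l] by (simp add: I_def)
  finally show ?thesis by (simp add: l_def)
qed

lemma q_coeff:
  assumes "t > 0" "x \<in> K" shows "L2_inner \<mu> (q t x) (\<phi> k) = exp (- lam k * t) * \<phi> k x"
  using T_phi[OF assms] by (simp add: T_inner)

lemma T_coeff:
  assumes t: "t > 0" and f: "f \<in> L2 \<mu>"
  shows "L2_inner \<mu> (T t f) (\<phi> k) = exp (- lam k * t) * L2_inner \<mu> f (\<phi> k)"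
proof -
  let ?S = "\<lambda>n x. \<Sum>j<n. L2_inner \<mu> f (\<phi> j) * \<phi> j x"
  have S: "?S n \<in> L2 \<mu>" for n by (intro L2_sum phi_L2)
  obtain M where M: "M \<ge> 0" "\<And>f. f \<in> L2 \<mu> \<Longrightarrow> L2_norm \<mu> (T t f) \<le> M * L2_norm \<mu> f"
    using T_bounded[OF t] by blast
  let ?D = "\<lambda>n. T t (\<lambda>x. f x - ?S n x)"
  have "(\<lambda>n. L2_norm \<mu> (?D n)) \<longlonglongrightarrow> 0"
  proof (rule Lim_null_comparison)
    show "\<forall>\<^sub>F n in sequentially. norm (L2_norm \<mu> (?D n)) \<le> M * L2_norm \<mu> (\<lambda>x. f x - ?S n x)"
      using M(2)[OF L2_diff[OF f S]] by simp
    show "(\<lambda>n. M * L2_norm \<mu> (\<lambda>x. f x - ?S n x)) \<longlonglongrightarrow> 0"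
      using tendsto_mult_right_zero[OF expansion_tendsto[OF f]] .
  qed
  then have "(\<lambda>n. L2_inner \<mu> (?D n) (\<phi> k)) \<longlonglongrightarrow> 0"
    by (intro inner_bounded_tendsto T_L2 t L2_diff f S phi_L2)
  moreover have "\<forall>\<^sub>F n in sequentially. L2_inner \<mu> (?D n) (\<phi> k) = L2_inner \<mu> (T t f) (\<phi> k) - exp (- lam k * t) * L2_inner \<mu> f (\<phi> k)"
    using eventually_gt_at_top[of k]
  proof eventually_elim
    case (elim n)
    have "?D n x = T t f x - (\<Sum>j<n. L2_inner \<mu> f (\<phi> j) * exp (- lam j * t) * \<phi> j x)" if "x \<in> K" for x
      using T_linear[OF t f S[of n] that, where a = 1 and b = "-1"]
        T_sum[OF t phi_L2 that, where A = "{..<n}" and c = "\<lambda>j. L2_inner \<mu> f (\<phi> j)"] that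
      by (simp add: T_phi[OF t] mult_ac)
    then have "L2_inner \<mu> (?D n) (\<phi> k) = L2_inner \<mu> (\<lambda>x. T t f x - (\<Sum>j<n. L2_inner \<mu> f (\<phi> j) * exp (- lam j * t) * \<phi> j x)) (\<phi> k)"
      unfolding L2_inner_def by (intro Bochner_Integration.integral_cong) auto
    also have "\<dots> = L2_inner \<mu> (T t f) (\<phi> k) - L2_inner \<mu> (\<lambda>x. \<Sum>j<n. L2_inner \<mu> f (\<phi> j) * exp (- lam j * t) * \<phi> j x) (\<phi> k)"
      by (intro L2_inner_diff T_L2 L2_sum phi_L2 t f)
    also have "L2_inner \<mu> (\<lambda>x. \<Sum>j<n. L2_inner \<mu> f (\<phi> j) * exp (- lam j * t) * \<phi> j x) (\<phi> k)
       = (\<Sum>j<n. if j = k then L2_inner \<mu> f (\<phi> j) * exp (- lam j * t) else 0)"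
      by (subst L2_inner_sum[OF phi_L2 phi_L2], intro sum.cong refl) (simp add: phi_orthonormal)
    also have "\<dots> = exp (- lam k * t) * L2_inner \<mu> f (\<phi> k)"
      using elim by (subst sum.delta) auto
    finally show ?case .
  qed
  ultimately have "(\<lambda>n. L2_inner \<mu> (T t f) (\<phi> k) - exp (- lam k * t) * L2_inner \<mu> f (\<phi> k)) \<longlonglongrightarrow> 0"
    by (simp add: tendsto_cong)
  then show ?thesis by (simp add: LIMSEQ_const_iff)
qed

text \<open>Equality of coefficients alone would give convergence only in L2. Splitting the time
  into halves expresses \<open>q t x y\<close> as the inner product of the rows of
  \<open>q (t/2)\<close> at \<open>x\<close> and \<open>y\<close>, and Parseval then gives
  convergence at each pair of points.\<close>

lemma q_expansion:
  assumes t: "t > 0" and x: "x \<in> K" and y: "y \<in> K"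
  shows "(\<lambda>k. exp (- lam k * t) * \<phi> k x * \<phi> k y) sums q t x y"
proof -
  have t2: "t / 2 > 0" using t by simp
  let ?g = "T (t/2) (q (t/2) x)"
  have ee: "exp (- lam k * (t/2)) * (exp (- lam k * (t/2)) * c) = exp (- lam k * t) * c" for k c
    by (simp flip: exp_add mult.assoc)
  have "AE z in \<mu>. ?g z = q t x z"
    by (intro L2_eq_if_coeffs_eq T_L2 q_L2 t t2 x) (simp only: T_coeff[OF t2 q_L2[OF t2 x]] q_coeff[OF t2 x] q_coeff[OF t x] ee)
  then have "?g y = q t x y"
    by (intro AE_eq_imp_eq[OF _ _ _ y] T_continuous q_L2 q_row_continuous t t2 x)
  moreover have "(\<lambda>k. L2_inner \<mu> (q (t/2) y) (\<phi> k) * L2_inner \<mu> (q (t/2) x) (\<phi> k)) sums ?g y"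
    unfolding T_inner by (intro Parseval q_L2 t2 x y)
  moreover have "L2_inner \<mu> (q (t/2) y) (\<phi> k) * L2_inner \<mu> (q (t/2) x) (\<phi> k) = exp (- lam k * t) * \<phi> k x * \<phi> k y" for k
    using ee[of k "\<phi> k x * \<phi> k y"] unfolding q_coeff[OF t2 x] q_coeff[OF t2 y] by (simp add: mult_ac)
  ultimately show ?thesis by simp
qed

lemma q_norm_expansion:
  assumes "t > 0" "x \<in> K"
  shows "(\<lambda>k. exp (- 2 * lam k * t) * (\<phi> k x)\<^sup>2) sums L2_inner \<mu> (q t x) (q t x)"
proof -
  have "L2_inner \<mu> (q t x) (\<phi> k) * L2_inner \<mu> (q t x) (\<phi> k) = exp (- 2 * lam k * t) * (\<phi> k x)\<^sup>2" for k
  proof -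
    have "exp (- 2 * lam k * t) = (exp (- lam k * t))\<^sup>2"
      using exp_double[of "- lam k * t"] by (simp only: mult_minus_left mult_minus_right mult.assoc)
    then show ?thesis unfolding q_coeff[OF assms] by (simp only: power2_eq_square mult_ac)
  qed
  then show ?thesis using Parseval[OF q_L2[OF assms] q_L2[OF assms]] by simp
qed

text \<open>The hypothesis on \<open>q\<close> does not mention a basis, so
  \<open>q_expansion\<close> also holds with the reflected one. There the series at
  \<open>(x, y)\<close> is the original series at the reflected points.\<close>

lemma q_reflection:
  assumes "t > 0" "x \<in> K" "y \<in> K"
  shows "q t (sg_reflection p i x) (sg_reflection p i y) = q t x y"
proof -
  interpret R: sierpinski_heat p K \<mu> lam "\<lambda>k x. \<phi> k (sg_reflection p i x)" q
    by (intro sierpinski_heat.intro sierpinski_eigen.intro sierpinski_eigen_axioms.intro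
      sierpinski_axioms sierpinski_heat_axioms.intro reflected_eigenbasis heat_kernel)
  show ?thesis
    using R.q_expansion[OF assms] q_expansion[OF assms(1) reflection_K[OF assms(2)] reflection_K[OF assms(3)]]
      sums_unique2 by blast
qed

end

section \<open>The Riesz kernel\<close>

lemma powr_exp_integrable:
  fixes z a :: real
  assumes "z > 0" "a > 0"
  shows "integrable lborel (\<lambda>t. indicator {0<..} t * (t powr (z - 1) * exp (- a * t)))"
proof -
  let ?f = "\<lambda>t. complex_of_real t powr (complex_of_real z - 1) / of_real (exp (a * t))"
  have "set_integrable lebesgue {0<..} ?f"
    using absolutely_integrable_Gamma_integral[of "complex_of_real z" a] assms by simp
  then have "set_integrable lebesgue {0<..} (\<lambda>t. norm (?f t))" by (rule set_integrable_norm)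
  then have "integrable lebesgue (\<lambda>t. indicator {0<..} t *\<^sub>R norm (?f t))"
    by (simp add: set_integrable_def)
  moreover have eq: "indicator {0<..} t *\<^sub>R norm (?f t) = indicator {0<..} t * (t powr (z - 1) * exp (- a * t))" for t
  proof (cases "t > 0")
    case True
    then have "norm (?f t) = t powr (z - 1) / exp (a * t)"
      by (simp add: norm_divide norm_powr_real_powr)
    then show ?thesis by (simp add: exp_minus field_simps)
  qed simp
  ultimately have "integrable lebesgue (\<lambda>t. indicator {0<..} t * (t powr (z - 1) * exp (- a * t)))"
    by (simp only: eq)
  then show ?thesis by (subst (asm) integrable_completion) auto
qed

text \<open>This is 9 > 5. Strictness makes t^((d_S - 1)/2 - 1) integrable at 0, the decisive point
  in \<open>k_L2\<close>.\<close>

lemma d_S_gt_1: "1 < d_S"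
proof -
  have "ln 5 < ln (3 * 3 :: real)" by (subst ln_less_cancel_iff) auto
  then have "ln 5 < 2 * ln (3::real)" by (subst (asm) ln_mult) auto
  moreover have "(0::real) < ln 5" by simp
  ultimately have "1 < 2 * ln 3 / ln (5::real)" by (simp only: less_divide_eq mult_1 if_True)
  then show ?thesis by (simp add: d_S_def d_H_def d_W_def)
qed

section \<open>Square integrability and symmetry of the Riesz kernel\<close>

context sierpinski_heat
begin

abbreviation k :: "real^2 \<Rightarrow> real^2 \<Rightarrow> real" where
  "k \<equiv> riesz_kernel q d_S"

lemma phi_measurable [measurable]: "\<phi> j \<in> borel_measurable \<mu>"
  by (rule L2_measurable[OF phi_L2])

lemma lborel_mu_sigma_finite: "pair_sigma_finite lborel \<mu>"
  by (intro pair_sigma_finite.intro sigma_finite_lborel sigma_finite_measure_axioms)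

text \<open>Continuity is assumed only for fixed time. Measurability in time as well comes from the
  partial sums of the eigenfunction expansion, which converge pointwise.\<close>

lemma q_joint_measurable:
  "(\<lambda>(x, t, y). indicator {0<..} t * q t x y) \<in> borel_measurable (\<mu> \<Otimes>\<^sub>M (lborel \<Otimes>\<^sub>M \<mu>))"
proof (rule borel_measurable_LIMSEQ_real)
  let ?G = "\<lambda>N (x, t, y). indicator {0<..} t * (\<Sum>k<N. exp (- lam k * t) * \<phi> k x * \<phi> k y) :: real"
  show "?G N \<in> borel_measurable (\<mu> \<Otimes>\<^sub>M (lborel \<Otimes>\<^sub>M \<mu>))" for N by measurable
  fix z :: "(real^2) \<times> real \<times> (real^2)" assume "z \<in> space (\<mu> \<Otimes>\<^sub>M (lborel \<Otimes>\<^sub>M \<mu>))"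
  then obtain x t y where z: "z = (x, t, y)" "x \<in> K" "y \<in> K" by (auto simp: space_pair_measure)
  show "(\<lambda>N. ?G N z) \<longlonglongrightarrow> (\<lambda>(x, t, y). indicator {0<..} t * q t x y) z"
    using q_expansion[of t x y] z unfolding sums_def by (cases "t > 0") auto
qed

lemma k_integral: "k x y = 1 / Gamma (d_S / 2) * (LINT t|lborel. t powr (d_S / 2 - 1) * (indicator {0<..} t * q t x y))"
  unfolding riesz_kernel_def set_lebesgue_integral_def
  by (intro arg_cong2[where f = "(*)"] refl Bochner_Integration.integral_cong) (auto simp: indicator_def)

lemma k_measurable: "(\<lambda>(x, y). k x y) \<in> borel_measurable (\<mu> \<Otimes>\<^sub>M \<mu>)"
proof -
  have "(\<lambda>z. (\<lambda>(x, t, y). indicator {0<..} t * q t x y) (fst (fst z), snd z, snd (fst z)))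
     \<in> borel_measurable ((\<mu> \<Otimes>\<^sub>M \<mu>) \<Otimes>\<^sub>M lborel)"
    by (rule measurable_compose[OF _ q_joint_measurable]) measurable
  then have "(\<lambda>((x, y), t). t powr (d_S / 2 - 1) * (indicator {0<..} t * q t x y)) \<in> borel_measurable ((\<mu> \<Otimes>\<^sub>M \<mu>) \<Otimes>\<^sub>M lborel)"
    by (simp add: case_prod_unfold)
  then have "(\<lambda>z. LINT t|lborel. (\<lambda>(x, y) t. t powr (d_S / 2 - 1) * (indicator {0<..} t * q t x y)) z t) \<in> borel_measurable (\<mu> \<Otimes>\<^sub>M \<mu>)"
    by (intro lborel.borel_measurable_lebesgue_integral) (simp add: case_prod_unfold)
  then show ?thesis unfolding k_integral by (simp add: case_prod_unfold)
qed

text \<open>Each term \<open>e\<^sup>-\<^sup>2\<^sup>\<lambda>\<^sup>t\<close> is at most \<open>e\<^sup>-\<^sup>\<lambda>\<^sup>t / (\<lambda> t)\<close>, which leaves the diagonal of the Green function.\<close>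
lemma q_norm_bound:
  "\<exists>C>0. \<forall>t>0. \<forall>x\<in>K. L2_inner \<mu> (q t x) (q t x) \<le> C * exp (- lam 0 * t) / t"
proof -
  obtain C where C: "C > 0" "\<And>n x. x \<in> K \<Longrightarrow> (\<Sum>k<n. (\<phi> k x)\<^sup>2 / lam k) \<le> C"
    using Green_diagonal_bound by blast
  have "L2_inner \<mu> (q t x) (q t x) \<le> C * exp (- lam 0 * t) / t" if t: "t > 0" and x: "x \<in> K" for t x
  proof (rule LIMSEQ_le_const2)
    show "(\<lambda>n. \<Sum>k<n. exp (- 2 * lam k * t) * (\<phi> k x)\<^sup>2) \<longlonglongrightarrow> L2_inner \<mu> (q t x) (q t x)"
      using q_norm_expansion[OF t x] by (simp add: sums_def)
    have term_le: "exp (- 2 * lam k * t) * (\<phi> k x)\<^sup>2 \<le> exp (- lam 0 * t) / t * ((\<phi> k x)\<^sup>2 / lam k)" for k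
    proof -
      have lt: "lam k * t > 0" using t by simp
      have "exp (- lam k * t) \<le> 1 / (lam k * t)"
      proof -
        have "lam k * t \<le> exp (lam k * t)" using exp_ge_add_one_self[of "lam k * t"] by linarith
        then have "1 / exp (lam k * t) \<le> 1 / (lam k * t)" using lt by (intro divide_left_mono) auto
        then show ?thesis by (simp add: exp_minus inverse_eq_divide)
      qed
      moreover have "exp (- lam k * t) \<le> exp (- lam 0 * t)" using t lam_mono[of 0 k] by simp
      ultimately have "exp (- lam k * t) * exp (- lam k * t) \<le> exp (- lam 0 * t) * (1 / (lam k * t))"
        by (intro mult_mono) auto
      moreover have "exp (- 2 * lam k * t) = exp (- lam k * t) * exp (- lam k * t)"
        unfolding exp_add[symmetric] by simp
      ultimately have "exp (- 2 * lam k * t) * (\<phi> k x)\<^sup>2 \<le> exp (- lam 0 * t) * (1 / (lam k * t)) * (\<phi> k x)\<^sup>2"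
        by (intro mult_right_mono) auto
      then show ?thesis by (simp add: mult_ac)
    qed
    have "(\<Sum>k<n. exp (- 2 * lam k * t) * (\<phi> k x)\<^sup>2) \<le> C * exp (- lam 0 * t) / t" for n
    proof -
      have "(\<Sum>k<n. exp (- 2 * lam k * t) * (\<phi> k x)\<^sup>2) \<le> exp (- lam 0 * t) / t * (\<Sum>k<n. (\<phi> k x)\<^sup>2 / lam k)"
        unfolding sum_distrib_left by (intro sum_mono term_le)
      also have "\<dots> \<le> exp (- lam 0 * t) / t * C" using C(2)[OF x] t by (intro mult_left_mono) auto
      finally show ?thesis by (simp add: mult_ac)
    qed
    then show "\<exists>N. \<forall>n\<ge>N. (\<Sum>k<n. exp (- 2 * lam k * t) * (\<phi> k x)\<^sup>2) \<le> C * exp (- lam 0 * t) / t"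
      by blast
  qed
  then show ?thesis using C(1) by blast
qed

text \<open>Cauchy--Schwarz in the time variable with the weight \<open>t\<^bsup>1/2\<^esup> exp(lam 0 * t / 2)\<close>.\<close>
lemma k_L2:
  assumes x: "x \<in> K"
  shows "k x \<in> L2 \<mu>"
proof -
  interpret P: pair_sigma_finite lborel \<mu> by (rule lborel_mu_sigma_finite)
  define a where "a = d_S / 2"
  have a: "a > 1/2" using d_S_gt_1 by (simp add: a_def)
  define \<delta> where "\<delta> = lam 0 / 2"
  have \<delta>: "\<delta> > 0" by (simp add: \<delta>_def)
  define qq where "qq t y = indicator {0<..} t * q t x y" for t y
  have qm: "(\<lambda>(t, y). qq t y) \<in> borel_measurable (lborel \<Otimes>\<^sub>M \<mu>)"
  proof -
    have "(\<lambda>z. (\<lambda>(x, t, y). indicator {0<..} t * q t x y) (x, z)) \<in> borel_measurable (lborel \<Otimes>\<^sub>M \<mu>)"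
      using x by (intro measurable_compose[OF measurable_Pair1' q_joint_measurable]) simp
    then show ?thesis by (simp add: qq_def case_prod_unfold)
  qed
  \<comment> \<open>The exponents are such that \<open>w t * v t y\<close> is the integrand of the
    Riesz kernel and, by \<open>q_norm_bound\<close>, the integral of \<open>v\<close>^2 over
    \<open>y\<close> is at most C \<open>w\<close>^2. One integrability statement thus serves both
    factors. Taking \<delta> = lam 0 / 2 spends half of the exponential decay on \<open>v\<close>
    and keeps the other half.\<close>
  define w where "w t = indicator {0<..} t * (t powr ((a - 3/2) / 2) * exp (- \<delta> * t / 2))" for t :: real
  define v where "v t y = t powr ((a - 1/2) / 2) * exp (\<delta> * t / 2) * qq t y" for t y
  have vm: "(\<lambda>(t, y). v t y) \<in> borel_measurable (lborel \<Otimes>\<^sub>M \<mu>)"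
    using qm unfolding v_def by (simp add: case_prod_unfold)
  have vm1: "(\<lambda>t. v t y) \<in> borel_measurable lborel" if "y \<in> K" for y
    using measurable_compose[OF measurable_Pair2'[of y \<mu> lborel] vm] that by simp
  have vm2: "v t \<in> borel_measurable \<mu>" for t
    using measurable_compose[OF measurable_Pair1'[of t lborel \<mu>] vm] by simp
  have sq: "(t powr (c / 2) * exp (e / 2))\<^sup>2 = t powr c * exp e" if "t > 0" for t c e :: real
  proof -
    have "(t powr (c / 2) * exp (e / 2))\<^sup>2 = (t powr (c / 2) * t powr (c / 2)) * (exp (e / 2) * exp (e / 2))"
      by (simp only: power2_eq_square mult_ac)
    then show ?thesis unfolding powr_add[symmetric] exp_add[symmetric] by simp
  qed
  have w2: "(w t)\<^sup>2 = indicator {0<..} t * (t powr ((a - 1/2) - 1) * exp (- \<delta> * t))" for t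
    using sq[of t "a - 3/2" "- \<delta> * t"] by (cases "t > 0") (simp_all add: w_def)
  have wint: "integrable lborel (\<lambda>t. (w t)\<^sup>2)"
    unfolding w2 using a \<delta> by (intro powr_exp_integrable) auto
  have "w \<in> borel_measurable lborel" unfolding w_def by measurable
  then have wL: "w \<in> L2 lborel" using wint by (simp add: L2_def)
  obtain C where C: "C > 0" "\<And>t x. t > 0 \<Longrightarrow> x \<in> K \<Longrightarrow> L2_inner \<mu> (q t x) (q t x) \<le> C * exp (- lam 0 * t) / t"
    using q_norm_bound by blast
  have v2: "(v t y)\<^sup>2 = (t powr ((a - 1/2) / 2) * exp (\<delta> * t / 2))\<^sup>2 * (qq t y)\<^sup>2" for t y
    by (simp add: v_def power_mult_distrib)
  have qq2: "integrable \<mu> (\<lambda>y. (qq t y)\<^sup>2)" for t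
    using q_L2[of t x] x unfolding qq_def by (cases "t > 0") (auto simp: L2_def)
  have v2int: "(LINT y|\<mu>. (v t y)\<^sup>2) \<le> C * (w t)\<^sup>2" for t
  proof (cases "t > 0")
    case True
    have "(LINT y|\<mu>. (v t y)\<^sup>2) = t powr (a - 1/2) * exp (\<delta> * t) * L2_inner \<mu> (q t x) (q t x)"
      unfolding v2 sq[OF True] using True by (simp add: L2_inner_def qq_def power2_eq_square)
    also have "\<dots> \<le> t powr (a - 1/2) * exp (\<delta> * t) * (C * exp (- lam 0 * t) / t)"
      using C(2)[OF True x] by (intro mult_left_mono) auto
    also have "\<dots> = C * (t powr (a - 1/2) / t powr 1) * (exp (\<delta> * t) * exp (- lam 0 * t))"
      using True by simp
    also have "\<dots> = C * (w t)\<^sup>2"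
      unfolding w2 powr_diff[symmetric] exp_add[symmetric] using True by (simp add: \<delta>_def field_simps)
    finally show ?thesis .
  qed (simp add: v_def qq_def w_def)
  have "integrable (lborel \<Otimes>\<^sub>M \<mu>) (\<lambda>(t, y). (v t y)\<^sup>2)"
  proof (rule P.Fubini_integrable)
    show m: "(\<lambda>(t, y). (v t y)\<^sup>2) \<in> borel_measurable (lborel \<Otimes>\<^sub>M \<mu>)"
      using vm by (simp add: case_prod_unfold)
    show "AE t in lborel. integrable \<mu> (\<lambda>y. (\<lambda>(t, y). (v t y)\<^sup>2) (t, y))"
      unfolding v2 prod.case using qq2 by simp
    have "integrable lborel (\<lambda>t. LINT y|\<mu>. (v t y)\<^sup>2)"
    proof (rule Bochner_Integration.integrable_bound)
      show "integrable lborel (\<lambda>t. C * (w t)\<^sup>2)" using wint by simp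
      show "(\<lambda>t. LINT y|\<mu>. (v t y)\<^sup>2) \<in> borel_measurable lborel"
        using borel_measurable_lebesgue_integral[OF m] by simp
      show "AE t in lborel. norm (LINT y|\<mu>. (v t y)\<^sup>2) \<le> norm (C * (w t)\<^sup>2)"
        using v2int C(1) by simp
    qed
    then show "integrable lborel (\<lambda>t. LINT y|\<mu>. norm ((\<lambda>(t, y). (v t y)\<^sup>2) (t, y)))" by simp
  qed
  then have int: "AE y in \<mu>. integrable lborel (\<lambda>t. (v t y)\<^sup>2)"
    and h: "integrable \<mu> (\<lambda>y. LINT t|lborel. (v t y)\<^sup>2)"
    using P.AE_integrable_snd[of "\<lambda>t y. (v t y)\<^sup>2"] P.integrable_snd[of "\<lambda>t y. (v t y)\<^sup>2"] by blast+
  have wv: "t powr (a - 1) * (indicator {0<..} t * q t x y) = w t * v t y" for t y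
  proof (cases "t > 0")
    case True
    have "w t * v t y = (t powr ((a - 3/2) / 2) * t powr ((a - 1/2) / 2)) * (exp (- \<delta> * t / 2) * exp (\<delta> * t / 2)) * q t x y"
      using True by (simp add: w_def v_def qq_def)
    also have "\<dots> = t powr (a - 1) * q t x y"
    proof -
      have e: "(a - 3/2) / 2 + (a - 1/2) / 2 = a - 1" by (simp add: add_divide_distrib[symmetric])
      show ?thesis unfolding powr_add[symmetric] exp_add[symmetric] e by simp
    qed
    finally show ?thesis using True by simp
  qed (simp add: w_def)
  have km: "k x \<in> borel_measurable \<mu>"
    using measurable_compose[OF measurable_Pair1'[of x \<mu> \<mu>] k_measurable] x by simp
  have "integrable \<mu> (\<lambda>y. (k x y)\<^sup>2)"
  proof (rule Bochner_Integration.integrable_bound)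
    show "integrable \<mu> (\<lambda>y. (1 / Gamma a)\<^sup>2 * (LINT t|lborel. (w t)\<^sup>2) * (LINT t|lborel. (v t y)\<^sup>2))"
      using h by (rule integrable_mult_right)
    show "(\<lambda>y. (k x y)\<^sup>2) \<in> borel_measurable \<mu>" using km by simp
    show "AE y in \<mu>. norm ((k x y)\<^sup>2) \<le> norm ((1 / Gamma a)\<^sup>2 * (LINT t|lborel. (w t)\<^sup>2) * (LINT t|lborel. (v t y)\<^sup>2))"
      using int AE_space
    proof eventually_elim
      case (elim y)
      then have vL: "(\<lambda>t. v t y) \<in> L2 lborel" using vm1[of y] by (simp add: L2_def)
      have "\<bar>L2_inner lborel w (\<lambda>t. v t y)\<bar>\<^sup>2 \<le> (L2_norm lborel w * L2_norm lborel (\<lambda>t. v t y))\<^sup>2"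
        by (intro power_mono L2_Cauchy_Schwarz wL vL) simp
      then have "(L2_inner lborel w (\<lambda>t. v t y))\<^sup>2 \<le> L2_inner lborel w w * L2_inner lborel (\<lambda>t. v t y) (\<lambda>t. v t y)"
        by (simp add: power_mult_distrib L2_norm_power2)
      moreover have "k x y = 1 / Gamma a * L2_inner lborel w (\<lambda>t. v t y)"
        unfolding k_integral L2_inner_def wv[symmetric] by (simp add: a_def)
      ultimately have "(k x y)\<^sup>2 \<le> (1 / Gamma a)\<^sup>2 * (L2_inner lborel w w * L2_inner lborel (\<lambda>t. v t y) (\<lambda>t. v t y))"
        by (simp only: power_mult_distrib) (intro mult_left_mono, auto)
      then show ?case by (simp add: L2_inner_def power2_eq_square mult.assoc)
    qed
  qed
  then show ?thesis using km by (simp add: L2_def)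
qed

lemma k_reflection:
  assumes "x \<in> K" "y \<in> K"
  shows "k (sg_reflection p i x) (sg_reflection p i y) = k x y"
proof -
  have eq: "indicator {0<..} t * q t (sg_reflection p i x) (sg_reflection p i y) = indicator {0<..} t * q t x y" for t :: real
    by (cases "t > 0") (simp_all add: q_reflection assms)
  show ?thesis unfolding k_integral eq ..
qed

definition \<kappa> :: "real^2 \<Rightarrow> nat \<Rightarrow> real" where
  "\<kappa> x j = L2_inner \<mu> (k x) (\<phi> j)"

lemma kappa_measurable: "(\<lambda>x. \<kappa> x j) \<in> borel_measurable \<mu>"
proof -
  note k_measurable[measurable]
  have "(\<lambda>(x, y). (\<lambda>(x, y). k x y) (x, y) * \<phi> j y) \<in> borel_measurable (\<mu> \<Otimes>\<^sub>M \<mu>)" by measurable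
  then have "(\<lambda>(x, y). k x y * \<phi> j y) \<in> borel_measurable (\<mu> \<Otimes>\<^sub>M \<mu>)" by simp
  then show ?thesis unfolding \<kappa>_def L2_inner_def by (rule borel_measurable_lebesgue_integral)
qed

section \<open>The reflection in the eigenbasis\<close>

definition refl_coeff :: "3 \<Rightarrow> nat \<Rightarrow> nat \<Rightarrow> real" where
  "refl_coeff i j m = L2_inner \<mu> (\<lambda>x. \<phi> j (sg_reflection p i x)) (\<phi> m)"

lemma refl_coeff_sym: "refl_coeff i j m = refl_coeff i m j"
  unfolding refl_coeff_def by (rule trans[OF L2_inner_reflection[OF phi_L2 phi_L2] L2_inner_commute])

text \<open>The reflection is symmetric for the form and for the inner product, so the coefficient
  multiplied by \<open>lam j\<close> equals the coefficient multiplied by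
  \<open>lam m\<close>.\<close>

lemma refl_coeff_zero:
  assumes "lam j \<noteq> lam m" shows "refl_coeff i j m = 0"
proof -
  let ?s = "sg_reflection p i"
  have "lam j * refl_coeff i j m = sg_energy p (\<phi> j) (\<lambda>x. \<phi> m (?s x))"
    unfolding refl_coeff_def L2_inner_reflection[OF phi_L2 phi_L2]
    by (intro phi_weak[symmetric] form_domain_reflection phi_form_domain)
  also have "\<dots> = sg_energy p (\<phi> m) (\<lambda>x. \<phi> j (?s x))"
    unfolding energy_reflection[symmetric] by (subst energy_sym) (simp add: energy_reflection)
  also have "\<dots> = lam m * refl_coeff i m j"
    unfolding refl_coeff_def L2_inner_reflection[OF phi_L2 phi_L2]
    by (intro phi_weak form_domain_reflection phi_form_domain)
  finally show ?thesis using assms refl_coeff_sym[of i m j] by simp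
qed

lemma inner_reflected:
  assumes "f \<in> L2 \<mu>"
  shows "L2_inner \<mu> f (\<lambda>x. \<phi> j (sg_reflection p i x)) = (\<Sum>m | lam m = lam j. refl_coeff i j m * L2_inner \<mu> f (\<phi> m))"
proof -
  have "(\<lambda>m. L2_inner \<mu> f (\<phi> m) * refl_coeff i j m) sums L2_inner \<mu> f (\<lambda>x. \<phi> j (sg_reflection p i x))"
    unfolding refl_coeff_def by (intro Parseval assms L2_reflection phi_L2)
  moreover have "(\<lambda>m. L2_inner \<mu> f (\<phi> m) * refl_coeff i j m) sums (\<Sum>m | lam m = lam j. L2_inner \<mu> f (\<phi> m) * refl_coeff i j m)"
    using refl_coeff_zero[of j _ i] by (intro sums_finite) auto
  ultimately show ?thesis using sums_unique2 by (simp add: mult.commute) blast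
qed

lemma refl_coeff_orthogonal:
  "(\<Sum>m | lam m = lam j. refl_coeff i j m * refl_coeff i l m) = (if j = l then 1 else 0)"
proof -
  have "(\<Sum>m | lam m = lam j. refl_coeff i j m * refl_coeff i l m)
     = L2_inner \<mu> (\<lambda>x. \<phi> l (sg_reflection p i x)) (\<lambda>x. \<phi> j (sg_reflection p i x))"
    unfolding inner_reflected[OF L2_reflection[OF phi_L2]] by (simp add: refl_coeff_def)
  also have "\<dots> = L2_inner \<mu> (\<phi> l) (\<phi> j)"
    unfolding L2_inner_reflection[OF phi_L2 L2_reflection[OF phi_L2]]
    by (simp add: reflection_involution[OF tri])
  finally show ?thesis by (simp add: phi_orthonormal eq_commute)
qed

text \<open>Joint invariance of the kernel moves the reflection from the first variable to the
  second, and from there to the eigenfunction, whose expansion is a finite sum.\<close>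

lemma kappa_reflection:
  assumes "x \<in> K"
  shows "\<kappa> (sg_reflection p i x) j = (\<Sum>m | lam m = lam j. refl_coeff i j m * \<kappa> x m)"
proof -
  let ?s = "sg_reflection p i"
  have "k (?s x) y = k x (?s y)" if "y \<in> K" for y
    using k_reflection[OF assms reflection_K[OF that], of i i] by (simp add: reflection_involution[OF tri])
  then have "\<kappa> (?s x) j = L2_inner \<mu> (\<lambda>y. k x (?s y)) (\<phi> j)"
    unfolding \<kappa>_def L2_inner_def by (intro Bochner_Integration.integral_cong) auto
  also have "\<dots> = L2_inner \<mu> (k x) (\<lambda>y. \<phi> j (?s y))"
    by (intro L2_inner_reflection k_L2 assms phi_L2)
  also have "\<dots> = (\<Sum>m | lam m = lam j. refl_coeff i j m * \<kappa> x m)"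
    unfolding \<kappa>_def by (intro inner_reflected k_L2 assms)
  finally show ?thesis .
qed

end

section \<open>Random vectors are determined by their characteristic functions\<close>

text \<open>Divided by their common mass \<open>m\<close>, the weights are probability densities,
  and Levy's theorem applies to the laws of \<open>X\<close> and \<open>Y\<close> under these. If
  \<open>m\<close> is 0, both weights vanish almost everywhere.\<close>

lemma (in prob_space) weighted_char_uniqueness:
  fixes X Y W V :: "'a \<Rightarrow> real"
  assumes [measurable]: "X \<in> borel_measurable M" "Y \<in> borel_measurable M"
      "W \<in> borel_measurable M" "V \<in> borel_measurable M"
    and W: "\<And>\<omega>. 0 \<le> W \<omega>" "\<And>\<omega>. W \<omega> \<le> C" and V: "\<And>\<omega>. 0 \<le> V \<omega>" "\<And>\<omega>. V \<omega> \<le> C"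
    and phase: "\<And>s b. expectation (\<lambda>\<omega>. W \<omega> * cos (s * X \<omega> + b)) = expectation (\<lambda>\<omega>. V \<omega> * cos (s * Y \<omega> + b))"
    and B: "B \<in> sets borel"
  shows "expectation (\<lambda>\<omega>. W \<omega> * indicator B (X \<omega>)) = expectation (\<lambda>\<omega>. V \<omega> * indicator B (Y \<omega>))"
proof -
  \<comment> \<open>The shifts 0 and -pi/2 of the phase give the real and the imaginary part of the
    characteristic function.\<close>
  have cos: "expectation (\<lambda>\<omega>. W \<omega> * cos (s * X \<omega>)) = expectation (\<lambda>\<omega>. V \<omega> * cos (s * Y \<omega>))"
    and sin: "expectation (\<lambda>\<omega>. W \<omega> * sin (s * X \<omega>)) = expectation (\<lambda>\<omega>. V \<omega> * sin (s * Y \<omega>))" for s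
    using phase[of s 0] phase[of s "- pi / 2"] by (simp_all add: cos_diff)
  have int: "integrable M W" "integrable M V"
    using W V by (auto intro!: integrable_const_bound[where B = C])
  define m where "m = expectation W"
  have mV: "m = expectation V" using cos[of 0] by (simp add: m_def)
  have m0: "m \<ge> 0" unfolding m_def using W by simp
  show ?thesis
  proof (cases "m = 0")
    case True
    have "AE \<omega> in M. W \<omega> = 0" "AE \<omega> in M. V \<omega> = 0"
      using integral_nonneg_eq_0_iff_AE[OF int(1)] integral_nonneg_eq_0_iff_AE[OF int(2)] W V True mV
      unfolding m_def by auto
    then have "AE \<omega> in M. W \<omega> * indicator B (X \<omega>) = 0" "AE \<omega> in M. V \<omega> * indicator B (Y \<omega>) = 0"
      by (eventually_elim, simp)+
    then have "expectation (\<lambda>\<omega>. W \<omega> * indicator B (X \<omega>)) = 0" "expectation (\<lambda>\<omega>. V \<omega> * indicator B (Y \<omega>)) = 0"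
      by (intro integral_eq_zero_AE; simp)+
    then show ?thesis by simp
  next
    case False
    with m0 have m: "m > 0" by simp
    define D where "D U Z = distr (density M (\<lambda>\<omega>. ennreal (U \<omega> / m))) borel Z" for U Z :: "'a \<Rightarrow> real"
    have real_distr: "real_distribution (D U Z)"
      and charD: "char (D U Z) s = Complex (expectation (\<lambda>\<omega>. U \<omega> * cos (s * Z \<omega>)) / m) (expectation (\<lambda>\<omega>. U \<omega> * sin (s * Z \<omega>)) / m)"
      and measD: "measure (D U Z) B = expectation (\<lambda>\<omega>. U \<omega> * indicator B (Z \<omega>)) / m"
      if U[measurable]: "U \<in> borel_measurable M" and Z[measurable]: "Z \<in> borel_measurable M"
        and U0: "\<And>\<omega>. 0 \<le> U \<omega>" "\<And>\<omega>. U \<omega> \<le> C" "expectation U = m" for U Z s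
    proof -
      have intU: "integrable M U" using U0 by (auto intro!: integrable_const_bound[where B = C])
      interpret dens: prob_space "density M (\<lambda>\<omega>. ennreal (U \<omega> / m))"
      proof
        have "emeasure (density M (\<lambda>\<omega>. ennreal (U \<omega> / m))) (space M) = (\<integral>\<^sup>+\<omega>. ennreal (U \<omega> / m) \<partial>M)"
          by (subst emeasure_density) (auto intro!: nn_integral_cong)
        also have "\<dots> = ennreal (expectation (\<lambda>\<omega>. U \<omega> / m))"
          using intU U0 m by (intro nn_integral_eq_integral) auto
        also have "\<dots> = 1" using U0(3) m by simp
        finally show "emeasure (density M (\<lambda>\<omega>. ennreal (U \<omega> / m))) (space (density M (\<lambda>\<omega>. ennreal (U \<omega> / m)))) = 1"
          by simp
      qed
      interpret rd: real_distribution "D U Z"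
        unfolding D_def by (rule dens.real_distribution_distr) simp
      show "real_distribution (D U Z)" by unfold_locales
      have gen: "(LINT x|D U Z. g x) = (LINT \<omega>|M. (U \<omega> / m) *\<^sub>R g (Z \<omega>))"
        if [measurable]: "g \<in> borel_measurable borel" for g :: "real \<Rightarrow> 'z::{banach, second_countable_topology}"
        unfolding D_def using U0 m by (simp add: integral_distr integral_density)
      have i: "integrable M (\<lambda>\<omega>. (U \<omega> / m) *\<^sub>R iexp (s * Z \<omega>))"
      proof (rule integrable_const_bound[where B = "C / m"])
        show "AE \<omega> in M. norm ((U \<omega> / m) *\<^sub>R iexp (s * Z \<omega>)) \<le> C / m"
          using U0 m by (intro AE_I2) (simp add: norm_mult divide_right_mono)
      qed measurable
      have "char (D U Z) s = (LINT \<omega>|M. (U \<omega> / m) *\<^sub>R iexp (s * Z \<omega>))"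
        unfolding char_def by (rule gen) measurable
      moreover have "Re (LINT \<omega>|M. (U \<omega> / m) *\<^sub>R iexp (s * Z \<omega>)) = expectation (\<lambda>\<omega>. U \<omega> * cos (s * Z \<omega>)) / m"
        using i by (subst integral_Re[symmetric]) (simp_all add: Re_exp)
      moreover have "Im (LINT \<omega>|M. (U \<omega> / m) *\<^sub>R iexp (s * Z \<omega>)) = expectation (\<lambda>\<omega>. U \<omega> * sin (s * Z \<omega>)) / m"
        using i by (subst integral_Im[symmetric]) (simp_all add: Im_exp)
      ultimately show "char (D U Z) s = Complex (expectation (\<lambda>\<omega>. U \<omega> * cos (s * Z \<omega>)) / m) (expectation (\<lambda>\<omega>. U \<omega> * sin (s * Z \<omega>)) / m)"
        by (simp add: complex_eq_iff)
      have "measure (D U Z) B = (LINT x|D U Z. indicator B x)" using B by simp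
      also have "\<dots> = expectation (\<lambda>\<omega>. U \<omega> * indicator B (Z \<omega>)) / m"
        using B by (subst gen) auto
      finally show "measure (D U Z) B = expectation (\<lambda>\<omega>. U \<omega> * indicator B (Z \<omega>)) / m" .
    qed
    have "char (D W X) = char (D V Y)"
      using charD[of W X] charD[of V Y] W V cos sin mV m_def by (intro ext) simp
    then have "D W X = D V Y"
      using real_distr[of W X] real_distr[of V Y] W V mV m_def by (intro Levy_uniqueness) auto
    then have "measure (D W X) B = measure (D V Y) B" by simp
    moreover have "measure (D W X) B = expectation (\<lambda>\<omega>. W \<omega> * indicator B (X \<omega>)) / m"
      by (rule measD) (use W m_def in auto)
    moreover have "measure (D V Y) B = expectation (\<lambda>\<omega>. V \<omega> * indicator B (Y \<omega>)) / m"
      by (rule measD) (use V mV in auto)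
    ultimately show ?thesis using m by simp
  qed
qed

text \<open>Induction on the number of coordinates turned from a phase into an indicator: the weights
  \<open>1 + cos (\<theta> + a)\<close> are non-negative, so the one-dimensional uniqueness theorem applies to them, and
  the phase is recovered from \<open>2 cos (\<theta> + a) = (1 + cos (\<theta> + a)) - (1 + cos (\<theta> + a + \<pi>))\<close>.\<close>
lemma (in prob_space) indicator_phase_eq:
  fixes X Y :: "'j \<Rightarrow> 'a \<Rightarrow> real"
  assumes J: "finite J"
    and X: "\<And>j. X j \<in> borel_measurable M" and Y: "\<And>j. Y j \<in> borel_measurable M"
    and char: "\<And>t. char (distr M borel (\<lambda>\<omega>. \<Sum>j\<in>J. t j * X j \<omega>)) 1 = char (distr M borel (\<lambda>\<omega>. \<Sum>j\<in>J. t j * Y j \<omega>)) 1"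
    and B [measurable]: "\<And>j. B j \<in> sets borel"
    and A: "finite A" "A \<subseteq> J"
  shows "expectation (\<lambda>\<omega>. (\<Prod>j\<in>A. indicator (B j) (X j \<omega>)) * cos ((\<Sum>j\<in>J. t j * X j \<omega>) + a))
    = expectation (\<lambda>\<omega>. (\<Prod>j\<in>A. indicator (B j) (Y j \<omega>)) * cos ((\<Sum>j\<in>J. t j * Y j \<omega>) + a))"
proof -
  define \<theta> where "\<theta> Z t \<omega> = (\<Sum>j\<in>J. t j * Z j \<omega> :: real)" for Z :: "'j \<Rightarrow> 'a \<Rightarrow> real" and t \<omega>
  define Ind where "Ind A Z \<omega> = (\<Prod>j\<in>A. indicator (B j) (Z j \<omega>) :: real)" for A and Z :: "'j \<Rightarrow> 'a \<Rightarrow> real" and \<omega>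
  define G where "G A Z t a = expectation (\<lambda>\<omega>. Ind A Z \<omega> * cos (\<theta> Z t \<omega> + a))" for A Z t a
  have meas: "\<theta> Z t \<in> borel_measurable M" "Ind A Z \<in> borel_measurable M"
    if [measurable]: "\<And>j. Z j \<in> borel_measurable M" for Z t A
    unfolding \<theta>_def Ind_def by measurable
  have Ind01: "0 \<le> Ind A Z \<omega>" "Ind A Z \<omega> \<le> 1" for A Z \<omega>
    unfolding Ind_def by (auto intro!: prod_nonneg prod_le_1)
  have int: "integrable M (\<lambda>\<omega>. Ind A Z \<omega> * cos (\<theta> Z t \<omega> + a))"
    if Z: "\<And>j. Z j \<in> borel_measurable M" for A Z t a
  proof (rule integrable_const_bound[where B = 1])
    note [measurable] = meas[OF Z]
    show "AE \<omega> in M. norm (Ind A Z \<omega> * cos (\<theta> Z t \<omega> + a)) \<le> 1"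
      using Ind01 by (intro AE_I2) (simp add: abs_mult mult_le_one)
    show "(\<lambda>\<omega>. Ind A Z \<omega> * cos (\<theta> Z t \<omega> + a)) \<in> borel_measurable M" by measurable
  qed
  have "\<forall>t a. G A X t a = G A Y t a"
    using A
  proof (induction A)
    case empty
    have *: "G {} Z t a = Re (char (distr M borel (\<theta> Z t)) 1) * cos a - Im (char (distr M borel (\<theta> Z t)) 1) * sin a"
      if Z: "\<And>j. Z j \<in> borel_measurable M" for Z t a
    proof -
      note [measurable] = meas[OF Z]
      have "integrable M (\<lambda>\<omega>. iexp (\<theta> Z t \<omega>))" "integrable M (\<lambda>\<omega>. cos (\<theta> Z t \<omega>))" "integrable M (\<lambda>\<omega>. sin (\<theta> Z t \<omega>))"
        by (rule integrable_const_bound[where B = 1]; auto)+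
      then show ?thesis
        unfolding char_def by (simp add: G_def Ind_def cos_add integral_distr Re_exp Im_exp flip: integral_Re integral_Im)
    qed
    show ?case
    proof (intro allI)
      fix t a
      show "G {} X t a = G {} Y t a" unfolding *[OF X] *[OF Y] using char[of t] by (simp add: \<theta>_def[abs_def])
    qed
  next
    case (insert m A)
    then have m: "m \<in> J" and IH: "\<And>t a. G A X t a = G A Y t a" by auto
    \<comment> \<open>The frequency vector of a single coordinate, which makes
      \<open>s * Z m \<omega>\<close> another phase of the form \<open>\<theta>\<close>.\<close>
    define \<delta> where "\<delta> s = (\<lambda>j. if j = m then s else 0 :: real)" for s
    have \<delta>: "\<theta> Z (\<delta> s) \<omega> = s * Z m \<omega>" for Z s \<omega>
      using m J by (simp add: \<theta>_def \<delta>_def if_distrib[of "\<lambda>x. x * _"] cong: if_cong)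
    have add: "\<theta> Z (\<lambda>j. t j + u j) \<omega> = \<theta> Z t \<omega> + \<theta> Z u \<omega>" "\<theta> Z (\<lambda>j. t j - u j) \<omega> = \<theta> Z t \<omega> - \<theta> Z u \<omega>" for Z t u \<omega>
      by (simp_all add: \<theta>_def sum.distrib sum_subtractf algebra_simps)
    let ?W = "\<lambda>Z t a \<omega>. Ind A Z \<omega> * (1 + cos (\<theta> Z t \<omega> + a))"
    \<comment> \<open>The product formula for cosines turns the weighted phase into phases with
      other frequencies and the same indicators, all covered by the induction hypothesis.\<close>
    have expand: "expectation (\<lambda>\<omega>. ?W Z t a \<omega> * cos (s * Z m \<omega> + b))
      = G A Z (\<delta> s) b + (G A Z (\<lambda>j. t j - \<delta> s j) (a - b) + G A Z (\<lambda>j. t j + \<delta> s j) (a + b)) / 2"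
      if Z: "\<And>j. Z j \<in> borel_measurable M" for Z t a s b
    proof -
      have "?W Z t a \<omega> * cos (s * Z m \<omega> + b) = Ind A Z \<omega> * cos (\<theta> Z (\<delta> s) \<omega> + b)
         + (Ind A Z \<omega> * cos (\<theta> Z (\<lambda>j. t j - \<delta> s j) \<omega> + (a - b)) + Ind A Z \<omega> * cos (\<theta> Z (\<lambda>j. t j + \<delta> s j) \<omega> + (a + b))) / 2" for \<omega>
      proof -
        have "cos (\<theta> Z t \<omega> + a) * cos (s * Z m \<omega> + b)
          = (cos (\<theta> Z (\<lambda>j. t j - \<delta> s j) \<omega> + (a - b)) + cos (\<theta> Z (\<lambda>j. t j + \<delta> s j) \<omega> + (a + b))) / 2"
          unfolding cos_times_cos add \<delta> by (simp add: algebra_simps)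
        then have "?W Z t a \<omega> * cos (s * Z m \<omega> + b) = Ind A Z \<omega> * (cos (s * Z m \<omega> + b)
          + (cos (\<theta> Z (\<lambda>j. t j - \<delta> s j) \<omega> + (a - b)) + cos (\<theta> Z (\<lambda>j. t j + \<delta> s j) \<omega> + (a + b))) / 2)"
          by (simp only: mult.assoc distrib_right mult_1)
        then show ?thesis unfolding \<delta> by (simp add: field_simps)
      qed
      then show ?thesis unfolding G_def using int[OF Z] by simp
    qed
    have key: "expectation (\<lambda>\<omega>. ?W X t a \<omega> * indicator (B m) (X m \<omega>)) = expectation (\<lambda>\<omega>. ?W Y t a \<omega> * indicator (B m) (Y m \<omega>))" for t a
    proof (rule weighted_char_uniqueness[where C = 2, OF X Y _ _ _ _ _ _ _ B])
      have W01: "0 \<le> ?W Z t a \<omega>" "?W Z t a \<omega> \<le> 2" for Z \<omega>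
      proof -
        have "0 \<le> 1 + cos (\<theta> Z t \<omega> + a)" "1 + cos (\<theta> Z t \<omega> + a) \<le> 2"
          using cos_ge_minus_one[of "\<theta> Z t \<omega> + a"] cos_le_one[of "\<theta> Z t \<omega> + a"] by linarith+
        then show "0 \<le> ?W Z t a \<omega>" "?W Z t a \<omega> \<le> 2"
          using Ind01[of A Z \<omega>] mult_mono[of "Ind A Z \<omega>" 1 "1 + cos (\<theta> Z t \<omega> + a)" 2] by auto
      qed
      show "0 \<le> ?W X t a \<omega>" "?W X t a \<omega> \<le> 2" "0 \<le> ?W Y t a \<omega>" "?W Y t a \<omega> \<le> 2" for \<omega> by (rule W01)+
      note [measurable] = meas[OF X] meas[OF Y]
      show "?W X t a \<in> borel_measurable M" "?W Y t a \<in> borel_measurable M" by measurable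
      show "expectation (\<lambda>\<omega>. ?W X t a \<omega> * cos (s * X m \<omega> + b)) = expectation (\<lambda>\<omega>. ?W Y t a \<omega> * cos (s * Y m \<omega> + b))" for s b
        by (rule trans[OF expand[OF X] trans[OF _ expand[OF Y, symmetric]]]) (simp only: IH)
    qed
    have half: "G (insert m A) Z t a = (expectation (\<lambda>\<omega>. ?W Z t a \<omega> * indicator (B m) (Z m \<omega>))
       - expectation (\<lambda>\<omega>. ?W Z t (a + pi) \<omega> * indicator (B m) (Z m \<omega>))) / 2"
      if Z: "\<And>j. Z j \<in> borel_measurable M" for Z t a
    proof -
      have Ins: "Ind (insert m A) Z \<omega> = Ind A Z \<omega> * indicator (B m) (Z m \<omega>)" for \<omega>
        using insert by (simp add: Ind_def mult.commute)
      have one: "\<theta> Z (\<lambda>_. 0) \<omega> = 0" for \<omega> by (simp add: \<theta>_def)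
      have W: "?W Z t a \<omega> * indicator (B m) (Z m \<omega>) = Ind (insert m A) Z \<omega> * cos (\<theta> Z (\<lambda>_. 0) \<omega> + 0) + Ind (insert m A) Z \<omega> * cos (\<theta> Z t \<omega> + a)" for a \<omega>
        by (simp add: Ins one algebra_simps)
      have "expectation (\<lambda>\<omega>. ?W Z t a \<omega> * indicator (B m) (Z m \<omega>)) = G (insert m A) Z (\<lambda>_. 0) 0 + G (insert m A) Z t a" for a
        unfolding W G_def by (intro Bochner_Integration.integral_add int Z)
      moreover have "G (insert m A) Z t (a + pi) = - G (insert m A) Z t a"
        unfolding G_def by (simp add: add.assoc[symmetric])
      ultimately show ?thesis by simp
    qed
    show ?case
    proof (intro allI)
      fix t a
      show "G (insert m A) X t a = G (insert m A) Y t a"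
        by (rule trans[OF half[OF X] trans[OF _ half[OF Y, symmetric]]]) (simp only: key)
    qed
  qed
  then show ?thesis by (simp add: G_def Ind_def \<theta>_def)
qed

text \<open>A Cramer-Wold statement for arbitrary families of coordinates. Cylinders over finite
  index sets determine a finite measure on the product; the argument 1 suffices because
  \<open>t\<close> already carries every scaling.\<close>

theorem (in prob_space) distr_eq_if_char_eq:
  fixes X Y :: "'j \<Rightarrow> 'a \<Rightarrow> real"
  assumes X [measurable]: "\<And>j. X j \<in> borel_measurable M" and Y [measurable]: "\<And>j. Y j \<in> borel_measurable M"
    and char: "\<And>J t. finite J \<Longrightarrow> char (distr M borel (\<lambda>\<omega>. \<Sum>j\<in>J. t j * X j \<omega>)) 1 = char (distr M borel (\<lambda>\<omega>. \<Sum>j\<in>J. t j * Y j \<omega>)) 1"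
  shows "distr M (PiM UNIV (\<lambda>_. borel)) (\<lambda>\<omega> j. X j \<omega>) = distr M (PiM UNIV (\<lambda>_. borel)) (\<lambda>\<omega> j. Y j \<omega>)"
proof -
  have meas: "(\<lambda>\<omega> j. Z j \<omega>) \<in> measurable M (PiM UNIV (\<lambda>_. borel))"
    if "\<And>j. Z j \<in> borel_measurable M" for Z :: "'j \<Rightarrow> 'a \<Rightarrow> real"
    using that by (intro measurable_PiM_single') auto
  note [measurable] = meas[OF X] meas[OF Y]
  show ?thesis
  proof (rule measure_eqI_PiM_infinite[where I = UNIV and M = "\<lambda>_. borel"])
    fix B :: "'j \<Rightarrow> real set" and J assume J: "finite J" and B: "\<And>i. i \<in> J \<Longrightarrow> B i \<in> sets borel"
    \<comment> \<open>\<open>indicator_phase_eq\<close> wants measurable sets at all indices; the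
      empty set fills in outside \<open>J\<close>, where it enters no product.\<close>
    define B' where "B' j = (if j \<in> J then B j else {})" for j
    have B': "B' j \<in> sets borel" for j using B by (simp add: B'_def)
    let ?S = "prod_emb UNIV (\<lambda>_. borel) J (Pi\<^sub>E J B)"
    have S: "?S \<in> sets (PiM UNIV (\<lambda>_. borel))" using J B by (intro sets_PiM_I) auto
    have em: "emeasure (distr M (PiM UNIV (\<lambda>_. borel)) (\<lambda>\<omega> j. Z j \<omega>)) ?S = ennreal (expectation (\<lambda>\<omega>. \<Prod>j\<in>J. indicator (B' j) (Z j \<omega>)))"
      if Z: "\<And>j. Z j \<in> borel_measurable M" for Z :: "'j \<Rightarrow> 'a \<Rightarrow> real"
    proof -
      let ?T = "(\<lambda>\<omega> j. Z j \<omega>) -` ?S \<inter> space M"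
      have T: "?T \<in> sets M" using meas[OF Z] S by (rule measurable_sets)
      have "\<omega> \<in> ?T \<longleftrightarrow> (\<forall>j\<in>J. Z j \<omega> \<in> B j)" if "\<omega> \<in> space M" for \<omega>
        using that by (auto simp: prod_emb_iff PiE_iff)
      then have "(\<Prod>j\<in>J. indicator (B' j) (Z j \<omega>)) = (indicator ?T \<omega> :: real)" if "\<omega> \<in> space M" for \<omega>
        using that J by (auto simp: indicator_def B'_def prod_zero_iff intro!: prod.neutral)
      then have "expectation (\<lambda>\<omega>. \<Prod>j\<in>J. indicator (B' j) (Z j \<omega>)) = (expectation (indicator ?T) :: real)"
        by (intro Bochner_Integration.integral_cong) auto
      also have "\<dots> = prob ?T" using T by simp
      finally show ?thesis using T S by (simp add: emeasure_distr[OF meas[OF Z]] emeasure_eq_measure)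
    qed
    show "emeasure (distr M (PiM UNIV (\<lambda>_. borel)) (\<lambda>\<omega> j. X j \<omega>)) ?S = emeasure (distr M (PiM UNIV (\<lambda>_. borel)) (\<lambda>\<omega> j. Y j \<omega>)) ?S"
    proof -
      \<comment> \<open>With zero frequencies and zero phase the cosine is 1, and only the
        indicators of all of \<open>J\<close> remain.\<close>
      have "expectation (\<lambda>\<omega>. (\<Prod>j\<in>J. indicator (B' j) (X j \<omega>)) * cos ((\<Sum>j\<in>J. 0 * X j \<omega>) + 0))
         = expectation (\<lambda>\<omega>. (\<Prod>j\<in>J. indicator (B' j) (Y j \<omega>)) * cos ((\<Sum>j\<in>J. 0 * Y j \<omega>) + 0))"
        by (rule indicator_phase_eq[OF J X Y char[OF J] B' J subset_refl])
      then show ?thesis by (simp add: em[OF X] em[OF Y])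
    qed
  next
    show "finite_measure (distr M (PiM UNIV (\<lambda>_. borel)) (\<lambda>\<omega> j. X j \<omega>))"
      using prob_space_distr[of "\<lambda>\<omega> j. X j \<omega>" "PiM UNIV (\<lambda>_. borel)"] by (simp add: prob_space_def)
  qed simp_all
qed

lemma (in prob_space) char_normal_combination:
  assumes xi: "iid_std_normal M \<xi>" and A: "finite A"
  shows "char (distr M borel (\<lambda>\<omega>. \<Sum>m\<in>A. c m * \<xi> m \<omega>)) 1 = of_real (exp (- (\<Sum>m\<in>A. (c m)\<^sup>2) / 2))"
proof -
  have ind: "indep_vars (\<lambda>_. borel) \<xi> UNIV" and dist: "\<And>m. distributed M lborel (\<xi> m) std_normal_density"
    using xi by (auto simp: iid_std_normal_def)
  have [measurable]: "\<xi> m \<in> borel_measurable M" for m using distributed_measurable[OF dist[of m]] by simp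
  have "indep_vars (\<lambda>_. borel) (\<lambda>m \<omega>. c m * \<xi> m \<omega>) A"
    using indep_vars_subset[OF ind subset_UNIV, of A] by (rule indep_vars_compose2) simp
  then have "char (distr M borel (\<lambda>\<omega>. \<Sum>m\<in>A. c m * \<xi> m \<omega>)) 1 = (\<Prod>m\<in>A. char (distr M borel (\<lambda>\<omega>. c m * \<xi> m \<omega>)) 1)"
    by (rule char_distr_sum)
  also have "\<dots> = (\<Prod>m\<in>A. complex_of_real (exp (- (c m)\<^sup>2 / 2)))"
  proof (rule prod.cong[OF refl])
    fix m
    have "char (distr M borel (\<lambda>\<omega>. c m * \<xi> m \<omega>)) 1 = (LINT \<omega>|M. iexp (c m * \<xi> m \<omega>))"
      unfolding char_def by (simp add: integral_distr)
    also have "\<dots> = (LINT x|distr M lborel (\<xi> m). iexp (c m * x))"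
      by (subst integral_distr) (use distributed_measurable[OF dist[of m]] in auto)
    also have "\<dots> = char std_normal_distribution (c m)"
      unfolding char_def distributed_distr_eq_density[OF dist[of m]] ..
    finally show "char (distr M borel (\<lambda>\<omega>. c m * \<xi> m \<omega>)) 1 = of_real (exp (- (c m)\<^sup>2 / 2))"
      by (simp add: char_std_normal_distribution)
  qed
  also have "(\<Prod>m\<in>A. complex_of_real (exp (- (c m)\<^sup>2 / 2))) = of_real (exp (\<Sum>m\<in>A. - (c m)\<^sup>2 / 2))"
    using A by (simp add: exp_sum)
  finally show ?thesis by (simp add: sum_negf sum_divide_distrib)
qed

section \<open>Coordinates on the completion\<close>

locale sierpinski_completion = sierpinski_heat +
  fixes \<epsilon> :: real and J :: "(real^2 \<Rightarrow> real) \<Rightarrow> 'b::{banach, second_countable_topology}"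
  assumes eps_pos: "\<epsilon> > 0" and completion: "is_neg_sobolev_completion \<mu> lam \<phi> \<epsilon> J"
begin

lemma J_linear:
  assumes "f \<in> L2 \<mu>" "g \<in> L2 \<mu>"
  shows "J (\<lambda>x. a * f x + b * g x) = a *\<^sub>R J f + b *\<^sub>R J g"
  using completion assms unfolding is_neg_sobolev_completion_def by blast

lemma norm_J_sums:
  assumes f: "f \<in> L2 \<mu>"
  shows "(\<lambda>k. lam k powr (- \<epsilon>) * (L2_inner \<mu> f (\<phi> k))\<^sup>2) sums (norm (J f))\<^sup>2"
proof -
  let ?a = "\<lambda>k. lam k powr (- \<epsilon>) * (L2_inner \<mu> f (\<phi> k))\<^sup>2"
  have major: "summable (\<lambda>k. lam 0 powr (- \<epsilon>) * (L2_inner \<mu> f (\<phi> k))\<^sup>2)"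
    using Parseval[OF f f] by (intro summable_mult) (auto simp: power2_eq_square sums_iff)
  have "?a k \<le> lam 0 powr (- \<epsilon>) * (L2_inner \<mu> f (\<phi> k))\<^sup>2" for k
    using eps_pos lam_mono[of 0 k] by (intro mult_right_mono powr_mono2') auto
  then have sum: "summable ?a"
    by (intro summable_comparison_test'[OF major, of 0 ?a]) simp
  have "norm (J f) = sqrt (\<Sum>k. ?a k)"
    using completion f unfolding is_neg_sobolev_completion_def neg_sobolev_norm_def by blast
  moreover have "(\<Sum>k. ?a k) \<ge> 0" using sum by (intro suminf_nonneg) auto
  ultimately show ?thesis using sum by (simp add: summable_sums)
qed

text \<open>The polarization identity extends the \<open>L\<^sup>2\<close> coefficients continuously to the completion.\<close>
definition coord :: "nat \<Rightarrow> 'b \<Rightarrow> real" where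
  "coord j b = lam j powr \<epsilon> * ((norm (b + J (\<phi> j)))\<^sup>2 - (norm (b - J (\<phi> j)))\<^sup>2) / 4"

lemma coord_continuous: "continuous_on UNIV (coord j)"
  unfolding coord_def[abs_def] by (intro continuous_intros) simp

lemma coord_tendsto: "(f \<longlongrightarrow> b) F \<Longrightarrow> ((\<lambda>x. coord j (f x)) \<longlongrightarrow> coord j b) F"
  unfolding coord_def by (intro tendsto_intros) auto

lemma coord_measurable [measurable]: "coord j \<in> borel_measurable borel"
  using coord_continuous by (rule borel_measurable_continuous_onI)

text \<open>No inner product is given on \<open>'b\<close>, but the norms of
  \<open>J f + J (\<phi> j)\<close> and \<open>J f - J (\<phi> j)\<close> are weighted sums over
  coefficients that differ only in the term with index \<open>j\<close>. The factor
  \<open>lam j powr \<epsilon>\<close> in \<open>coord\<close> removes its weight.\<close>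

lemma coord_J:
  assumes f: "f \<in> L2 \<mu>" shows "coord j (J f) = L2_inner \<mu> f (\<phi> j)"
proof -
  let ?c = "\<lambda>k. L2_inner \<mu> f (\<phi> k)" and ?\<delta> = "\<lambda>k. if k = j then 1 else 0 :: real"
  have eq: "J f + s *\<^sub>R J (\<phi> j) = J (\<lambda>x. 1 * f x + s * \<phi> j x)" for s
    using J_linear[OF f phi_L2, of 1 s j] by simp
  have sums: "(\<lambda>k. lam k powr (- \<epsilon>) * (?c k + s * ?\<delta> k)\<^sup>2) sums (norm (J f + s *\<^sub>R J (\<phi> j)))\<^sup>2" for s
  proof -
    have "L2_inner \<mu> (\<lambda>x. 1 * f x + s * \<phi> j x) (\<phi> k) = ?c k + s * ?\<delta> k" for k
      unfolding L2_inner_linear[OF f phi_L2 phi_L2] phi_orthonormal by simp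
    then show ?thesis
      unfolding eq using norm_J_sums[OF L2_linear[OF f phi_L2], of 1 s j] by simp
  qed
  have "(\<lambda>k. lam k powr (- \<epsilon>) * (?c k + 1 * ?\<delta> k)\<^sup>2 - lam k powr (- \<epsilon>) * (?c k + (-1) * ?\<delta> k)\<^sup>2)
     sums ((norm (J f + 1 *\<^sub>R J (\<phi> j)))\<^sup>2 - (norm (J f + (-1) *\<^sub>R J (\<phi> j)))\<^sup>2)"
    by (intro sums_diff sums)
  moreover have "(\<lambda>k. lam k powr (- \<epsilon>) * (?c k + 1 * ?\<delta> k)\<^sup>2 - lam k powr (- \<epsilon>) * (?c k + (-1) * ?\<delta> k)\<^sup>2)
    = (\<lambda>k. if k = j then lam k powr (- \<epsilon>) * (4 * ?c k) else 0)"
    by (auto simp: power2_eq_square algebra_simps)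
  ultimately have "(norm (J f + J (\<phi> j)))\<^sup>2 - (norm (J f - J (\<phi> j)))\<^sup>2 = lam j powr (- \<epsilon>) * (4 * ?c j)"
    using sums_single[of j "\<lambda>k. lam k powr (- \<epsilon>) * (4 * ?c k)"] sums_unique2 by fastforce
  moreover have "lam j powr \<epsilon> * lam j powr (- \<epsilon>) = 1"
    by (simp flip: powr_add)
  ultimately show ?thesis by (simp add: coord_def mult.assoc[symmetric])
qed

lemma J_dense: obtains f where "\<And>n. f n \<in> L2 \<mu>" "(\<lambda>n. J (f n)) \<longlonglongrightarrow> b"
proof -
  have "b \<in> closure (J ` L2 \<mu>)" using completion by (simp add: is_neg_sobolev_completion_def)
  then obtain x where "(\<forall>n. x n \<in> J ` L2 \<mu>) \<and> x \<longlonglongrightarrow> b" unfolding closure_sequential ..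
  then have x: "x n \<in> J ` L2 \<mu>" "x \<longlonglongrightarrow> b" for n by simp_all
  show ?thesis
  proof (rule that)
    show "inv_into (L2 \<mu>) J (x n) \<in> L2 \<mu>" for n by (rule inv_into_into[OF x(1)])
    show "(\<lambda>n. J (inv_into (L2 \<mu>) J (x n))) \<longlonglongrightarrow> b" using x(2) by (simp add: f_inv_into_f[OF x(1)])
  qed
qed

text \<open>Additivity is not visible in the definition by norms; it holds on the range of
  \<open>J\<close> and extends by density and continuity.\<close>

lemma coord_add: "coord j (a + b) = coord j a + coord j b"
proof -
  obtain f where f: "\<And>n. f n \<in> L2 \<mu>" "(\<lambda>n. J (f n)) \<longlonglongrightarrow> a" by (rule J_dense[of a]) (rule that)
  obtain g where g: "\<And>n. g n \<in> L2 \<mu>" "(\<lambda>n. J (g n)) \<longlonglongrightarrow> b" by (rule J_dense[of b]) (rule that)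
  have eq: "coord j (J (f n) + J (g n)) = coord j (J (f n)) + coord j (J (g n))" for n
  proof -
    have "J (f n) + J (g n) = J (\<lambda>x. 1 * f n x + 1 * g n x)" using J_linear[OF f(1) g(1), of 1 n 1 n] by simp
    then show ?thesis
      using f(1) g(1) by (simp only: coord_J L2_linear L2_inner_linear phi_L2)
  qed
  show ?thesis
  proof (rule LIMSEQ_unique)
    show "(\<lambda>n. coord j (J (f n) + J (g n))) \<longlonglongrightarrow> coord j (a + b)"
      by (intro coord_tendsto tendsto_add f g)
    show "(\<lambda>n. coord j (J (f n) + J (g n))) \<longlonglongrightarrow> coord j a + coord j b"
      unfolding eq by (intro tendsto_add coord_tendsto f g)
  qed
qed

lemma coord_diff: "coord j (a - b) = coord j a - coord j b"
  using coord_add[of j "a - b" b] by simp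

text \<open>Written with \<open>L2_set\<close> for its triangle inequality;
  \<open>partial_norm_alt\<close> is the form for limits and measurability.\<close>

definition partial_norm :: "nat \<Rightarrow> 'b \<Rightarrow> real" where
  "partial_norm n b = L2_set (\<lambda>k. lam k powr (- \<epsilon> / 2) * coord k b) {..<n}"

lemma partial_norm_alt: "partial_norm n b = sqrt (\<Sum>k<n. lam k powr (- \<epsilon>) * (coord k b)\<^sup>2)"
proof -
  have "(lam k powr (- \<epsilon> / 2))\<^sup>2 = lam k powr (- \<epsilon>)" for k
    by (simp add: power2_eq_square flip: powr_add)
  then show ?thesis unfolding partial_norm_def L2_set_def by (simp add: power_mult_distrib)
qed

lemma partial_norm_triangle: "partial_norm n (a + b) \<le> partial_norm n a + partial_norm n b"
  unfolding partial_norm_def coord_add distrib_left by (rule L2_set_triangle_ineq)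

lemma partial_norm_minus: "partial_norm n (b - a) = partial_norm n (a - b)"
  unfolding partial_norm_alt coord_diff by (simp add: power2_commute)

lemma partial_norm_J:
  assumes "f \<in> L2 \<mu>"
  shows "(\<lambda>n. partial_norm n (J f)) \<longlonglongrightarrow> norm (J f)" "partial_norm n (J f) \<le> norm (J f)"
proof -
  have "(\<lambda>n. sqrt (\<Sum>k<n. lam k powr (- \<epsilon>) * (L2_inner \<mu> f (\<phi> k))\<^sup>2)) \<longlonglongrightarrow> sqrt ((norm (J f))\<^sup>2)"
    using norm_J_sums[OF assms] unfolding sums_def by (rule tendsto_real_sqrt)
  then show lim: "(\<lambda>n. partial_norm n (J f)) \<longlonglongrightarrow> norm (J f)"
    unfolding partial_norm_alt coord_J[OF assms] by simp
  have "incseq (\<lambda>n. partial_norm n (J f))"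
    unfolding partial_norm_alt by (intro incseq_SucI) simp
  then show "partial_norm n (J f) \<le> norm (J f)" using lim by (rule incseq_le)
qed

lemma partial_norm_le: "partial_norm n b \<le> norm b"
proof -
  obtain f where f: "\<And>m. f m \<in> L2 \<mu>" "(\<lambda>m. J (f m)) \<longlonglongrightarrow> b" by (rule J_dense[of b]) (rule that)
  show ?thesis
  proof (rule LIMSEQ_le)
    show "(\<lambda>m. partial_norm n (J (f m))) \<longlonglongrightarrow> partial_norm n b"
      unfolding partial_norm_alt by (intro tendsto_intros coord_tendsto f)
    show "(\<lambda>m. norm (J (f m))) \<longlonglongrightarrow> norm b" by (intro tendsto_norm f)
    show "\<exists>N. \<forall>m\<ge>N. partial_norm n (J (f m)) \<le> norm (J (f m))"
      using partial_norm_J(2)[OF f(1)] by blast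
  qed
qed

text \<open>Convergence holds on the dense range of \<open>J\<close>, and the partial norms are
  uniformly Lipschitz by \<open>partial_norm_le\<close>, so it carries over to all of
  \<open>'b\<close>. The norm is thus a limit of functions of the coordinates.\<close>

lemma partial_norm_tendsto: "(\<lambda>n. partial_norm n b) \<longlonglongrightarrow> norm b"
proof (rule LIMSEQ_I)
  fix r :: real assume r: "r > 0"
  obtain f where f: "\<And>m. f m \<in> L2 \<mu>" "(\<lambda>m. J (f m)) \<longlonglongrightarrow> b" by (rule J_dense[of b]) (rule that)
  obtain m where m: "norm (J (f m) - b) < r / 3"
    using LIMSEQ_D[OF f(2), of "r / 3"] r by auto
  let ?a = "J (f m)"
  obtain N where N: "\<And>n. n \<ge> N \<Longrightarrow> norm (partial_norm n ?a - norm ?a) < r / 3"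
    using LIMSEQ_D[OF partial_norm_J(1)[OF f(1)], of "r / 3"] r by auto
  show "\<exists>N. \<forall>n\<ge>N. norm (partial_norm n b - norm b) < r"
  proof (intro exI[of _ N] allI impI)
    fix n assume n: "N \<le> n"
    have 1: "partial_norm n b \<le> partial_norm n ?a + partial_norm n (?a - b)"
      using partial_norm_triangle[of n ?a "b - ?a"] partial_norm_minus[of n b ?a] by simp
    have 2: "partial_norm n ?a \<le> partial_norm n b + partial_norm n (?a - b)"
      using partial_norm_triangle[of n b "?a - b"] by simp
    have 3: "partial_norm n (?a - b) < r / 3" using partial_norm_le[of n "?a - b"] m by linarith
    have 4: "\<bar>norm ?a - norm b\<bar> < r / 3" using norm_triangle_ineq3[of ?a b] m by linarith
    have 5: "\<bar>partial_norm n ?a - norm ?a\<bar> < r / 3" using N[OF n] by simp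
    show "norm (partial_norm n b - norm b) < r" unfolding real_norm_def using 1 2 3 4 5 by linarith
  qed
qed

abbreviation seq_space :: "(nat \<Rightarrow> real) measure" where
  "seq_space \<equiv> PiM UNIV (\<lambda>_. borel)"

lemma coords_measurable: "(\<lambda>b j. coord j b) \<in> measurable borel seq_space"
  by (intro measurable_PiM_single') auto

text \<open>Distances to a fixed point are limits of functions of the coordinates, and balls generate
  the topology.\<close>
lemma borel_sets_coords:
  assumes "S \<in> sets (borel :: 'b measure)"
  shows "\<exists>T\<in>sets seq_space. S = (\<lambda>b j. coord j b) -` T"
proof -
  let ?\<Lambda> = "\<lambda>b j. coord j b"
  let ?M = "vimage_algebra UNIV ?\<Lambda> seq_space"
  have c: "coord j \<in> borel_measurable ?M" for j
  proof -
    have "?\<Lambda> \<in> measurable ?M seq_space" by (rule measurable_vimage_algebra1) (simp add: space_PiM)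
    from measurable_compose[OF this measurable_component_singleton[of j UNIV "\<lambda>_. borel"]]
    show ?thesis by simp
  qed
  have ball: "ball a r \<in> sets ?M" for a r
  proof -
    have "(\<lambda>b. norm (b - a)) \<in> borel_measurable ?M"
    proof (rule borel_measurable_LIMSEQ_real[OF partial_norm_tendsto])
      note c[measurable]
      show "(\<lambda>b. partial_norm n (b - a)) \<in> borel_measurable ?M" for n
        unfolding partial_norm_alt coord_diff by measurable
    qed
    then have "{b \<in> space ?M. norm (b - a) < r} \<in> sets ?M" by measurable
    moreover have "{b \<in> space ?M. norm (b - a) < r} = ball a r"
      by (auto simp: dist_norm norm_minus_commute)
    ultimately show ?thesis by simp
  qed
  have "(\<lambda>b. b) \<in> borel_measurable ?M"
  proof (rule borel_measurableI)
    fix U :: "'b set" assume U: "open U"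
    \<comment> \<open>An open set is the union of all balls inside it; second countability, through
      Lindelof, leaves countably many, as a sigma-algebra requires.\<close>
    let ?F = "{ball a r |a r. ball a r \<subseteq> U}"
    obtain F' where F': "F' \<subseteq> ?F" "countable F'" "\<Union>F' = \<Union>?F"
      using Lindelof[of ?F] by auto
    have "\<Union>?F = U"
    proof (intro subset_antisym subsetI)
      fix b assume "b \<in> U"
      then obtain r where "r > 0" "ball b r \<subseteq> U" using U open_contains_ball by blast
      then show "b \<in> \<Union>?F" using centre_in_ball by blast
    qed auto
    moreover have "\<Union>F' \<in> sets ?M" using F'(1,2) ball by (intro sets.countable_Union) auto
    ultimately show "(\<lambda>b. b) -` U \<inter> space ?M \<in> sets ?M" using F'(3) by simp
  qed
  from measurable_sets[OF this assms] have "S \<in> sets ?M" by simp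
  then show ?thesis by (auto simp: sets_vimage_algebra2 space_PiM)
qed

end

text \<open>Induction over the generation of measurable functions: indicators come from preimages
  under \<open>X\<close>, and sums, multiples and suprema can be formed before composing with
  \<open>X\<close>.\<close>

lemma Doob_Dynkin_ennreal:
  fixes f :: "'a \<Rightarrow> ennreal"
  assumes f: "f \<in> borel_measurable (vimage_algebra \<Omega> X N)" and X: "X \<in> \<Omega> \<rightarrow> space N"
  shows "\<exists>g\<in>borel_measurable N. \<forall>\<omega>\<in>\<Omega>. f \<omega> = g (X \<omega>)"
  using f
proof (induction rule: borel_measurable_induct)
  case (cong f g)
  then show ?case by simp
next
  case (set A)
  then obtain T where T: "T \<in> sets N" "A = X -` T \<inter> \<Omega>" using sets_vimage_algebra2[OF X] by auto
  then show ?case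
    by (intro bexI[of _ "indicator T"]) (auto simp: indicator_def)
next
  case (mult u c)
  then obtain g where "g \<in> borel_measurable N" "\<forall>\<omega>\<in>\<Omega>. u \<omega> = g (X \<omega>)" by blast
  then show ?case by (intro bexI[of _ "\<lambda>x. c * g x"]) auto
next
  case (add u v)
  then obtain g g' where "g \<in> borel_measurable N" "\<forall>\<omega>\<in>\<Omega>. u \<omega> = g (X \<omega>)"
    "g' \<in> borel_measurable N" "\<forall>\<omega>\<in>\<Omega>. v \<omega> = g' (X \<omega>)" by blast
  then show ?case by (intro bexI[of _ "\<lambda>x. g' x + g x"]) auto
next
  case (seq U)
  then have "\<forall>i. \<exists>g. g \<in> borel_measurable N \<and> (\<forall>\<omega>\<in>\<Omega>. U i \<omega> = g (X \<omega>))" by blast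
  then obtain g where g: "\<And>i. g i \<in> borel_measurable N" "\<And>i \<omega>. \<omega> \<in> \<Omega> \<Longrightarrow> U i \<omega> = g i (X \<omega>)" by metis
  then show ?case by (intro bexI[of _ "\<lambda>x. SUP i. g i x"]) (auto simp: image_comp SUP_apply)
qed

section \<open>Laws of random measures\<close>

lemma measurable_measure_algebraI:
  assumes "\<And>\<omega>. \<omega> \<in> space M \<Longrightarrow> sets (f \<omega>) = sets N"
    and "\<And>A. A \<in> sets N \<Longrightarrow> (\<lambda>\<omega>. emeasure (f \<omega>) A) \<in> borel_measurable M"
  shows "f \<in> measurable M (measure_algebra N)"
  unfolding measure_algebra_def
proof (rule measurable_Sup2)
  show "(\<lambda>A. vimage_algebra {M. sets M = sets N} (\<lambda>M. emeasure M A) borel) ` sets N \<noteq> {}" by auto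
qed (use assms in \<open>auto intro!: measurable_vimage_algebra2\<close>)

text \<open>A measure is encoded by the family \<open>\<Psi>\<close> of its values. The evaluations
  generate the sigma-algebra, so each of its sets is a preimage under \<open>\<Psi>\<close> of a set
  in the product, where cylinders determine the law.\<close>

lemma (in prob_space) distr_measure_algebra_eqI:
  assumes f: "f \<in> measurable M (measure_algebra N)" and g: "g \<in> measurable M (measure_algebra N)"
    and eq: "\<And>I C. finite I \<Longrightarrow> I \<subseteq> sets N \<Longrightarrow> (\<And>A. A \<in> I \<Longrightarrow> C A \<in> sets borel) \<Longrightarrow>
      emeasure M {\<omega> \<in> space M. \<forall>A\<in>I. emeasure (f \<omega>) A \<in> C A} = emeasure M {\<omega> \<in> space M. \<forall>A\<in>I. emeasure (g \<omega>) A \<in> C A}"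
  shows "distr M (measure_algebra N) f = distr M (measure_algebra N) g"
proof -
  let ?\<Omega> = "{L. sets L = sets N}" and ?Q = "PiM (sets N) (\<lambda>_. borel :: ennreal measure)"
  define \<Psi> where "\<Psi> L = (\<lambda>A\<in>sets N. emeasure L A)" for L :: "'b measure"
  have \<Psi>: "\<Psi> \<in> ?\<Omega> \<rightarrow> space ?Q" by (auto simp: \<Psi>_def space_PiM)
  let ?V = "vimage_algebra ?\<Omega> \<Psi> ?Q"
  have idm: "(\<lambda>L. L) \<in> measurable ?V (measure_algebra N)"
  proof (rule measurable_measure_algebraI)
    fix A assume A: "A \<in> sets N"
    have "(\<lambda>L. \<Psi> L A) \<in> borel_measurable ?V"
      using measurable_compose[OF measurable_vimage_algebra1[OF \<Psi>] measurable_component_singleton[OF A]] by simp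
    then show "(\<lambda>L. emeasure L A) \<in> borel_measurable ?V" using A by (simp add: \<Psi>_def)
  qed simp
  have vim: "\<exists>T\<in>sets ?Q. S = \<Psi> -` T \<inter> ?\<Omega>" if "S \<in> sets (measure_algebra N)" for S
    using measurable_sets[OF idm that] sets.sets_into_space[OF that]
    by (auto simp: sets_vimage_algebra2[OF \<Psi>] space_measure_algebra Int_absorb2)
  have \<Psi>m: "(\<lambda>\<omega>. \<Psi> (u \<omega>)) \<in> measurable M ?Q" if u: "u \<in> measurable M (measure_algebra N)" for u
    unfolding \<Psi>_def
    by (rule measurable_restrict) (rule measurable_compose[OF u measurable_emeasure_measure_algebra])
  have Q: "distr M ?Q (\<lambda>\<omega>. \<Psi> (f \<omega>)) = distr M ?Q (\<lambda>\<omega>. \<Psi> (g \<omega>))"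
  proof (rule measure_eqI_PiM_infinite[where I = "sets N" and M = "\<lambda>_. borel"])
    fix C I assume I: "finite I" "I \<subseteq> sets N" and C: "\<And>A. A \<in> I \<Longrightarrow> C A \<in> sets (borel :: ennreal measure)"
    let ?S = "prod_emb (sets N) (\<lambda>_. borel) I (Pi\<^sub>E I C)"
    have S: "?S \<in> sets ?Q" using I C by (intro sets_PiM_I) auto
    have "emeasure (distr M ?Q (\<lambda>\<omega>. \<Psi> (u \<omega>))) ?S = emeasure M {\<omega> \<in> space M. \<forall>A\<in>I. emeasure (u \<omega>) A \<in> C A}"
      if u: "u \<in> measurable M (measure_algebra N)" for u
    proof -
      have "(\<lambda>\<omega>. \<Psi> (u \<omega>)) -` ?S \<inter> space M = {\<omega> \<in> space M. \<forall>A\<in>I. emeasure (u \<omega>) A \<in> C A}"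
        using I(2) by (auto simp: \<Psi>_def prod_emb_iff PiE_iff subset_iff)
      then show ?thesis using emeasure_distr[OF \<Psi>m[OF u] S] by simp
    qed
    then show "emeasure (distr M ?Q (\<lambda>\<omega>. \<Psi> (f \<omega>))) ?S = emeasure (distr M ?Q (\<lambda>\<omega>. \<Psi> (g \<omega>))) ?S"
      using f g eq[OF I C] by simp
  next
    show "finite_measure (distr M ?Q (\<lambda>\<omega>. \<Psi> (f \<omega>)))"
      using prob_space_distr[OF \<Psi>m[OF f]] by (simp add: prob_space_def)
  qed simp_all
  show ?thesis
  proof (rule measure_eqI)
    fix S assume "S \<in> sets (distr M (measure_algebra N) f)"
    then have S: "S \<in> sets (measure_algebra N)" by simp
    then obtain T where T: "T \<in> sets ?Q" "S = \<Psi> -` T \<inter> ?\<Omega>" using vim by blast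
    have "emeasure (distr M (measure_algebra N) u) S = emeasure (distr M ?Q (\<lambda>\<omega>. \<Psi> (u \<omega>))) T"
      if u: "u \<in> measurable M (measure_algebra N)" for u
    proof -
      have "u -` S \<inter> space M = (\<lambda>\<omega>. \<Psi> (u \<omega>)) -` T \<inter> space M"
        using measurable_space[OF u] by (auto simp: T space_measure_algebra)
      then show ?thesis using u S T \<Psi>m[OF u] by (simp add: emeasure_distr)
    qed
    then show "emeasure (distr M (measure_algebra N) f) S = emeasure (distr M (measure_algebra N) g) S"
      using f g Q by simp
  qed simp
qed

lemma cutoff_ge: "l \<le> fgff_cutoff l"
proof -
  have "2 * l + 3 \<le> 3 ^ (l + 1)" by (induction l) auto
  then show ?thesis unfolding fgff_cutoff_def by simp
qed

section \<open>The field as a random sequence and the law of its reflection\<close>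

locale sierpinski_lqg = sierpinski_completion p K \<mu> lam \<phi> q \<epsilon> J + P: prob_space P
  for p K \<mu> lam \<phi> q \<epsilon> and J :: "(real^2 \<Rightarrow> real) \<Rightarrow> 'b::{banach, second_countable_topology}"
    and P :: "'w measure" +
  fixes \<xi> :: "nat \<Rightarrow> 'w \<Rightarrow> real" and h :: "'w \<Rightarrow> 'b" and \<nu> :: "'w \<Rightarrow> (real^2) measure" and \<gamma> :: real
    and i :: 3
  assumes normal: "iid_std_normal P \<xi>" and fgff: "is_fgff P lam \<phi> \<xi> J h"
    and lqg: "is_lqg_measure K \<mu> (riesz_kernel q d_S) J P h \<gamma> \<nu>"
begin

definition X :: "'w \<Rightarrow> nat \<Rightarrow> real" where
  "X \<omega> j = coord j (h \<omega>)"

abbreviation scale :: "nat \<Rightarrow> real" where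
  "scale j \<equiv> lam j powr (- d_S / 4)"

lemma h_measurable [measurable]: "h \<in> borel_measurable P"
  using fgff by (simp add: is_fgff_def)

lemma X_component [measurable]: "(\<lambda>\<omega>. X \<omega> j) \<in> borel_measurable P"
  unfolding X_def by measurable

lemma X_measurable [measurable]: "X \<in> measurable P seq_space"
proof -
  have "(\<lambda>\<omega> j. X \<omega> j) \<in> measurable P seq_space"
    by (intro measurable_PiM_single') auto
  then show ?thesis by simp
qed

lemma xi_measurable [measurable]: "\<xi> j \<in> borel_measurable P"
  using normal distributed_measurable unfolding iid_std_normal_def by (metis measurable_lborel1)

lemma X_AE: "AE \<omega> in P. \<forall>j. X \<omega> j = scale j * \<xi> j \<omega>"
proof -
  have "AE \<omega> in P. (\<lambda>l. J (fgff_level lam \<phi> \<xi> l \<omega>)) \<longlonglongrightarrow> h \<omega>"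
    using fgff by (simp add: is_fgff_def)
  then show ?thesis
  proof eventually_elim
    case (elim \<omega>)
    show ?case
    proof
      fix j
      \<comment> \<open>The cutoff is at least l > j, so coordinate \<open>j\<close> no longer
        changes with the level; the limit is that of an eventually constant sequence.\<close>
      have level: "coord j (J (fgff_level lam \<phi> \<xi> l \<omega>)) = scale j * \<xi> j \<omega>" if l: "Suc j \<le> l" for l
      proof -
        let ?c = "\<lambda>k. \<xi> k \<omega> * scale k"
        have eq: "fgff_level lam \<phi> \<xi> l \<omega> = (\<lambda>x. \<Sum>k<fgff_cutoff l. ?c k * \<phi> k x)"
          by (simp add: fgff_level_def fun_eq_iff)
        have "coord j (J (fgff_level lam \<phi> \<xi> l \<omega>)) = (\<Sum>k<fgff_cutoff l. ?c k * (if k = j then 1 else 0))"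
          unfolding eq coord_J[OF L2_sum[OF phi_L2]] L2_inner_sum[OF phi_L2 phi_L2] phi_orthonormal ..
        also have "\<dots> = (\<Sum>k<fgff_cutoff l. if k = j then ?c k else 0)" by (intro sum.cong) auto
        also have "\<dots> = ?c j" using l cutoff_ge[of l] by (subst sum.delta) auto
        finally show ?thesis by (simp add: mult.commute)
      qed
      have "(\<lambda>l. coord j (J (fgff_level lam \<phi> \<xi> l \<omega>))) \<longlonglongrightarrow> coord j (h \<omega>)"
        using elim by (rule coord_tendsto)
      moreover have "(\<lambda>l. coord j (J (fgff_level lam \<phi> \<xi> l \<omega>))) \<longlonglongrightarrow> scale j * \<xi> j \<omega>"
        using level by (intro tendsto_eventually eventually_sequentiallyI[of "Suc j"])
      ultimately show "X \<omega> j = scale j * \<xi> j \<omega>" unfolding X_def by (rule LIMSEQ_unique)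
    qed
  qed
qed

text \<open>The reflection as it acts on coefficients. Restricting the sum to one eigenvalue makes
  it finite, hence defined and measurable on all sequences without any convergence.\<close>

definition refl_seq :: "(nat \<Rightarrow> real) \<Rightarrow> nat \<Rightarrow> real" where
  "refl_seq c j = (\<Sum>m | lam m = lam j. refl_coeff i j m * c m)"

lemma seq_component [measurable]: "(\<lambda>c. c j) \<in> borel_measurable seq_space"
  by (rule measurable_component_singleton) simp

lemma refl_seq_measurable [measurable]: "refl_seq \<in> measurable seq_space seq_space"
proof -
  have "(\<lambda>c. refl_seq c j) \<in> borel_measurable seq_space" for j
    unfolding refl_seq_def by measurable
  then have "(\<lambda>c j. refl_seq c j) \<in> measurable seq_space seq_space"
    by (intro measurable_PiM_single') auto
  then show ?thesis by simp
qed

text \<open>A symmetric orthogonal matrix is its own inverse, block by block.\<close>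

lemma refl_seq_involution: "refl_seq (refl_seq c) = c"
proof
  fix j
  let ?I = "{m. lam m = lam j}"
  have "refl_seq (refl_seq c) j = (\<Sum>m\<in>?I. \<Sum>l\<in>?I. refl_coeff i j m * (refl_coeff i m l * c l))"
    unfolding refl_seq_def sum_distrib_left by (intro sum.cong refl) auto
  also have "\<dots> = (\<Sum>l\<in>?I. (\<Sum>m\<in>?I. refl_coeff i j m * refl_coeff i l m) * c l)"
    by (subst sum.swap) (simp add: sum_distrib_right mult.assoc refl_coeff_sym[of i _ "_ :: nat"] cong: sum.cong)
  also have "\<dots> = (\<Sum>l\<in>?I. if l = j then c l else 0)"
    unfolding refl_coeff_orthogonal by (intro sum.cong) auto
  also have "\<dots> = c j" using finite_multiplicity[of "lam j"] by simp
  finally show "refl_seq (refl_seq c) j = c j" .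
qed

text \<open>The coordinates of the field are independent Gaussians with variances constant on the
  blocks of the orthogonal involution, so both vectors have the same characteristic functions.\<close>
lemma refl_seq_law: "distr P seq_space (\<lambda>\<omega>. refl_seq (X \<omega>)) = distr P seq_space X"
proof -
  have RX: "(\<lambda>\<omega>. refl_seq (X \<omega>) j) \<in> borel_measurable P" for j
    unfolding refl_seq_def by measurable
  have "distr P seq_space (\<lambda>\<omega> j. refl_seq (X \<omega>) j) = distr P seq_space (\<lambda>\<omega> j. X \<omega> j)"
  proof (rule P.distr_eq_if_char_eq[OF RX X_component])
    fix I :: "nat set" and t :: "nat \<Rightarrow> real" assume I: "finite I"
    \<comment> \<open>All blocks that meet \<open>I\<close>: after the reflection the linear
      combination still involves only finitely many of the Gaussians.\<close>
    define U where "U = (\<Union>j\<in>I. {m. lam m = lam j})"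
    have U: "finite U" unfolding U_def using I by simp
    define s where "s j = t j * scale j" for j
    define c where "c m = (\<Sum>j\<in>I. s j * refl_coeff i j m)" for m
    have "AE \<omega> in P. (\<Sum>j\<in>I. t j * X \<omega> j) = (\<Sum>j\<in>I. s j * \<xi> j \<omega>)"
      using X_AE by eventually_elim (simp add: s_def mult.assoc)
    then have "distr P borel (\<lambda>\<omega>. \<Sum>j\<in>I. t j * X \<omega> j) = distr P borel (\<lambda>\<omega>. \<Sum>j\<in>I. s j * \<xi> j \<omega>)"
      by (intro distr_cong_AE refl) measurable
    then have 1: "char (distr P borel (\<lambda>\<omega>. \<Sum>j\<in>I. t j * X \<omega> j)) 1 = of_real (exp (- (\<Sum>j\<in>I. (s j)\<^sup>2) / 2))"
      using P.char_normal_combination[OF normal I] by simp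
    have block: "(\<Sum>m | lam m = lam j. refl_coeff i j m * f m) = (\<Sum>m\<in>U. refl_coeff i j m * f m)" if "j \<in> I" for j f
      using U that refl_coeff_zero[of j _ i] by (intro sum.mono_neutral_left) (auto simp: U_def)
    have "AE \<omega> in P. (\<Sum>j\<in>I. t j * refl_seq (X \<omega>) j) = (\<Sum>m\<in>U. c m * \<xi> m \<omega>)"
      using X_AE
    proof eventually_elim
      case (elim \<omega>)
      have "t j * refl_seq (X \<omega>) j = (\<Sum>m\<in>U. s j * refl_coeff i j m * \<xi> m \<omega>)" if j: "j \<in> I" for j
      proof -
        \<comment> \<open>Within a block \<open>lam m = lam j\<close>, so the standard deviation
          \<open>scale m\<close> can be replaced by \<open>scale j\<close> and taken out of the
          sum.\<close>
        have "refl_seq (X \<omega>) j = (\<Sum>m | lam m = lam j. refl_coeff i j m * (scale j * \<xi> m \<omega>))"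
          unfolding refl_seq_def using elim by (intro sum.cong) auto
        then show ?thesis unfolding block[OF j] s_def by (simp add: sum_distrib_left mult_ac)
      qed
      then have "(\<Sum>j\<in>I. t j * refl_seq (X \<omega>) j) = (\<Sum>j\<in>I. \<Sum>m\<in>U. s j * refl_coeff i j m * \<xi> m \<omega>)" by simp
      also have "\<dots> = (\<Sum>m\<in>U. c m * \<xi> m \<omega>)" unfolding c_def sum_distrib_right by (rule sum.swap)
      finally show ?case .
    qed
    then have "distr P borel (\<lambda>\<omega>. \<Sum>j\<in>I. t j * refl_seq (X \<omega>) j) = distr P borel (\<lambda>\<omega>. \<Sum>m\<in>U. c m * \<xi> m \<omega>)"
      using RX by (intro distr_cong_AE refl) measurable
    then have 2: "char (distr P borel (\<lambda>\<omega>. \<Sum>j\<in>I. t j * refl_seq (X \<omega>) j)) 1 = of_real (exp (- (\<Sum>m\<in>U. (c m)\<^sup>2) / 2))"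
      using P.char_normal_combination[OF normal U] by simp
    have "(\<Sum>m\<in>U. (c m)\<^sup>2) = (\<Sum>m\<in>U. \<Sum>j\<in>I. \<Sum>l\<in>I. s j * s l * (refl_coeff i j m * refl_coeff i l m))"
      unfolding c_def power2_eq_square sum_product by (simp add: mult_ac)
    also have "\<dots> = (\<Sum>j\<in>I. \<Sum>m\<in>U. \<Sum>l\<in>I. s j * s l * (refl_coeff i j m * refl_coeff i l m))"
      by (rule sum.swap)
    also have "\<dots> = (\<Sum>j\<in>I. \<Sum>l\<in>I. \<Sum>m\<in>U. s j * s l * (refl_coeff i j m * refl_coeff i l m))"
      by (intro sum.cong refl sum.swap)
    also have "\<dots> = (\<Sum>j\<in>I. \<Sum>l\<in>I. if l = j then s j * s l else 0)"
    proof (intro sum.cong refl)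
      fix j l assume j: "j \<in> I"
      have "(\<Sum>m\<in>U. s j * s l * (refl_coeff i j m * refl_coeff i l m)) = s j * s l * (\<Sum>m\<in>U. refl_coeff i j m * refl_coeff i l m)"
        by (simp add: sum_distrib_left)
      also have "(\<Sum>m\<in>U. refl_coeff i j m * refl_coeff i l m) = (if j = l then 1 else 0)"
        unfolding block[OF j, symmetric] by (rule refl_coeff_orthogonal)
      finally show "(\<Sum>m\<in>U. s j * s l * (refl_coeff i j m * refl_coeff i l m)) = (if l = j then s j * s l else 0)"
        by simp
    qed
    also have "\<dots> = (\<Sum>j\<in>I. (s j)\<^sup>2)" using I by (simp add: power2_eq_square)
    finally show "char (distr P borel (\<lambda>\<omega>. \<Sum>j\<in>I. t j * refl_seq (X \<omega>) j)) 1 = char (distr P borel (\<lambda>\<omega>. \<Sum>j\<in>I. t j * X \<omega> j)) 1"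
      unfolding 1 2 by simp
  qed
  then show ?thesis by simp
qed

section \<open>The characterizing identity in coordinates\<close>

definition shift :: "(nat \<Rightarrow> real) \<Rightarrow> real^2 \<Rightarrow> nat \<Rightarrow> real" where
  "shift c x j = c j + \<gamma> * \<kappa> x j"

lemma refl_seq_shift: "x \<in> K \<Longrightarrow> refl_seq (shift c x) = shift (refl_seq c) (sg_reflection p i x)"
  by (rule ext) (simp add: refl_seq_def shift_def kappa_reflection distrib_left sum.distrib sum_distrib_left mult_ac)

lemma shift_measurable: "(\<lambda>(c, x). shift c x) \<in> measurable (seq_space \<Otimes>\<^sub>M \<mu>) seq_space"
proof -
  note kappa_measurable[measurable]
  have "(\<lambda>z. shift (fst z) (snd z) j) \<in> borel_measurable (seq_space \<Otimes>\<^sub>M \<mu>)" for j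
    unfolding shift_def by measurable
  then have "(\<lambda>z j. shift (fst z) (snd z) j) \<in> measurable (seq_space \<Otimes>\<^sub>M \<mu>) seq_space"
    by (intro measurable_PiM_single') auto
  then show ?thesis by (simp add: case_prod_unfold)
qed

text \<open>The integral over \<mu> on the right-hand side of the characterizing identity, when the
  test function asks for coordinates in \<open>B\<close> and a point in \<open>A\<close>.\<close>

definition \<Phi> :: "(nat \<Rightarrow> real) set \<Rightarrow> (real^2) set \<Rightarrow> (nat \<Rightarrow> real) \<Rightarrow> ennreal" where
  "\<Phi> B A c = (\<integral>\<^sup>+x. indicator B (shift c x) * indicator A x \<partial>\<mu>)"

lemma Phi_integrand_measurable:
  assumes [measurable]: "B \<in> sets seq_space" "A \<in> sets \<mu>"
  shows "(\<lambda>(c, x). indicator B (shift c x) * indicator A x :: ennreal) \<in> borel_measurable (seq_space \<Otimes>\<^sub>M \<mu>)"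
proof -
  have "(\<lambda>z. indicator B ((\<lambda>(c, x). shift c x) z) :: ennreal) \<in> borel_measurable (seq_space \<Otimes>\<^sub>M \<mu>)"
    by (rule measurable_compose[OF shift_measurable]) simp
  moreover have "(\<lambda>z. indicator A (snd z) :: ennreal) \<in> borel_measurable (seq_space \<Otimes>\<^sub>M \<mu>)" by measurable
  ultimately show ?thesis by (simp add: case_prod_unfold)
qed

lemma Phi_measurable:
  assumes "B \<in> sets seq_space" "A \<in> sets \<mu>"
  shows "\<Phi> B A \<in> borel_measurable seq_space"
  using borel_measurable_nn_integral[OF Phi_integrand_measurable[OF assms]] unfolding \<Phi>_def[abs_def] .

lemma Phi_reflection:
  assumes B: "B \<in> sets seq_space" and A: "A \<in> sets \<mu>"
  shows "\<Phi> (refl_seq -` B) (sg_reflection p i -` A) c = \<Phi> B A (refl_seq c)"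
proof -
  have "\<Phi> (refl_seq -` B) (sg_reflection p i -` A) c
    = (\<integral>\<^sup>+x. (\<lambda>x. indicator B (shift (refl_seq c) x) * indicator A x) (sg_reflection p i x) \<partial>\<mu>)"
    unfolding \<Phi>_def by (intro nn_integral_cong) (simp add: indicator_def refl_seq_shift)
  also have "\<dots> = (\<integral>\<^sup>+x. indicator B (shift (refl_seq c) x) * indicator A x \<partial>\<mu>)"
    using measurable_compose[OF measurable_Pair1'[of "refl_seq c" seq_space \<mu>] Phi_integrand_measurable[OF B A]]
    by (intro nn_integral_reflection) (simp add: space_PiM)
  finally show ?thesis by (simp add: \<Phi>_def)
qed

lemma nu_sets: "\<omega> \<in> space P \<Longrightarrow> sets (\<nu> \<omega>) = sets (borel_on K)"
  using lqg measurable_space[of \<nu> "vimage_algebra (space P) h borel" "measure_algebra (borel_on K)" \<omega>]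
  by (auto simp: is_lqg_measure_def space_measure_algebra)

text \<open>The measure is measurable with respect to the field, and by
  \<open>borel_sets_coords\<close> the field with respect to its coordinates;
  \<open>Doob_Dynkin_ennreal\<close> turns this into a function of \<open>X\<close>.\<close>

lemma nu_factor:
  assumes A: "A \<in> sets \<mu>"
  shows "\<exists>g\<in>borel_measurable seq_space. \<forall>\<omega>\<in>space P. emeasure (\<nu> \<omega>) A = g (X \<omega>)"
proof (rule Doob_Dynkin_ennreal)
  show X: "X \<in> space P \<rightarrow> space seq_space" by (simp add: space_PiM)
  have m: "(\<lambda>\<omega>. emeasure (\<nu> \<omega>) A) \<in> borel_measurable (vimage_algebra (space P) h borel)"
    using lqg A measurable_compose[OF _ measurable_emeasure_measure_algebra]
    unfolding is_lqg_measure_def sets_mu by blast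
  have h: "h \<in> measurable (vimage_algebra (space P) X seq_space) borel"
  proof (rule measurableI)
    fix S :: "'b set" assume "S \<in> sets borel"
    then obtain T where T: "T \<in> sets seq_space" "S = (\<lambda>b j. coord j b) -` T" using borel_sets_coords by blast
    have "h -` S \<inter> space P = X -` T \<inter> space P" by (auto simp: T X_def[abs_def])
    then show "h -` S \<inter> space (vimage_algebra (space P) X seq_space) \<in> sets (vimage_algebra (space P) X seq_space)"
      using T(1) by (auto simp: sets_vimage_algebra2[OF X])
  qed simp
  have "(\<lambda>\<omega>. \<omega>) \<in> measurable (vimage_algebra (space P) X seq_space) (vimage_algebra (space P) h borel)"
    using h by (intro measurable_vimage_algebra2) auto
  from measurable_compose[OF this m]
  show "(\<lambda>\<omega>. emeasure (\<nu> \<omega>) A) \<in> borel_measurable (vimage_algebra (space P) X seq_space)" .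
qed

lemma lqg_identity:
  assumes B: "B \<in> sets seq_space" and A: "A \<in> sets \<mu>"
  shows "(\<integral>\<^sup>+\<omega>. indicator B (X \<omega>) * emeasure (\<nu> \<omega>) A \<partial>P) = (\<integral>\<^sup>+\<omega>. \<Phi> B A (X \<omega>) \<partial>P)"
proof -
  let ?F = "\<lambda>(b, x). indicator B (\<lambda>j. coord j b) * indicator A x :: ennreal"
  have A': "A \<in> sets (borel_on K)" using A by (simp add: sets_mu)
  have "(\<lambda>z. indicator B (\<lambda>j. coord j (fst z)) :: ennreal) \<in> borel_measurable (borel \<Otimes>\<^sub>M borel_on K)"
    by (rule measurable_compose[OF measurable_compose[OF measurable_fst coords_measurable]])
      (rule borel_measurable_indicator[OF B])
  moreover have "(\<lambda>z. indicator A (snd z) :: ennreal) \<in> borel_measurable (borel \<Otimes>\<^sub>M borel_on K)"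
    by (rule measurable_compose[OF measurable_snd borel_measurable_indicator[OF A']])
  ultimately have "(\<lambda>z. indicator B (\<lambda>j. coord j (fst z)) * indicator A (snd z) :: ennreal) \<in> borel_measurable (borel \<Otimes>\<^sub>M borel_on K)"
    by (rule borel_measurable_times_ennreal)
  then have F: "?F \<in> borel_measurable (borel \<Otimes>\<^sub>M borel_on K)" by (simp add: case_prod_unfold)
  have "(\<integral>\<^sup>+\<omega>. indicator B (X \<omega>) * emeasure (\<nu> \<omega>) A \<partial>P) = (\<integral>\<^sup>+\<omega>. (\<integral>\<^sup>+x. ?F (h \<omega>, x) \<partial>(\<nu> \<omega>)) \<partial>P)"
  proof (intro nn_integral_cong)
    fix \<omega> assume "\<omega> \<in> space P"
    then have "A \<in> sets (\<nu> \<omega>)" using A' nu_sets by simp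
    from nn_integral_cmult_indicator[OF this, of "indicator B (X \<omega>)"]
    show "indicator B (X \<omega>) * emeasure (\<nu> \<omega>) A = (\<integral>\<^sup>+x. ?F (h \<omega>, x) \<partial>(\<nu> \<omega>))"
      unfolding X_def[abs_def] prod.case by (rule sym)
  qed
  also have "\<dots> = (\<integral>\<^sup>+\<omega>. (\<integral>\<^sup>+x. ?F (h \<omega> + \<gamma> *\<^sub>R J (k x), x) \<partial>\<mu>) \<partial>P)"
    using lqg F unfolding is_lqg_measure_def by blast
  also have "\<dots> = (\<integral>\<^sup>+\<omega>. \<Phi> B A (X \<omega>) \<partial>P)"
    unfolding \<Phi>_def
  proof (intro nn_integral_cong)
    fix \<omega> x assume "x \<in> space \<mu>"
    then have x: "k x \<in> L2 \<mu>" by (simp add: k_L2)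
    have "\<gamma> *\<^sub>R J (k x) = J (\<lambda>y. \<gamma> * k x y)" using J_linear[OF x x, of \<gamma> 0] by simp
    then have "coord j (h \<omega> + \<gamma> *\<^sub>R J (k x)) = shift (X \<omega>) x j" for j
      by (simp add: coord_add coord_J L2_scale x L2_inner_scale shift_def X_def \<kappa>_def)
    then show "?F (h \<omega> + \<gamma> *\<^sub>R J (k x), x) = indicator B (shift (X \<omega>) x) * indicator A x"
      by (simp add: shift_def[abs_def])
  qed
  finally show ?thesis .
qed

section \<open>Invariance of the law of the random measure\<close>

abbreviation \<rho> :: "(nat \<Rightarrow> real) measure" where
  "\<rho> \<equiv> distr P seq_space X"

lemma rho_refl: "distr \<rho> seq_space refl_seq = \<rho>"
  using refl_seq_law by (simp add: distr_distr comp_def)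

lemma rho_refl_nn: "f \<in> borel_measurable seq_space \<Longrightarrow> (\<integral>\<^sup>+c. f (refl_seq c) \<partial>\<rho>) = (\<integral>\<^sup>+c. f c \<partial>\<rho>)"
  using nn_integral_distr[of refl_seq \<rho> seq_space f] by (simp add: rho_refl)

text \<open>The preimage is taken in the whole plane, but invariance of \<open>K\<close> and the
  involution place it inside \<open>K\<close>.\<close>

lemma reflection_vimage_sets:
  assumes "A \<in> sets \<mu>" shows "sg_reflection p i -` A \<in> sets \<mu>"
proof -
  have "sg_reflection p i -` A \<subseteq> K"
  proof
    fix x assume "x \<in> sg_reflection p i -` A"
    then have "sg_reflection p i x \<in> K" using assms by (auto simp: sets_mu_iff)
    then show "x \<in> K" using reflection_K[of "sg_reflection p i x" i] by (simp add: reflection_involution[OF tri])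
  qed
  then show ?thesis using measurable_sets[OF reflection_measurable assms, of i] by (simp add: Int_absorb2)
qed

text \<open>Both functions are densities, with respect to the law of the field, of one and the same
  finite measure \<open>B \<mapsto> E (1 (X \<in> B) \<nu>(A))\<close>.\<close>
lemma density_reflection:
  assumes A: "A \<in> sets \<mu>"
    and g [measurable]: "g \<in> borel_measurable seq_space" and gX: "\<And>\<omega>. \<omega> \<in> space P \<Longrightarrow> emeasure (\<nu> \<omega>) A = g (X \<omega>)"
    and g' [measurable]: "g' \<in> borel_measurable seq_space"
    and gX': "\<And>\<omega>. \<omega> \<in> space P \<Longrightarrow> emeasure (\<nu> \<omega>) (sg_reflection p i -` A) = g' (X \<omega>)"
  shows "AE c in \<rho>. g c = g' (refl_seq c)"
proof -
  have id: "(\<integral>\<^sup>+c. indicator B c * f c \<partial>\<rho>) = (\<integral>\<^sup>+c. \<Phi> B A' c \<partial>\<rho>)"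
    if B: "B \<in> sets seq_space" and A': "A' \<in> sets \<mu>" and f: "f \<in> borel_measurable seq_space"
      and fX: "\<And>\<omega>. \<omega> \<in> space P \<Longrightarrow> emeasure (\<nu> \<omega>) A' = f (X \<omega>)" for B A' f
  proof -
    have "(\<integral>\<^sup>+c. indicator B c * f c \<partial>\<rho>) = (\<integral>\<^sup>+\<omega>. indicator B (X \<omega>) * f (X \<omega>) \<partial>P)"
      using B f by (subst nn_integral_distr) auto
    also have "\<dots> = (\<integral>\<^sup>+\<omega>. indicator B (X \<omega>) * emeasure (\<nu> \<omega>) A' \<partial>P)"
      using fX by (intro nn_integral_cong) auto
    also have "\<dots> = (\<integral>\<^sup>+\<omega>. \<Phi> B A' (X \<omega>) \<partial>P)" by (rule lqg_identity[OF B A'])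
    also have "\<dots> = (\<integral>\<^sup>+c. \<Phi> B A' c \<partial>\<rho>)"
      using Phi_measurable[OF B A'] by (subst nn_integral_distr) auto
    finally show ?thesis .
  qed
  let ?s = "sg_reflection p i"
  \<comment> \<open>Replacing \<open>c\<close> by \<open>refl_seq c\<close> under the invariant law
    \<rho> moves the reflection from \<open>g'\<close> onto \<open>B\<close>. The identity for the
    reflected sets then applies, and \<open>Phi_reflection\<close> with the invariance of \<rho>
    removes both reflections.\<close>
  have dens: "(\<integral>\<^sup>+c. g' (refl_seq c) * indicator B c \<partial>\<rho>) = (\<integral>\<^sup>+c. g c * indicator B c \<partial>\<rho>)"
    if B: "B \<in> sets seq_space" for B
  proof -
    have B': "refl_seq -` B \<in> sets seq_space" using measurable_sets[OF refl_seq_measurable B] by (simp add: space_PiM)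
    have "(\<integral>\<^sup>+c. g' (refl_seq c) * indicator B c \<partial>\<rho>) = (\<integral>\<^sup>+c. g' (refl_seq (refl_seq c)) * indicator B (refl_seq c) \<partial>\<rho>)"
    proof (rule rho_refl_nn[symmetric])
      note B[measurable]
      show "(\<lambda>c. g' (refl_seq c) * indicator B c) \<in> borel_measurable seq_space" by measurable
    qed
    also have "\<dots> = (\<integral>\<^sup>+c. indicator (refl_seq -` B) c * g' c \<partial>\<rho>)"
      unfolding refl_seq_involution by (intro nn_integral_cong) (simp add: indicator_def)
    also have "\<dots> = (\<integral>\<^sup>+c. \<Phi> (refl_seq -` B) (?s -` A) c \<partial>\<rho>)"
      by (rule id[OF B' reflection_vimage_sets[OF A] g' gX'])
    also have "\<dots> = (\<integral>\<^sup>+c. \<Phi> B A (refl_seq c) \<partial>\<rho>)" unfolding Phi_reflection[OF B A] ..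
    also have "\<dots> = (\<integral>\<^sup>+c. \<Phi> B A c \<partial>\<rho>)" by (rule rho_refl_nn[OF Phi_measurable[OF B A]])
    also have "\<dots> = (\<integral>\<^sup>+c. indicator B c * g c \<partial>\<rho>)" by (rule id[OF B A g gX, symmetric])
    finally show ?thesis by (simp add: mult.commute)
  qed
  have rg: "(\<lambda>c. g' (refl_seq c)) \<in> borel_measurable \<rho>" "g \<in> borel_measurable \<rho>" by measurable
  have "density \<rho> g = density \<rho> (\<lambda>c. g' (refl_seq c))"
  proof (rule measure_eqI)
    fix B assume "B \<in> sets (density \<rho> g)"
    then have B: "B \<in> sets seq_space" by simp
    then show "emeasure (density \<rho> g) B = emeasure (density \<rho> (\<lambda>c. g' (refl_seq c))) B"
      using rg dens[OF B] by (simp add: emeasure_density)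
  qed simp
  \<comment> \<open>Uniqueness of densities needs finiteness. For \<open>B\<close> = UNIV the
    identity shows that \<nu>(A) has mean \<mu>(A).\<close>
  moreover have "(\<integral>\<^sup>+c. g c \<partial>\<rho>) \<noteq> \<infinity>"
  proof -
    have S: "UNIV \<in> sets seq_space" using sets.top[of seq_space] by (simp add: space_PiM)
    have "(\<integral>\<^sup>+c. g c \<partial>\<rho>) = (\<integral>\<^sup>+c. indicator UNIV c * g c \<partial>\<rho>)" by simp
    also have "\<dots> = (\<integral>\<^sup>+c. \<Phi> UNIV A c \<partial>\<rho>)" by (rule id[OF S A g gX])
    also have "\<dots> = emeasure \<mu> A"
      using A prob_space.emeasure_space_1[OF P.prob_space_distr[OF X_measurable]] by (simp add: \<Phi>_def)
    finally show ?thesis by (simp add: emeasure_eq_measure)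
  qed
  ultimately show ?thesis using finite_density_unique[OF rg(2,1)] by simp
qed

text \<open>Since \<open>I\<close> is finite, the almost sure identities of
  \<open>density_reflection\<close> hold for all its members together. They make \<open>D\<close>
  the preimage of \<open>D'\<close> under \<open>refl_seq\<close> up to a null set, and the law of
  \<open>X\<close> is invariant under \<open>refl_seq\<close>.\<close>

lemma finite_dimensional_law:
  assumes I: "finite I" "I \<subseteq> sets \<mu>" and C: "\<And>A. A \<in> I \<Longrightarrow> C A \<in> sets borel"
  shows "emeasure P {\<omega> \<in> space P. \<forall>A\<in>I. emeasure (\<nu> \<omega>) A \<in> C A}
    = emeasure P {\<omega> \<in> space P. \<forall>A\<in>I. emeasure (\<nu> \<omega>) (sg_reflection p i -` A) \<in> C A}"
proof -
  let ?s = "sg_reflection p i"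
  have "\<forall>A\<in>sets \<mu>. \<exists>g. g \<in> borel_measurable seq_space \<and> (\<forall>\<omega>\<in>space P. emeasure (\<nu> \<omega>) A = g (X \<omega>))"
    using nu_factor by blast
  then obtain g where g: "\<And>A. A \<in> sets \<mu> \<Longrightarrow> g A \<in> borel_measurable seq_space"
    and gX: "\<And>A \<omega>. A \<in> sets \<mu> \<Longrightarrow> \<omega> \<in> space P \<Longrightarrow> emeasure (\<nu> \<omega>) A = g A (X \<omega>)"
    by metis
  have gXI: "emeasure (\<nu> \<omega>) A = g A (X \<omega>)" "emeasure (\<nu> \<omega>) (?s -` A) = g (?s -` A) (X \<omega>)"
    if "A \<in> I" "\<omega> \<in> space P" for A \<omega>
    using that I(2) by (auto intro!: gX reflection_vimage_sets)
  define D where "D = {c. \<forall>A\<in>I. g A c \<in> C A}"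
  define D' where "D' = {c. \<forall>A\<in>I. g (?s -` A) c \<in> C A}"
  have set: "{c. \<forall>A\<in>I. f A c \<in> C A} \<in> sets seq_space"
    if "\<And>A. A \<in> I \<Longrightarrow> f A \<in> borel_measurable seq_space" for f :: "(real^2) set \<Rightarrow> (nat \<Rightarrow> real) \<Rightarrow> ennreal"
  proof -
    have "{c \<in> space seq_space. \<forall>A\<in>I. f A c \<in> C A} \<in> sets seq_space"
      using I(1) that C by (intro sets.sets_Collect_finite_All) (auto intro: measurable_sets_Collect)
    then show ?thesis by (simp add: space_PiM)
  qed
  have D: "D \<in> sets seq_space" unfolding D_def using g I by (intro set) auto
  have D': "D' \<in> sets seq_space" unfolding D'_def using g I reflection_vimage_sets by (intro set) auto
  have "AE c in \<rho>. \<forall>A\<in>I. g A c = g (?s -` A) (refl_seq c)"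
  proof (rule AE_finite_allI[OF I(1)])
    fix A assume "A \<in> I"
    then have A: "A \<in> sets \<mu>" using I(2) by blast
    note A' = reflection_vimage_sets[OF A]
    show "AE c in \<rho>. g A c = g (?s -` A) (refl_seq c)"
      by (rule density_reflection[OF A g[OF A] gX[OF A] g[OF A'] gX[OF A']])
  qed
  then have AE: "AE c in \<rho>. c \<in> D \<longleftrightarrow> refl_seq c \<in> D'"
    by eventually_elim (auto simp: D_def D'_def)
  have "{\<omega> \<in> space P. \<forall>A\<in>I. emeasure (\<nu> \<omega>) A \<in> C A} = X -` D \<inter> space P"
    using gXI by (auto simp: D_def)
  then have "emeasure P {\<omega> \<in> space P. \<forall>A\<in>I. emeasure (\<nu> \<omega>) A \<in> C A} = emeasure \<rho> D"
    using D by (simp add: emeasure_distr)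
  also have "\<dots> = emeasure \<rho> (refl_seq -` D')"
    using AE D measurable_sets[OF refl_seq_measurable D'] by (intro emeasure_eq_AE) (auto simp: space_PiM)
  also have "\<dots> = emeasure (distr \<rho> seq_space refl_seq) D'"
    using D' by (simp add: emeasure_distr[of refl_seq] space_PiM)
  also have "\<dots> = emeasure \<rho> D'" unfolding rho_refl ..
  also have "\<dots> = emeasure P (X -` D' \<inter> space P)"
    using D' by (simp add: emeasure_distr)
  also have "X -` D' \<inter> space P = {\<omega> \<in> space P. \<forall>A\<in>I. emeasure (\<nu> \<omega>) (?s -` A) \<in> C A}"
    using gXI by (auto simp: D'_def)
  finally show ?thesis .
qed

theorem law_reflection_invariant:
  "distr P (measure_algebra (borel_on K)) \<nu>
    = distr P (measure_algebra (borel_on K)) (\<lambda>\<omega>. distr (\<nu> \<omega>) (borel_on K) (sg_reflection p i))"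
proof -
  let ?s = "sg_reflection p i"
  let ?N = "borel_on K"
  have em_meas: "(\<lambda>\<omega>. emeasure (\<nu> \<omega>) A) \<in> borel_measurable P" if A: "A \<in> sets \<mu>" for A
  proof -
    obtain g where "g \<in> borel_measurable seq_space" "\<forall>\<omega>\<in>space P. emeasure (\<nu> \<omega>) A = g (X \<omega>)"
      using nu_factor[OF A] by blast
    then show ?thesis
      using measurable_compose[OF X_measurable] by (simp cong: measurable_cong)
  qed
  have em: "emeasure (distr (\<nu> \<omega>) ?N ?s) A = emeasure (\<nu> \<omega>) (?s -` A)" if "\<omega> \<in> space P" "A \<in> sets ?N" for \<omega> A
  proof -
    have "sets (\<nu> \<omega>) = sets \<mu>" using nu_sets[OF that(1)] by (simp add: sets_mu)
    then have "measurable (\<nu> \<omega>) ?N = measurable \<mu> \<mu>" and sp: "space (\<nu> \<omega>) = K"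
      using measurable_cong_sets[OF _ sets_mu[symmetric]] sets_eq_imp_space_eq[of "\<nu> \<omega>" \<mu>] by simp_all
    then have m: "?s \<in> measurable (\<nu> \<omega>) ?N" using reflection_measurable by blast
    have A: "A \<in> sets \<mu>" unfolding sets_mu by (rule that(2))
    have "?s -` A \<subseteq> K" using reflection_vimage_sets[OF A] unfolding sets_mu_iff by blast
    then show ?thesis unfolding emeasure_distr[OF m that(2)] sp by (simp add: Int_absorb2)
  qed
  show ?thesis
  proof (rule P.distr_measure_algebra_eqI)
    show "\<nu> \<in> measurable P (measure_algebra ?N)"
      using nu_sets em_meas by (intro measurable_measure_algebraI) (auto simp: sets_mu)
    show "(\<lambda>\<omega>. distr (\<nu> \<omega>) ?N ?s) \<in> measurable P (measure_algebra ?N)"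
    proof (rule measurable_measure_algebraI)
      fix A assume A: "A \<in> sets ?N"
      then have "(\<lambda>\<omega>. emeasure (\<nu> \<omega>) (?s -` A)) \<in> borel_measurable P"
        by (intro em_meas reflection_vimage_sets) (simp add: sets_mu)
      then show "(\<lambda>\<omega>. emeasure (distr (\<nu> \<omega>) ?N ?s) A) \<in> borel_measurable P"
        using em[OF _ A] by (simp cong: measurable_cong)
    qed simp
    fix I :: "(real^2) set set" and C :: "(real^2) set \<Rightarrow> ennreal set"
    assume I: "finite I" "I \<subseteq> sets ?N" and C: "\<And>A. A \<in> I \<Longrightarrow> C A \<in> sets borel"
    have "{\<omega> \<in> space P. \<forall>A\<in>I. emeasure (distr (\<nu> \<omega>) ?N ?s) A \<in> C A} = {\<omega> \<in> space P. \<forall>A\<in>I. emeasure (\<nu> \<omega>) (?s -` A) \<in> C A}"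
      using I(2) em by (auto simp: subset_iff)
    then show "emeasure P {\<omega> \<in> space P. \<forall>A\<in>I. emeasure (\<nu> \<omega>) A \<in> C A} = emeasure P {\<omega> \<in> space P. \<forall>A\<in>I. emeasure (distr (\<nu> \<omega>) ?N ?s) A \<in> C A}"
      using finite_dimensional_law[OF I(1) _ C] I(2) by (simp add: sets_mu)
  qed
qed

end

theorem theorem14:
  fixes p :: "3 \<Rightarrow> real^2" and K :: "(real^2) set" and \<mu> :: "(real^2) measure"
    and lam :: "nat \<Rightarrow> real" and \<phi> :: "nat \<Rightarrow> real^2 \<Rightarrow> real"
    and q :: "real \<Rightarrow> real^2 \<Rightarrow> real^2 \<Rightarrow> real"
    and P :: "'w measure" and \<xi> :: "nat \<Rightarrow> 'w \<Rightarrow> real"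
    and J :: "(real^2 \<Rightarrow> real) \<Rightarrow> 'b::{banach, second_countable_topology}"
    and h :: "'w \<Rightarrow> 'b" and \<nu> :: "'w \<Rightarrow> (real^2) measure"
    and C\<^sub>0 \<gamma> \<epsilon> :: real and i :: 3
  assumes "unit_triangle p" and "is_gasket p K" and "is_self_similar_measure p K \<mu>"
    and "is_eigenbasis p K \<mu> lam \<phi>"
    and "is_heat_kernel p K \<mu> q"
    and "C\<^sub>0 > 0"
    and "\<And>x y. x \<in> K \<Longrightarrow> y \<in> K \<Longrightarrow> x \<noteq> y \<Longrightarrow>
           riesz_kernel q d_S x y \<le> C\<^sub>0 * (1 + ln (1 / dist x y))"
    and "\<epsilon> > 0" and "is_neg_sobolev_completion \<mu> lam \<phi> \<epsilon> J"
    and "prob_space P" and "iid_std_normal P \<xi>"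
    and "is_fgff P lam \<phi> \<xi> J h"
    and "\<bar>\<gamma>\<bar> < sqrt (d_H / C\<^sub>0)"
    and "is_lqg_measure K \<mu> (riesz_kernel q d_S) J P h \<gamma> \<nu>"
  shows "distr P (measure_algebra (borel_on K)) \<nu> =
         distr P (measure_algebra (borel_on K))
           (\<lambda>\<omega>. distr (\<nu> \<omega>) (borel_on K) (sg_reflection p i))"
proof -
  interpret sierpinski_lqg p K \<mu> lam \<phi> q \<epsilon> J P \<xi> h \<nu> \<gamma> i
    using assms
    by (intro sierpinski_lqg.intro sierpinski_lqg_axioms.intro sierpinski_completion.intro
      sierpinski_completion_axioms.intro sierpinski_heat.intro sierpinski_heat_axioms.intro
      sierpinski_eigen.intro sierpinski_eigen_axioms.intro sierpinski.intro)
  show ?thesis by (rule law_reflection_invariant)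
qed

end
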